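(* Let $k\ge2$ be a constant. If any of #F$k$-OV, #F$k$-SUM, or #F$k$-XOR can be solved in $T(n)$ time then #F$k$-$f$ can be solved in $\tilde{O}(T(n))$ time, for every function $f:(\{0,1\}^b)^k\to\{0,1\}$.
   Context: $g=o(\lg n/\lg\lg n)$, $b=o(\lg n)$. A $(g,b)$-factored vector $v$ is a $g$-tuple of sets $v[i]\subseteq\{0,1\}^b$. For $f:(\{0,1\}^b)^k\to\{0,1\}$, #F$k$-$f$: given $k$ sets $V_1,\dots,V_k$ of $n$ factored vectors each, output $\sum_{v_1\in V_1,\dots,v_k\in V_k}\prod_{i=1}^g\sum_{w_1\in v_1[i],\dots,w_k\in v_k[i]}f(w_1,\dots,w_k)$. #F$k$-OV: $f=1$ iff $\sum_{a=1}^b\prod_j w_j[a]=0$. #F$k$-XOR: $f=1$ iff $w_1\oplus\cdots\oplus w_k=\vec 0$. #F$k$-SUM: $f=1$ iff $w_1+\cdots+w_k=0$ as $b$-bit numbers.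
   Formalization: Since an arbitrary family f may be uncomputable (making the literal claim false), the input of #Fk-f here also contains the truth table of f, with 2^{kb} = n^{o(1)} entries. *)

theory Defs
  imports Complex_Main "HOL-Library.Landau_Symbols"
begin

section \<open>Factored problems\<close>

type_synonym bits = "bool list"
type_synonym fvec = "bits set list"

definition fvecs :: "nat \<Rightarrow> nat \<Rightarrow> fvec set" where
  "fvecs g b = {v. length v = g \<and> (\<forall>A\<in>set v. A \<subseteq> {w. length w = b})}"

definition fk_instance :: "nat \<Rightarrow> nat \<Rightarrow> nat \<Rightarrow> nat \<Rightarrow> fvec set list \<Rightarrow> bool" where
  "fk_instance k n g b Vs \<longleftrightarrow>
     length Vs = k \<and> (\<forall>V\<in>set Vs. V \<subseteq> fvecs g b \<and> card V = n)"

text \<open>\<^const>\<open>listset\<close> \<open>[A\<^sub>1, \<dots>, A\<^sub>k]\<close> is the set of all \<open>[a\<^sub>1, \<dots>, a\<^sub>k]\<close> with \<open>a\<^sub>j \<in> A\<^sub>j\<close>.\<close>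

definition factored_count :: "(bits list \<Rightarrow> bool) \<Rightarrow> nat \<Rightarrow> fvec set list \<Rightarrow> nat" where
  "factored_count f g Vs =
     (\<Sum>vs\<in>listset Vs. \<Prod>i<g. \<Sum>ws\<in>listset (map (\<lambda>v. v ! i) vs). of_bool (f ws))"

text \<open>Bit strings are read as numbers with the least significant bit first.\<close>

definition bits_val :: "bits \<Rightarrow> nat" where
  "bits_val w = horner_sum of_bool 2 w"

definition f_OV :: "nat \<Rightarrow> bits list \<Rightarrow> bool" where
  "f_OV b ws \<longleftrightarrow> (\<Sum>a<b. \<Prod>w\<leftarrow>ws. of_bool (w ! a) :: nat) = 0"

definition f_XOR :: "nat \<Rightarrow> bits list \<Rightarrow> bool" where
  "f_XOR b ws \<longleftrightarrow>
     fold (map2 (\<lambda>x y. x \<noteq> y)) ws (replicate b False) = replicate b False"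

text \<open>Addition of \<open>b\<close>-bit numbers is addition modulo \<open>2 ^ b\<close>.\<close>

definition f_SUM :: "nat \<Rightarrow> bits list \<Rightarrow> bool" where
  "f_SUM b ws \<longleftrightarrow> (\<Sum>w\<leftarrow>ws. bits_val w) mod 2 ^ b = 0"


section \<open>Word RAM\<close>

datatype binop =
  Add | Sub | Mul | Div | Mod | BitAnd | BitOr | BitXor | Shl | Shr | Less | Equal

fun binop_val :: "binop \<Rightarrow> nat \<Rightarrow> nat \<Rightarrow> nat" where
  "binop_val Add x y = x + y"
| "binop_val Sub x y = x - y"
| "binop_val Mul x y = x * y"
| "binop_val Div x y = x div y"
| "binop_val Mod x y = x mod y"
| "binop_val BitAnd x y = and x y"
| "binop_val BitOr x y = or x y"
| "binop_val BitXor x y = xor x y"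
| "binop_val Shl x y = push_bit y x"
| "binop_val Shr x y = drop_bit y x"
| "binop_val Less x y = of_bool (x < y)"
| "binop_val Equal x y = of_bool (x = y)"

text \<open>
  Register arguments are register names. \<open>Load r a\<close> and \<open>Store a r\<close> access the memory cell whose
  address is held in register \<open>a\<close>; conditions test whether a register is nonzero.
\<close>

datatype com =
  Const nat nat
| Op binop nat nat nat
| Load nat nat
| Store nat nat
| Seq com com
| Cond nat com com
| While nat com

type_synonym state = "(nat \<Rightarrow> nat) \<times> (nat \<Rightarrow> nat)"

text \<open>
  \<open>exec w P s t s'\<close>: on a machine with word length \<open>w\<close>, program \<open>P\<close> started in state
  \<open>s = (registers, memory)\<close> halts in state \<open>s'\<close> after exactly \<open>t\<close> unit-cost steps. Every value put
  into a register, hence also every address used and every value stored, has to fit into a word;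
  a computation that overflows has no derivation.
\<close>

inductive exec :: "nat \<Rightarrow> com \<Rightarrow> state \<Rightarrow> nat \<Rightarrow> state \<Rightarrow> bool" for w :: nat where
  Const: "c < 2 ^ w \<Longrightarrow> exec w (Const r c) (R, M) 1 (R(r := c), M)"
| Op: "binop_val bop (R x) (R y) < 2 ^ w \<Longrightarrow>
    exec w (Op bop r x y) (R, M) 1 (R(r := binop_val bop (R x) (R y)), M)"
| Load: "M (R a) < 2 ^ w \<Longrightarrow> exec w (Load r a) (R, M) 1 (R(r := M (R a)), M)"
| Store: "exec w (Store a r) (R, M) 1 (R, M(R a := R r))"
| Seq: "exec w P s t s' \<Longrightarrow> exec w Q s' u s'' \<Longrightarrow> exec w (Seq P Q) s (t + u) s''"
| CondTrue: "R r \<noteq> 0 \<Longrightarrow> exec w P (R, M) t s' \<Longrightarrow> exec w (Cond r P Q) (R, M) (Suc t) s'"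
| CondFalse: "R r = 0 \<Longrightarrow> exec w Q (R, M) t s' \<Longrightarrow> exec w (Cond r P Q) (R, M) (Suc t) s'"
| WhileFalse: "R r = 0 \<Longrightarrow> exec w (While r P) (R, M) 1 (R, M)"
| WhileTrue: "R r \<noteq> 0 \<Longrightarrow> exec w P (R, M) t s' \<Longrightarrow> exec w (While r P) s' u s'' \<Longrightarrow>
    exec w (While r P) (R, M) (Suc (t + u)) s''"

definition initial :: "nat list \<Rightarrow> state" where
  "initial xs = ((\<lambda>_. 0), (\<lambda>i. if i < length xs then xs ! i else 0))"

text \<open>
  The counts need not fit into a constant number of words. A result is left in memory as
  its number of binary digits (without leading zeros), followed by the digits, least significant
  one first.
\<close>

definition result_in :: "(nat \<Rightarrow> nat) \<Rightarrow> nat \<Rightarrow> bool" where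
  "result_in M x \<longleftrightarrow>
     M 0 = (LEAST l. x < 2 ^ l) \<and> (\<forall>i < M 0. M (Suc i) = of_bool (bit x i))"

definition computes_within :: "nat \<Rightarrow> com \<Rightarrow> nat list \<Rightarrow> nat \<Rightarrow> nat \<Rightarrow> bool" where
  "computes_within w P xs t x \<longleftrightarrow>
     (\<exists>t' R M. t' \<le> t \<and> exec w P (initial xs) t' (R, M) \<and> result_in M x)"


section \<open>Solving factored problems on a word RAM\<close>

text \<open>Sets are presented as lists without repetitions, in arbitrary order.\<close>

definition enc_bits_set :: "bits set \<Rightarrow> nat list \<Rightarrow> bool" where
  "enc_bits_set A xs \<longleftrightarrow>
     (\<exists>ws. distinct ws \<and> set ws = A \<and> xs = length ws # map bits_val ws)"

definition enc_fvec :: "fvec \<Rightarrow> nat list \<Rightarrow> bool" where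
  "enc_fvec v xs \<longleftrightarrow> (\<exists>xss. list_all2 enc_bits_set v xss \<and> xs = concat xss)"

definition enc_fvec_set :: "fvec set \<Rightarrow> nat list \<Rightarrow> bool" where
  "enc_fvec_set V xs \<longleftrightarrow>
     (\<exists>vs xss. distinct vs \<and> set vs = V \<and> list_all2 enc_fvec vs xss \<and> xs = concat xss)"

definition enc_instance :: "fvec set list \<Rightarrow> nat list \<Rightarrow> bool" where
  "enc_instance Vs xs \<longleftrightarrow> (\<exists>xss. list_all2 enc_fvec_set Vs xss \<and> xs = concat xss)"

text \<open>Entry \<open>\<Sum>j<k. bits_val w\<^sub>j * 2 ^ (j * b)\<close> of the truth table is \<open>f [w\<^sub>0, \<dots>, w\<^bsub>k-1\<^esub>]\<close>.\<close>

definition truth_table :: "nat \<Rightarrow> nat \<Rightarrow> (bits list \<Rightarrow> bool) \<Rightarrow> nat list" where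
  "truth_table k b f =
     map (\<lambda>x. of_bool (f (map (\<lambda>j. map (\<lambda>a. bit x (j * b + a)) [0..<b]) [0..<k]))) [0..<2 ^ (k * b)]"

definition admissible :: "(nat \<Rightarrow> nat) \<Rightarrow> (nat \<Rightarrow> nat) \<Rightarrow> bool" where
  "admissible g b \<longleftrightarrow>
     (\<lambda>n. real (g n)) \<in> o(\<lambda>n. log 2 (real n) / log 2 (log 2 (real n))) \<and>
     (\<lambda>n. real (b n)) \<in> o(\<lambda>n. log 2 (real n))"

text \<open>
  \<open>f n b\<close> is the function on \<open>({0,1}\<^sup>b)\<^sup>k\<close> used on instances with \<open>n\<close> vectors per set, \<open>aux n b\<close> is
  additional input, and \<open>\<T>\<close> is a class of time bounds such as \<open>O(T)\<close>. A single program has to solve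
  all instances; as \<open>g\<close> and \<open>b\<close> are restricted only asymptotically, the implied constants of
  the running time and of the word length \<open>O(log n)\<close> may depend on the functions \<open>g\<close> and \<open>b\<close>.
\<close>

definition fk_solvable ::
  "nat \<Rightarrow> (nat \<Rightarrow> nat \<Rightarrow> bits list \<Rightarrow> bool) \<Rightarrow> (nat \<Rightarrow> nat \<Rightarrow> nat list) \<Rightarrow> (nat \<Rightarrow> real) set \<Rightarrow> bool" where
  "fk_solvable k f aux \<T> \<longleftrightarrow>
     (\<exists>P. \<forall>g b. admissible g b \<longrightarrow>
       (\<exists>t w. (\<lambda>n. real (t n)) \<in> \<T> \<and> (\<lambda>n. real (w n)) \<in> O(\<lambda>n. log 2 (real n)) \<and>
         (\<forall>n Vs xs. fk_instance k n (g n) (b n) Vs \<longrightarrow> enc_instance Vs xs \<longrightarrow>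
            computes_within (w n) P ([n, g n, b n] @ aux n (b n) @ xs) (t n)
              (factored_count (f n (b n)) (g n) Vs))))"

definition FkOV_solvable :: "nat \<Rightarrow> (nat \<Rightarrow> real) set \<Rightarrow> bool" where
  "FkOV_solvable k = fk_solvable k (\<lambda>n. f_OV) (\<lambda>n b. [])"

definition FkSUM_solvable :: "nat \<Rightarrow> (nat \<Rightarrow> real) set \<Rightarrow> bool" where
  "FkSUM_solvable k = fk_solvable k (\<lambda>n. f_SUM) (\<lambda>n b. [])"

definition FkXOR_solvable :: "nat \<Rightarrow> (nat \<Rightarrow> real) set \<Rightarrow> bool" where
  "FkXOR_solvable k = fk_solvable k (\<lambda>n. f_XOR) (\<lambda>n b. [])"

text \<open>
  An arbitrary \<open>f\<close> need not be computable, so an algorithm for it needs access to \<open>f\<close>: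
  its truth table, of size \<open>2 ^ (k * b)\<close>, is part of the input.
\<close>

definition Fkf_solvable ::
  "nat \<Rightarrow> (nat \<Rightarrow> nat \<Rightarrow> bits list \<Rightarrow> bool) \<Rightarrow> (nat \<Rightarrow> real) set \<Rightarrow> bool" where
  "Fkf_solvable k f = fk_solvable k f (\<lambda>n b. truth_table k b (f n b))"

definition soft_O :: "(nat \<Rightarrow> real) \<Rightarrow> (nat \<Rightarrow> real) set" where
  "soft_O T = (\<Union>p::nat. O(\<lambda>n. T n * log 2 (real n) ^ p))"

end

theory Submission
  imports Defs "HOL-Real_Asymp.Real_Asymp"
begin

text \<open>
  Read a tuple of \<open>k\<close> words of length \<open>b\<close> as one number \<open>u < 2 ^ (k * b)\<close>. A word \<open>w\<close> of a vector in the first set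
  is replaced by the codes of all \<open>u\<close> with first digit \<open>w\<close> and \<open>f u = 1\<close>, and a word of a vector in the \<open>j\<close>-th set by a
  code of the digits of \<open>u\<close> that it determines; the second set guesses the first digit, so that each satisfying
  tuple is counted exactly once. The codes are chosen such that \<open>OV\<close>, \<open>XOR\<close> or \<open>SUM\<close> holds iff all digits agree.
  In the first set an additional junk word, which never contributes, keeps different vectors different.
  On the word RAM the new instance replaces the old one in memory, all other cells and registers are
  cleared, and then the given program is run.

  The reduction takes time \<open>O((n * g + 1) * 2 ^ (k * b))\<close>. This is \<open>O(T)\<close>, because \<open>T\<close> bounds the running time for all
  admissible parameters: on suitable instances with larger words, a cell that is not loaded could be changed so
  that the count changes, hence a solver needs time \<open>n * 2 ^ h\<close> for every \<open>h = o(log n)\<close>.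
\<close>

section \<open>Properties of executions\<close>

text \<open>The code of \<open>u\<close> has to keep digit \<open>0\<close>, although no word
  outside the first set depends on it: otherwise two words of one component whose remaining digits
  agree would share a code, and a set would count them once. A digit that is kept must also be
  cancelled by someone, which is the purpose of the guess in the second set; exactly one of the
  \<open>2 ^ b\<close> guesses is right. The reduction costs a factor of \<open>2 ^ (k * b)\<close>.
  For \<open>b = o(log n)\<close> this is \<open>n ^ o(1)\<close>, but it may exceed every power of
  \<open>log n\<close>, so \<open>soft_O\<close> does not absorb it, and nothing is assumed about
  \<open>T\<close>. What helps is that \<open>T\<close> is fixed before \<open>g\<close> and
  \<open>b\<close>: the same program, run with one component per vector and somewhat longer words,
  has to obey the same class \<open>O(T)\<close>, and that it must read its input becomes a lower
  bound on \<open>T\<close>. The longer words leave room for about \<open>log (log n)\<close> extra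
  bits, which are what it takes to have \<open>n\<close> different vectors that all contain the
  attacked values.\<close>

inductive_cases exec_ConstE: "exec w (Const r c) s t s'"
inductive_cases exec_OpE: "exec w (Op bop r x y) s t s'"
inductive_cases exec_LoadE: "exec w (Load r a) s t s'"
inductive_cases exec_StoreE: "exec w (Store a r) s t s'"
inductive_cases exec_SeqE: "exec w (Seq P Q) s t s'"
inductive_cases exec_CondE: "exec w (Cond r P Q) s t s'"
inductive_cases exec_WhileE: "exec w (While r P) s t s'"

lemmas exec_intros = exec.Store[unfolded One_nat_def] exec.WhileFalse[unfolded One_nat_def]
  exec.CondTrue exec.CondFalse

text \<open>A longer word only relaxes the overflow tests. The reduction and the given solver come
  with different word lengths, and their composition runs with the sum of the two.\<close>

lemma exec_word_mono: "exec w P s t s' \<Longrightarrow> w \<le> w' \<Longrightarrow> exec w' P s t s'"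
proof (induction rule: exec.induct)
  case (Const c r R M)
  then show ?case by (meson exec.Const less_le_trans one_le_numeral power_increasing)
next
  case (Op bop R x y r M)
  then show ?case by (meson exec.Op less_le_trans one_le_numeral power_increasing)
next
  case (Load M R a r)
  then show ?case by (meson exec.Load less_le_trans one_le_numeral power_increasing)
next
  case (Seq P s t s' Q u s'')
  then show ?case using exec.Seq by blast
next
  case (WhileTrue R r P M t s' u s'')
  then show ?case using exec.WhileTrue by blast
qed (simp_all add: exec_intros)

text \<open>Identifies the run that insensitivity predicts on a modified input with the run that the
  solver is assumed to have there.\<close>

lemma exec_deterministic: "exec w P s t s' \<Longrightarrow> exec w P s u s'' \<Longrightarrow> u = t \<and> s'' = s'"
proof (induction arbitrary: u s'' rule: exec.induct)
  case (Seq P s t s' Q u s'' u' s3)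
  from Seq.prems show ?case by (rule exec_SeqE) (use Seq.IH in blast)
next
  case (WhileTrue R r P M t s' u s'' u' s3)
  from WhileTrue.prems show ?case
  proof (rule exec_WhileE)
    fix R' M' t' s2 u2
    assume *: "(R, M) = (R', M')" "u' = Suc (t' + u2)" "exec w P (R', M') t' s2"
      "exec w (While r P) s2 u2 s3"
    then have "t' = t \<and> s2 = s'" using WhileTrue.IH(1) by blast
    then show ?thesis using WhileTrue.IH(2)[of u2 s3] * by simp
  qed (use WhileTrue.hyps(1) in simp)
next
  case (CondTrue R r P M t s' Q)
  from CondTrue.prems show ?case
  proof (rule exec_CondE)
    fix R' M' t'
    assume *: "(R, M) = (R', M')" "u = Suc t'" "exec w P (R', M') t' s''"
    then show ?thesis using CondTrue.IH[of t' s''] by simp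
  qed (use CondTrue.hyps(1) in simp)
next
  case (CondFalse R r Q M t s' P)
  from CondFalse.prems show ?case
  proof (rule exec_CondE)
    fix R' M' t'
    assume *: "(R, M) = (R', M')" "u = Suc t'" "exec w Q (R', M') t' s''"
    then show ?thesis using CondFalse.IH[of t' s''] by simp
  qed (use CondFalse.hyps(1) in simp)
next
  case (WhileFalse R r P M)
  from WhileFalse.prems show ?case
    by (rule exec_WhileE) (use WhileFalse.hyps in simp_all)
qed (erule exec_ConstE exec_OpE exec_LoadE exec_StoreE, simp)+

text \<open>If the initial content of cell \<open>c\<close> does not influence a run, then the final content is either
  still the initial one or has been overwritten independently of the initial one.\<close>

definition insensitive :: "nat \<Rightarrow> com \<Rightarrow> state \<Rightarrow> nat \<Rightarrow> state \<Rightarrow> nat \<Rightarrow> bool" where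
  "insensitive w P s t s' c \<longleftrightarrow>
     (\<forall>v. exec w P (fst s, (snd s)(c := v)) t s' \<or>
        snd s' c = snd s c \<and> exec w P (fst s, (snd s)(c := v)) t (fst s', (snd s')(c := v)))"

text \<open>Once the cell has been overwritten, both runs are in the same state and \<open>Q\<close>
  runs as before; until then they differ in cell \<open>c\<close> only, and the insensitivity of
  \<open>Q\<close> takes over.\<close>

lemma insensitive_Seq:
  assumes "exec w Q s' u s''" "insensitive w P s t s' c" "insensitive w Q s' u s'' c"
  shows "insensitive w (Seq P Q) s (t + u) s'' c"
  unfolding insensitive_def
proof
  fix v
  note assms(2)[unfolded insensitive_def, rule_format, of v]
  moreover note assms(3)[unfolded insensitive_def, rule_format, of v]
  moreover note exec.Seq[of w P "(fst s, (snd s)(c := v))" t] assms(1)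
  ultimately show "exec w (Seq P Q) (fst s, (snd s)(c := v)) (t + u) s'' \<or>
    snd s'' c = snd s c \<and> exec w (Seq P Q) (fst s, (snd s)(c := v)) (t + u) (fst s'', (snd s'')(c := v))"
    by metis
qed

lemma insensitive_While:
  assumes "R r \<noteq> 0" "exec w (While r P) s' u s''"
    "insensitive w P (R, M) t s' c" "insensitive w (While r P) s' u s'' c"
  shows "insensitive w (While r P) (R, M) (Suc (t + u)) s'' c"
  unfolding insensitive_def
proof
  fix v
  note assms(3)[unfolded insensitive_def fst_conv snd_conv, rule_format, of v]
  moreover note assms(4)[unfolded insensitive_def, rule_format, of v]
  moreover note exec.WhileTrue[of R r w P "M(c := v)" t, OF assms(1)] assms(2)
  ultimately show "exec w (While r P) (fst (R, M), (snd (R, M))(c := v)) (Suc (t + u)) s'' \<or>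
    snd s'' c = snd (R, M) c \<and>
    exec w (While r P) (fst (R, M), (snd (R, M))(c := v)) (Suc (t + u)) (fst s'', (snd s'')(c := v))"
    unfolding fst_conv snd_conv by metis
qed

lemma exec_Cond:
  "exec w (if R r \<noteq> 0 then P else Q) (R, M) t s' \<Longrightarrow> exec w (Cond r P Q) (R, M) (Suc t) s'"
  by (cases "R r = 0") (simp_all add: exec.CondTrue exec.CondFalse)

lemma insensitive_Cond:
  assumes "insensitive w (if R r \<noteq> 0 then P else Q) (R, M) t s' c"
  shows "insensitive w (Cond r P Q) (R, M) (Suc t) s' c"
  unfolding insensitive_def
proof
  fix v
  show "exec w (Cond r P Q) (fst (R, M), (snd (R, M))(c := v)) (Suc t) s' \<or>
    snd s' c = snd (R, M) c \<and>
    exec w (Cond r P Q) (fst (R, M), (snd (R, M))(c := v)) (Suc t) (fst s', (snd s')(c := v))"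
    using assms[unfolded insensitive_def, rule_format, of v] exec_Cond[of w R r P Q "M(c := v)" t]
    unfolding fst_conv snd_conv by blast
qed

text \<open>\<open>A\<close> collects the cells that are loaded, at most one per step. A
  \<open>Store\<close> contributes nothing: it either erases the modification or commutes with it.
  Addresses and conditions depend on registers only.\<close>

lemma exec_insensitive:
  assumes "exec w P s t s'"
  shows "\<exists>A. finite A \<and> card A \<le> t \<and> (\<forall>c. c \<notin> A \<longrightarrow> insensitive w P s t s' c)"
  using assms
proof (induction rule: exec.induct)
  case (Const c r R M)
  then have "insensitive w (Const r c) (R, M) 1 (R(r := c), M) a" for a
    unfolding insensitive_def fst_conv snd_conv by (blast intro: exec.Const)
  then show ?case by (metis card.empty finite.emptyI zero_le)
next
  case (Op bop R x y r M)
  then have "insensitive w (Op bop r x y) (R, M) 1 (R(r := binop_val bop (R x) (R y)), M) a" for a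
    unfolding insensitive_def fst_conv snd_conv by (blast intro: exec.Op)
  then show ?case by (metis card.empty finite.emptyI zero_le)
next
  case (Load M R a r)
  have "insensitive w (Load r a) (R, M) 1 (R(r := M (R a)), M) c" if "c \<notin> {R a}" for c
    unfolding insensitive_def fst_conv snd_conv
    using exec.Load[of "M(c := v)" R a w r for v] Load that by simp
  moreover have "finite {R a}" "card {R a} \<le> 1" by simp_all
  ultimately show ?case by blast
next
  case (Store a r R M)
  have "exec w (Store a r) (R, M(c := v)) 1 (R, M(c := v, R a := R r))" for c v
    by (rule exec.Store)
  moreover have "M(c := v, R a := R r) = M(R a := R r) \<or>
      M(c := v, R a := R r) = M(R a := R r, c := v) \<and> (M(R a := R r)) c = M c" for c v
    by (cases "c = R a") (simp_all add: fun_upd_twist)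
  ultimately have "insensitive w (Store a r) (R, M) 1 (R, M(R a := R r)) c" for c
    unfolding insensitive_def fst_conv snd_conv by metis
  then show ?case by (metis card.empty finite.emptyI zero_le)
next
  case (Seq P s t s' Q u s'')
  then obtain A B where AB: "finite A" "card A \<le> t" "\<And>c. c \<notin> A \<Longrightarrow> insensitive w P s t s' c"
    "finite B" "card B \<le> u" "\<And>c. c \<notin> B \<Longrightarrow> insensitive w Q s' u s'' c" by blast
  have "insensitive w (Seq P Q) s (t + u) s'' c" if "c \<notin> A \<union> B" for c
    using that by (intro insensitive_Seq[OF Seq.hyps(2)] AB(3,6)) simp_all
  moreover have "finite (A \<union> B)" "card (A \<union> B) \<le> t + u"
    using AB(1,2,4,5) card_Un_le[of A B] by auto
  ultimately show ?case by blast
next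
  case (CondTrue R r P M t s' Q)
  then obtain A where "finite A" "card A \<le> t" "\<And>c. c \<notin> A \<Longrightarrow> insensitive w P (R, M) t s' c"
    by blast
  moreover from this have "c \<notin> A \<Longrightarrow> insensitive w (Cond r P Q) (R, M) (Suc t) s' c" for c
    using insensitive_Cond[of w R r P Q] CondTrue.hyps(1) by simp
  ultimately show ?case using le_SucI by blast
next
  case (CondFalse R r Q M t s' P)
  then obtain A where "finite A" "card A \<le> t" "\<And>c. c \<notin> A \<Longrightarrow> insensitive w Q (R, M) t s' c"
    by blast
  moreover from this have "c \<notin> A \<Longrightarrow> insensitive w (Cond r P Q) (R, M) (Suc t) s' c" for c
    using insensitive_Cond[of w R r P Q] CondFalse.hyps(1) by simp
  ultimately show ?case using le_SucI by blast
next
  case (WhileFalse R r P M)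
  then have "insensitive w (While r P) (R, M) 1 (R, M) c" for c
    unfolding insensitive_def fst_conv snd_conv by (blast intro: exec.WhileFalse)
  then show ?case by (metis card.empty finite.emptyI zero_le)
next
  case (WhileTrue R r P M t s' u s'')
  then obtain A B where AB: "finite A" "card A \<le> t" "\<And>c. c \<notin> A \<Longrightarrow> insensitive w P (R, M) t s' c"
    "finite B" "card B \<le> u" "\<And>c. c \<notin> B \<Longrightarrow> insensitive w (While r P) s' u s'' c" by blast
  have "insensitive w (While r P) (R, M) (Suc (t + u)) s'' c" if "c \<notin> A \<union> B" for c
    using that by (intro insensitive_While[of R r w P s' u s'' M t, OF WhileTrue.hyps(1,3)] AB(3,6)) simp_all
  moreover have "finite (A \<union> B)" "card (A \<union> B) \<le> Suc (t + u)"
    using AB(1,2,4,5) card_Un_le[of A B] by auto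
  ultimately show ?case by blast
qed

section \<open>Weakest preconditions with running time\<close>

definition wp :: "nat \<Rightarrow> com \<Rightarrow> (nat \<Rightarrow> state \<Rightarrow> bool) \<Rightarrow> state \<Rightarrow> bool" where
  "wp w P Q s \<longleftrightarrow> (\<exists>t s'. exec w P s t s' \<and> Q t s')"

lemma wpI: "exec w P s t s' \<Longrightarrow> Q t s' \<Longrightarrow> wp w P Q s"
  unfolding wp_def by blast

lemma wpE: "wp w P Q s \<Longrightarrow> (\<And>t s'. exec w P s t s' \<Longrightarrow> Q t s' \<Longrightarrow> thesis) \<Longrightarrow> thesis"
  unfolding wp_def by blast

text \<open>This rule and its companions are equivalences, so that straight-line code is executed
  symbolically by rewriting and only loops need an invariant.\<close>

lemma wp_Const: "wp w (Const r c) Q (R, M) \<longleftrightarrow> c < 2 ^ w \<and> Q 1 (R(r := c), M)"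
proof
  assume "wp w (Const r c) Q (R, M)"
  then show "c < 2 ^ w \<and> Q 1 (R(r := c), M)"
    by (elim wpE exec_ConstE) simp
qed (auto intro!: wpI[OF exec.Const])

lemma wp_Op: "wp w (Op bop r x y) Q (R, M) \<longleftrightarrow>
    binop_val bop (R x) (R y) < 2 ^ w \<and> Q 1 (R(r := binop_val bop (R x) (R y)), M)"
proof
  assume "wp w (Op bop r x y) Q (R, M)"
  then show "binop_val bop (R x) (R y) < 2 ^ w \<and> Q 1 (R(r := binop_val bop (R x) (R y)), M)"
    by (elim wpE exec_OpE) simp
qed (auto intro!: wpI[OF exec.Op])

lemma wp_Load: "wp w (Load r a) Q (R, M) \<longleftrightarrow> M (R a) < 2 ^ w \<and> Q 1 (R(r := M (R a)), M)"
proof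
  assume "wp w (Load r a) Q (R, M)"
  then show "M (R a) < 2 ^ w \<and> Q 1 (R(r := M (R a)), M)"
    by (elim wpE exec_LoadE) simp
qed (auto intro!: wpI[OF exec.Load])

lemma wp_Store: "wp w (Store a r) Q (R, M) \<longleftrightarrow> Q 1 (R, M(R a := R r))"
proof
  assume "wp w (Store a r) Q (R, M)"
  then show "Q 1 (R, M(R a := R r))"
    by (elim wpE exec_StoreE) simp
qed (auto intro!: wpI[OF exec.Store])

lemma wp_Seq: "wp w (Seq P P') Q = wp w P (\<lambda>t. wp w P' (\<lambda>u. Q (t + u)))"
proof (intro ext iffI)
  fix s
  assume "wp w (Seq P P') Q s"
  then show "wp w P (\<lambda>t. wp w P' (\<lambda>u. Q (t + u))) s"
    by (elim wpE exec_SeqE) (simp add: wpI)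
next
  fix s
  assume "wp w P (\<lambda>t. wp w P' (\<lambda>u. Q (t + u))) s"
  then show "wp w (Seq P P') Q s"
    by (elim wpE) (rule wpI[OF exec.Seq])
qed

lemma wp_Cond: "wp w (Cond r P P') Q (R, M) \<longleftrightarrow> wp w (if R r \<noteq> 0 then P else P') (\<lambda>t. Q (Suc t)) (R, M)"
proof
  assume "wp w (Cond r P P') Q (R, M)"
  then show "wp w (if R r \<noteq> 0 then P else P') (\<lambda>t. Q (Suc t)) (R, M)"
    by (elim wpE exec_CondE) (simp_all add: wpI)
next
  assume "wp w (if R r \<noteq> 0 then P else P') (\<lambda>t. Q (Suc t)) (R, M)"
  then show "wp w (Cond r P P') Q (R, M)"
    by (elim wpE) (rule wpI[OF exec_Cond])
qed

lemmas wp_simps = wp_Const wp_Op wp_Load wp_Store wp_Seq wp_Cond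

lemma wp_mono: "wp w P Q s \<Longrightarrow> (\<And>t s'. Q t s' \<Longrightarrow> Q' t s') \<Longrightarrow> wp w P Q' s"
  unfolding wp_def by blast

section \<open>Programs\<close>

abbreviation (input) seq :: "com \<Rightarrow> com \<Rightarrow> com" (infixr ";;" 60) where
  "P ;; Q \<equiv> Seq P Q"

text \<open>Register names. Register \<open>0\<close> is never written and serves as the constant zero.\<close>

abbreviation (input) "rOne \<equiv> 28 :: nat"
abbreviation (input) "rn \<equiv> 2 :: nat"
abbreviation (input) "rg \<equiv> 3 :: nat"
abbreviation (input) "rb \<equiv> 4 :: nat"
abbreviation (input) "rin \<equiv> 5 :: nat"
abbreviation (input) "rout \<equiv> 6 :: nat"
abbreviation (input) "rS \<equiv> 7 :: nat"
abbreviation (input) "rm \<equiv> 8 :: nat"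
abbreviation (input) "ry \<equiv> 9 :: nat"
abbreviation (input) "ru \<equiv> 10 :: nat"
abbreviation (input) "rw \<equiv> 11 :: nat"
abbreviation (input) "rt \<equiv> 12 :: nat"
abbreviation (input) "rs \<equiv> 13 :: nat"
abbreviation (input) "rh \<equiv> 14 :: nat"
abbreviation (input) "rY \<equiv> 15 :: nat"
abbreviation (input) "rP \<equiv> 16 :: nat"
abbreviation (input) "rQ \<equiv> 17 :: nat"
abbreviation (input) "ra \<equiv> 18 :: nat"
abbreviation (input) "rp \<equiv> 19 :: nat"
abbreviation (input) "rq \<equiv> 20 :: nat"
abbreviation (input) "rc \<equiv> 21 :: nat"
abbreviation (input) "rJ \<equiv> 22 :: nat"
abbreviation (input) "rThree \<equiv> 23 :: nat"
abbreviation (input) "rB \<equiv> 24 :: nat"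
abbreviation (input) "rZ \<equiv> 25 :: nat"
abbreviation (input) "rE \<equiv> 26 :: nat"
abbreviation (input) "rF \<equiv> 27 :: nat"

definition for_loop :: "nat \<Rightarrow> com \<Rightarrow> com" where
  "for_loop c P = While c (P ;; Op Sub c c rOne)"

text \<open>The counter runs down from \<open>N\<close>, so \<open>i\<close> is the number of
  finished rounds, and the invariant is required after the decrement. A round costs the body plus
  \<open>2\<close> steps for test and decrement; the failing test at the end costs the last
  step.\<close>

lemma wp_for_loop:
  assumes body: "\<And>i R M. i < N \<Longrightarrow> I i R M \<Longrightarrow> R c = N - i \<Longrightarrow>
      wp w P (\<lambda>t (R', M'). t \<le> \<tau> \<and> R' c = N - i \<and> R' rOne = 1 \<and> I (Suc i) (R'(c := N - Suc i)) M') (R, M)"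
    and "N < 2 ^ w"
    and start: "I 0 R M" "R c = N"
    and post: "\<And>t R' M'. t \<le> N * (\<tau> + 2) + 1 \<Longrightarrow> I N R' M' \<Longrightarrow> R' c = 0 \<Longrightarrow> Q t (R', M')"
  shows "wp w (for_loop c P) Q (R, M)"
proof -
  have "\<exists>t R' M'. exec w (for_loop c P) (R, M) t (R', M') \<and> t \<le> m * (\<tau> + 2) + 1 \<and> I N R' M' \<and> R' c = 0"
    if "I i R M" "R c = N - i" "i + m = N" for i m R M
    using that
  proof (induction m arbitrary: i R M)
    case 0
    then have "exec w (for_loop c P) (R, M) 1 (R, M)"
      unfolding for_loop_def by (intro exec.WhileFalse) simp
    moreover have "i = N" "R c = 0" using 0 by simp_all
    ultimately show ?case using 0(1) by fastforce
  next
    case (Suc m)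
    from body[of i R M] Suc.prems obtain t R1 M1 where 1: "exec w P (R, M) t (R1, M1)" "t \<le> \<tau>"
      "R1 c = N - i" "R1 rOne = 1" "I (Suc i) (R1(c := N - Suc i)) M1"
      unfolding wp_def by auto
    have "exec w (Op Sub c c rOne) (R1, M1) 1 (R1(c := R1 c - R1 rOne), M1)"
      using exec.Op[of Sub R1 c rOne w c M1] 1 \<open>N < 2 ^ w\<close> by simp
    also have "R1 c - R1 rOne = N - Suc i" using 1 by simp
    finally have 2: "exec w (P ;; Op Sub c c rOne) (R, M) (t + 1) (R1(c := N - Suc i), M1)"
      using 1(1) exec.Seq by blast
    obtain u R2 M2 where 3: "exec w (for_loop c P) (R1(c := N - Suc i), M1) u (R2, M2)"
      "u \<le> m * (\<tau> + 2) + 1" "I N R2 M2" "R2 c = 0"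
      using Suc.IH[OF 1(5) fun_upd_same] Suc.prems(3) by (metis add_Suc_shift)
    have "exec w (for_loop c P) (R, M) (Suc (t + 1 + u)) (R2, M2)"
      using exec.WhileTrue[of R c w _ M, OF _ 2] 3(1) Suc.prems unfolding for_loop_def by simp
    moreover have "Suc (t + 1 + u) \<le> Suc m * (\<tau> + 2) + 1" using 1(2) 3(2) by simp
    ultimately show ?case using 3 by blast
  qed
  from this[of 0 R M N] start obtain t R' M' where "exec w (for_loop c P) (R, M) t (R', M')"
    "t \<le> N * (\<tau> + 2) + 1" "I N R' M'" "R' c = 0" by auto
  then show ?thesis unfolding wp_def using post by blast
qed

text \<open>All codes are affine in \<open>u\<close>. Positive and negative slope are kept apart
  because machine numbers are natural; thus one loop serves every problem and every set, and only
  the coefficients change.\<close>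

definition lin :: "nat \<Rightarrow> nat \<Rightarrow> nat \<Rightarrow> nat \<Rightarrow> nat" where
  "lin a p q u = a + u * p - u * q"

text \<open>Memory holding the input \<open>X\<close> and, from address \<open>B\<close> on, the output written so far.\<close>

definition mem :: "nat list \<Rightarrow> nat \<Rightarrow> nat list \<Rightarrow> nat \<Rightarrow> nat" where
  "mem X B ys = (\<lambda>i. if i < length X then X ! i
     else if B \<le> i \<and> i < B + length ys then ys ! (i - B) else 0)"

lemma mem_input: "i < length X \<Longrightarrow> mem X B ys i = X ! i"
  by (simp add: mem_def)

lemma mem_append: "length X \<le> B \<Longrightarrow> (mem X B ys)(B + length ys := v) = mem X B (ys @ [v])"
  by (auto simp: mem_def fun_eq_iff nth_append)

lemma mem_update:
  "length X \<le> B \<Longrightarrow> (mem X B (ys @ v # zs))(B + length ys := v') = mem X B (ys @ v' # zs)"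
  by (auto simp: mem_def fun_eq_iff nth_append nth_Cons split: nat.splits)

lemma mem_output: "length X \<le> B \<Longrightarrow> i < length ys \<Longrightarrow> mem X B ys (B + i) = ys ! i"
  by (simp add: mem_def)

definition emit :: "nat \<Rightarrow> com" where
  "emit x = Op Mul rt ru rp ;; Op Add rt x rt ;; Op Mul rs ru rq ;; Op Sub rt rt rs ;;
     Store rout rt ;; Op Add rout rout rOne"

text \<open>\<open>rJ\<close> is \<open>0\<close> for the first set and \<open>1\<close> for all
  others. Or-ing it to the table entry at address \<open>3 + u\<close> switches the filter by
  \<open>f\<close> off, and the final test on it restricts the junk word to the first set.\<close>

definition expand_word :: com where
  "expand_word =
     Load rw rin ;; Op Add rin rin rOne ;; Op Mul ru rw rP ;; Op Add ry rY 0 ;;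
     for_loop ry (Op Add rt ru rThree ;; Load rt rt ;; Op BitOr rt rt rJ ;;
       Cond rt (emit ra) (Const rt 0) ;; Op Add ru ru rQ) ;;
     Cond rJ (Const rt 0) (Op Add ru rw 0 ;; emit rc)"

text \<open>The length of the new list is known only after the list has been written, so its cell is
  reserved at address \<open>rh\<close> and filled in last.\<close>

definition expand_set :: com where
  "expand_set =
     Load rm rin ;; Op Add rin rin rOne ;; Op Add rh rout 0 ;; Op Add rout rout rOne ;;
     for_loop rm expand_word ;;
     Op Sub rt rout rh ;; Op Sub rt rt rOne ;; Store rh rt"

definition expand_sets :: com where
  "expand_sets = Op Mul rS rn rg ;; for_loop rS expand_set"

definition candidates :: "nat list \<Rightarrow> (nat \<Rightarrow> nat) \<Rightarrow> nat \<Rightarrow> nat \<Rightarrow> nat list" where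
  "candidates X R x Y = map (lin (R ra) (R rp) (R rq))
     (filter (\<lambda>u. X ! (3 + u) \<noteq> 0 \<or> R rJ \<noteq> 0) (map (\<lambda>y. x * R rP + y * R rQ) [0..<Y]))"

definition expansion :: "nat list \<Rightarrow> (nat \<Rightarrow> nat) \<Rightarrow> nat \<Rightarrow> nat list" where
  "expansion X R x = candidates X R x (R rY) @ (if R rJ \<noteq> 0 then [] else [lin (R rc) (R rp) (R rq) x])"

lemma length_candidates: "length (candidates X R x Y) \<le> Y"
  unfolding candidates_def using length_filter_le[of _ "map (\<lambda>y. x * R rP + y * R rQ) [0..<Y]"] by simp

lemma length_expansion: "length (expansion X R x) \<le> R rY + 1"
  unfolding expansion_def using length_candidates[of X R x "R rY"] by simp

text \<open>The index range is fixed by \<open>Z\<close>, the size of the truth table stored from address \<open>3\<close> on.\<close>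

definition ready :: "nat \<Rightarrow> nat \<Rightarrow> nat list \<Rightarrow> nat \<Rightarrow> (nat \<Rightarrow> nat) \<Rightarrow> bool" where
  "ready w Z X B R \<longleftrightarrow> R 0 = 0 \<and> R rOne = 1 \<and> R rThree = 3 \<and>
     3 + Z \<le> length X \<and> length X \<le> B \<and> (\<forall>x\<in>set X. x < 2 ^ w) \<and> B < 2 ^ w \<and>
     R rY < 2 ^ w \<and> R rQ \<le> Z \<and> Z + Z < 2 ^ w \<and>
     (\<forall>u<Z. R ra + u * R rp < 2 ^ w \<and> R rc + u * R rp < 2 ^ w \<and> u * R rq < 2 ^ w)"

lemma ready_cong:
  "(\<And>r. r \<in> {0, rOne, rThree, rY, rQ, ra, rp, rc, rq} \<Longrightarrow> R' r = R r) \<Longrightarrow> ready w Z X B R' = ready w Z X B R"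
  unfolding ready_def by simp

lemma expansion_cong:
  "(\<And>r. r \<in> {rY, rQ, rP, ra, rp, rc, rq, rJ} \<Longrightarrow> R' r = R r) \<Longrightarrow> expansion X R' = expansion X R"
  unfolding expansion_def candidates_def fun_eq_iff by simp

lemma or_nat_lt: "(x::nat) < 2 ^ w \<Longrightarrow> y < 2 ^ w \<Longrightarrow> or x y < 2 ^ w"
  by (metis take_bit_nat_eq_self_iff take_bit_or)

lemma or_nat_eq_0_iff: "or (x::nat) y = 0 \<longleftrightarrow> x = 0 \<and> y = 0"
  by (auto simp: bit_eq_iff bit_or_iff)

lemma wp_emit:
  assumes "R rOne = 1" "R x + R ru * R rp < 2 ^ w" "R ru * R rq < 2 ^ w" "Suc (R rout) < 2 ^ w"
    "x \<notin> {rt, rs}"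
    "\<And>t. t \<le> 6 \<Longrightarrow> Q t (R(rs := R ru * R rq, rt := lin (R x) (R rp) (R rq) (R ru), rout := Suc (R rout)),
       M(R rout := lin (R x) (R rp) (R rq) (R ru)))"
  shows "wp w (emit x) Q (R, M)"
proof -
  have "R ru * R rp < 2 ^ w" "lin (R x) (R rp) (R rq) (R ru) < 2 ^ w"
    using assms by (simp_all add: lin_def)
  then show ?thesis
    using assms by (simp add: emit_def wp_simps lin_def)
qed

lemma wp_expand_word:
  assumes ready: "ready w Z X B R" and J: "R rJ < 2 ^ w"
    and pos: "R rin < length X" "x = X ! (R rin)"
    and range: "x < Z" "\<And>y. y < R rY \<Longrightarrow> x * R rP + y * R rQ < Z" "R rY > 0"
    and out: "R rout = B + length ys" "B + length ys + R rY + 2 < 2 ^ w"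
    and Q: "\<And>t R' M'. t \<le> 14 * R rY + 15 \<Longrightarrow> (\<forall>r. r \<notin> {rin, rout, rt, rs, ru, ry, rw} \<longrightarrow> R' r = R r) \<Longrightarrow>
        R' rin = R rin + 1 \<Longrightarrow> R' rout = B + length (ys @ expansion X R x) \<Longrightarrow>
        M' = mem X B (ys @ expansion X R x) \<Longrightarrow> Q t (R', M')"
  shows "wp w expand_word Q (R, mem X B ys)"
proof -
  have X: "length X \<le> B" "3 + Z \<le> length X" "B < 2 ^ w" using ready by (auto simp: ready_def)
  have Xw: "X ! i < 2 ^ w" if "i < length X" for i using ready that by (auto simp: ready_def)
  define R0 where "R0 = R(rw := x, rin := Suc (R rin), ru := x * R rP, ry := R rY)"
  define I where "I = (\<lambda>i R' M'. (\<forall>r. r \<notin> {rout, rt, rs, ru, ry} \<longrightarrow> R' r = R0 r) \<and>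
     R' ru = x * R rP + i * R rQ \<and> R' rout = B + length (ys @ candidates X R x i) \<and>
     M' = mem X B (ys @ candidates X R x i))"
  have loop: "wp w (for_loop ry (Op Add rt ru rThree ;; Load rt rt ;; Op BitOr rt rt rJ ;;
       Cond rt (emit ra) (Const rt 0) ;; Op Add ru ru rQ))
       (\<lambda>t (R', M'). t \<le> R rY * 14 + 1 \<and> I (R rY) R' M' \<and> R' ry = 0) (R0, mem X B ys)"
  proof (rule wp_for_loop[where I = I and N = "R rY" and \<tau> = 12])
    fix i R' M' assume i: "i < R rY" and I: "I i R' M'" and c: "R' ry = R rY - i"
    let ?u = "x * R rP + i * R rQ"
    have u: "?u < Z" using range i by simp
    have R': "R' ru = ?u" "R' rThree = 3" "R' rJ = R rJ" "R' ra = R ra" "R' rp = R rp" "R' rq = R rq"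
      "R' rQ = R rQ" "R' rOne = 1" "R' rout = B + length (ys @ candidates X R x i)"
      "M' = mem X B (ys @ candidates X R x i)"
      and fr: "\<forall>r. r \<notin> {rout, rt, rs, ru, ry} \<longrightarrow> R' r = R0 r"
      using I ready by (simp_all add: I_def R0_def ready_def)
    have R0: "R0 rOne = 1" using ready by (simp add: R0_def ready_def)
    have lin: "R ra + ?u * R rp < 2 ^ w" "?u * R rq < 2 ^ w" using ready u by (simp_all add: ready_def)
    have uq: "?u + R rQ < 2 ^ w" "?u + 3 < 2 ^ w" using ready u by (simp_all add: ready_def)
    have len: "Suc (B + length (ys @ candidates X R x i)) < 2 ^ w"
      using length_candidates[of X R x i] out i by simp
    have M: "mem X B (ys @ candidates X R x i) (?u + 3) = X ! (3 + ?u)"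
      using u X by (simp add: mem_input add.commute)
    have Xu: "X ! (3 + ?u) < 2 ^ w" using Xw u X by simp
    have Xor: "or (X ! (3 + ?u)) (R rJ) < 2 ^ w" by (rule or_nat_lt[OF Xu J])
    have step: "candidates X R x (Suc i) = candidates X R x i @
      (if X ! (3 + ?u) = 0 \<and> R rJ = 0 then [] else [lin (R ra) (R rp) (R rq) ?u])"
      by (simp add: candidates_def)
    have app: "(mem X B (ys @ candidates X R x i))(B + (length ys + length (candidates X R x i)) := v)
      = mem X B (ys @ candidates X R x i @ [v])" for v
      using mem_append[OF X(1), of "ys @ candidates X R x i" v] by simp
    show "wp w (Op Add rt ru rThree ;; Load rt rt ;; Op BitOr rt rt rJ ;;
       Cond rt (emit ra) (Const rt 0) ;; Op Add ru ru rQ)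
          (\<lambda>t (R'', M''). t \<le> 12 \<and> R'' ry = R rY - i \<and> R'' rOne = 1 \<and>
             I (Suc i) (R''(ry := R rY - Suc i)) M'') (R', M')"
    proof (cases "X ! (3 + ?u) = 0 \<and> R rJ = 0")
      case True
      then show ?thesis using uq Xu Xor fr
        by (simp add: wp_simps R' R0 M c step I_def)
    next
      case False
      then have "or (X ! (3 + ?u)) (R rJ) \<noteq> 0" by (simp add: or_nat_eq_0_iff)
      moreover have "candidates X R x (Suc i) = candidates X R x i @ [lin (R ra) (R rp) (R rq) ?u]"
        using False by (simp only: step if_False)
      ultimately show ?thesis using uq Xu Xor fr lin len
        by (simp add: wp_simps R' R0 M c I_def)
          (rule wp_emit; simp add: R' R0 c wp_simps app)
    qed
  next
    show "I 0 R0 (mem X B ys)" using out by (simp add: I_def R0_def candidates_def)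
  qed (use ready in \<open>auto simp: ready_def R0_def\<close>)
  \<comment> \<open>The instance \<open>y = 0\<close> of the range assumption, available because
    \<open>R rY > 0\<close>, bounds the start value \<open>x * R rP\<close>.\<close>
  have init: "X ! R rin < 2 ^ w" "Suc (R rin) < 2 ^ w" "x * R rP < 2 ^ w" "R rY < 2 ^ w" "x < 2 ^ w"
      "R rOne = 1" "R 0 = 0"
    using Xw pos X ready range(1) range(2)[of 0] range(3) by (simp_all add: ready_def)
  have fin: "lin (R rc) (R rp) (R rq) x < 2 ^ w" "R rc + x * R rp < 2 ^ w" "x * R rq < 2 ^ w"
    using ready range(1) by (auto simp: ready_def lin_def intro: le_less_trans[OF diff_le_self])
  have last: "wp w (Cond rJ (Const rt 0) (Op Add ru rw 0 ;; emit rc)) (\<lambda>u. Q (Suc (Suc (Suc (Suc (t + u)))))) (R', M')"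
    if t: "t \<le> R rY * 14 + 1" and I: "I (R rY) R' M'" and y: "R' ry = 0" for t R' M'
  proof -
    have R': "R' rJ = R rJ" "R' rc = R rc" "R' rp = R rp" "R' rq = R rq" "R' rw = x" "R' 0 = 0" "R' rOne = 1"
      "R' rin = Suc (R rin)" "R' rout = B + length (ys @ candidates X R x (R rY))"
      "M' = mem X B (ys @ candidates X R x (R rY))"
      and fr: "\<forall>r. r \<notin> {rin, rout, rt, rs, ru, ry, rw} \<longrightarrow> R' r = R r"
      using I init by (simp_all add: I_def R0_def)
    have app: "(mem X B (ys @ candidates X R x (R rY)))(B + (length ys + length (candidates X R x (R rY))) := v)
      = mem X B (ys @ candidates X R x (R rY) @ [v])" for v
      using mem_append[OF X(1), of "ys @ candidates X R x (R rY)" v] by simp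
    have len: "Suc (B + length (ys @ candidates X R x (R rY))) < 2 ^ w"
      using length_candidates[of X R x "R rY"] out by simp
    show ?thesis
    proof (cases "R rJ = 0")
      case False
      then show ?thesis using t fr
        by (simp add: wp_simps R') (rule Q, simp_all add: R' expansion_def)
    next
      case True
      show ?thesis using t fr init fin len True
        by (simp add: wp_simps R', intro wp_emit) (simp_all add: R' app Q expansion_def)
    qed
  qed
  have "wp w (for_loop ry (Op Add rt ru rThree ;; Load rt rt ;; Op BitOr rt rt rJ ;;
       Cond rt (emit ra) (Const rt 0) ;; Op Add ru ru rQ))
       (\<lambda>t. wp w (Cond rJ (Const rt 0) (Op Add ru rw 0 ;; emit rc)) (\<lambda>u. Q (Suc (Suc (Suc (Suc (t + u)))))))
       (R0, mem X B ys)"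
    by (rule wp_mono[OF loop]) (auto intro: last)
  then show ?thesis unfolding expand_word_def
    using init pos(1) pos(2)[symmetric] by (simp add: wp_simps mem_input R0_def)
qed

section \<open>Input segments and the expansion of lists of words\<close>

definition seg :: "nat list \<Rightarrow> nat \<Rightarrow> nat list \<Rightarrow> bool" where
  "seg X p xs \<longleftrightarrow> p + length xs \<le> length X \<and> (\<forall>i<length xs. X ! (p + i) = xs ! i)"

lemma seg_append: "seg X p (xs @ ys) \<longleftrightarrow> seg X p xs \<and> seg X (p + length xs) ys"
proof
  assume *: "seg X p (xs @ ys)"
  then have 1: "X ! (p + i) = (xs @ ys) ! i" if "i < length xs + length ys" for i
    using that by (simp add: seg_def)
  have "X ! (p + length xs + i) = ys ! i" if "i < length ys" for i
    using 1[of "length xs + i"] that by (simp add: add.assoc)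
  moreover have "X ! (p + i) = xs ! i" if "i < length xs" for i
    using 1[of i] that by (simp add: nth_append)
  ultimately show "seg X p xs \<and> seg X (p + length xs) ys" using * by (simp add: seg_def)
next
  assume *: "seg X p xs \<and> seg X (p + length xs) ys"
  then have "X ! (p + i) = (xs @ ys) ! i" if "i < length xs + length ys" for i
    using that by (cases "i < length xs") (auto simp: seg_def nth_append dest: spec[of _ "i - length xs"])
  then show "seg X p (xs @ ys)" using * by (simp add: seg_def)
qed

lemma seg_Cons: "seg X p (x # xs) \<longleftrightarrow> p < length X \<and> X ! p = x \<and> seg X (Suc p) xs"
  using seg_append[of X p "[x]" xs] by (auto simp: seg_def)

lemma seg_concat_nth:
  assumes "seg X p (concat (map f L))" "i < length L"
  shows "seg X (p + length (concat (map f (take i L)))) (f (L ! i))"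
proof -
  have "concat (map f L) = concat (map f (take i L)) @ f (L ! i) @ concat (map f (drop (Suc i) L))"
    by (subst id_take_nth_drop[OF assms(2)]) simp
  then show ?thesis using assms(1) by (simp add: seg_append)
qed

definition in_range :: "nat \<Rightarrow> (nat \<Rightarrow> nat) \<Rightarrow> nat \<Rightarrow> bool" where
  "in_range Z R x \<longleftrightarrow> x < Z \<and> (\<forall>y<R rY. x * R rP + y * R rQ < Z)"

lemma length_concat_le:
  "(\<And>x. x \<in> set xs \<Longrightarrow> length (f x) \<le> c) \<Longrightarrow> length (concat (map f xs)) \<le> length xs * c"
  by (induction xs) (simp_all add: add_mono)

lemma wp_expand_set:
  assumes ready: "ready w Z X B R" and J: "R rJ < 2 ^ w" and Y: "R rY > 0"
    and seg: "seg X (R rin) (length ws # ws)"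
    and range: "\<And>x. x \<in> set ws \<Longrightarrow> in_range Z R x"
    and len: "length ws < 2 ^ w" "length ws \<le> E"
    and out: "R rout = B + length ys" "B + length ys + E * (R rY + 1) + R rY + 4 < 2 ^ w"
    and zs: "zs = concat (map (expansion X R) ws)"
    and Q: "\<And>t R' M'. t \<le> E * (14 * R rY + 17) + 8 \<Longrightarrow>
        (\<forall>r. r \<notin> {rin, rout, rt, rs, ru, ry, rw, rm, rh} \<longrightarrow> R' r = R r) \<Longrightarrow>
        R' rin = R rin + length (length ws # ws) \<Longrightarrow> R' rout = B + length (ys @ length zs # zs) \<Longrightarrow>
        M' = mem X B (ys @ length zs # zs) \<Longrightarrow> Q t (R', M')"
  shows "wp w expand_set Q (R, mem X B ys)"
proof -
  have X: "length X \<le> B" "B < 2 ^ w" "R rOne = 1" "R 0 = 0" "R rY < 2 ^ w"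
    using ready by (auto simp: ready_def)
  have hd: "R rin < length X" "X ! (R rin) = length ws" "seg X (Suc (R rin)) ws"
    using seg by (simp_all add: seg_Cons)
  define R0 where "R0 = R(rm := length ws, rin := Suc (R rin), rh := R rout, rout := Suc (R rout))"
  define D where "D = (\<lambda>i. concat (map (expansion X R) (take i ws)))"
  define I where "I = (\<lambda>i R' M'. (\<forall>r. r \<notin> {rin, rout, rt, rs, ru, ry, rw, rm} \<longrightarrow> R' r = R0 r) \<and>
     R' rin = Suc (R rin) + i \<and> R' rout = B + length (ys @ 0 # D i) \<and> M' = mem X B (ys @ 0 # D i))"
  have lenD: "length (D i) \<le> E * (R rY + 1)" for i
  proof -
    have "length (D i) \<le> length (take i ws) * (R rY + 1)"
      unfolding D_def by (rule length_concat_le[OF length_expansion])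
    also have "\<dots> \<le> E * (R rY + 1)" using len(2) by (intro mult_right_mono) auto
    finally show ?thesis .
  qed
  \<comment> \<open>Unwritten cells are \<open>0\<close>, so skipping the length cell has the same
    effect as writing \<open>0\<close> into it.\<close>
  have mem0: "mem X B ys = mem X B (ys @ [0])"
    by (auto simp: mem_def fun_eq_iff nth_append)
  have loop: "wp w (for_loop rm expand_word)
       (\<lambda>t (R', M'). t \<le> length ws * (14 * R rY + 17) + 1 \<and> I (length ws) R' M' \<and> R' rm = 0) (R0, mem X B ys)"
  proof (rule wp_for_loop[where I = I and N = "length ws" and \<tau> = "14 * R rY + 15"])
    fix i R' M' assume i: "i < length ws" and I: "I i R' M'" and c: "R' rm = length ws - i"
    have fr: "\<forall>r. r \<notin> {rin, rout, rt, rs, ru, ry, rw, rm} \<longrightarrow> R' r = R0 r"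
      and R': "R' rin = Suc (R rin) + i" "R' rout = B + length (ys @ 0 # D i)" "M' = mem X B (ys @ 0 # D i)"
      using I by (simp_all add: I_def)
    have fr': "R' 0 = R 0" "R' rOne = R rOne" "R' rThree = R rThree" "R' rY = R rY" "R' rQ = R rQ"
      "R' rP = R rP" "R' ra = R ra" "R' rp = R rp" "R' rc = R rc" "R' rq = R rq" "R' rJ = R rJ"
      using fr by (simp_all add: R0_def)
    have ready': "ready w Z X B R'" using ready by (subst ready_cong[of R' R]) (auto simp: fr')
    have exp': "expansion X R' = expansion X R" by (rule expansion_cong) (auto simp: fr')
    have x: "X ! (R' rin) = ws ! i" "R' rin < length X"
      using hd(3) i by (simp_all add: R' seg_def)
    have rg: "in_range Z R (ws ! i)" using range i by simp
    have D: "D (Suc i) = D i @ expansion X R (ws ! i)"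
      using i by (simp add: D_def take_Suc_conv_app_nth)
    show "wp w expand_word (\<lambda>t (R'', M''). t \<le> 14 * R rY + 15 \<and> R'' rm = length ws - i \<and> R'' rOne = 1 \<and>
             I (Suc i) (R''(rm := length ws - Suc i)) M'') (R', M')"
      unfolding R'(3)
    proof (rule wp_expand_word[OF ready' _ x(2) x(1)[symmetric], where ys = "ys @ 0 # D i"])
      show "B + length (ys @ 0 # D i) + R' rY + 2 < 2 ^ w"
        using out(2) lenD[of i] by (simp add: fr')
    next
      fix t R'' M''
      assume a: "t \<le> 14 * R' rY + 15" "\<forall>r. r \<notin> {rin, rout, rt, rs, ru, ry, rw} \<longrightarrow> R'' r = R' r"
        "R'' rin = R' rin + 1" "R'' rout = B + length ((ys @ 0 # D i) @ expansion X R' (ws ! i))"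
        "M'' = mem X B ((ys @ 0 # D i) @ expansion X R' (ws ! i))"
      have "R'' rm = length ws - i" "R'' rOne = 1" using a(2) c X(3) by (simp_all add: fr')
      then show "case (R'', M'') of (R'', M'') \<Rightarrow> t \<le> 14 * R rY + 15 \<and> R'' rm = length ws - i \<and> R'' rOne = 1 \<and>
             I (Suc i) (R''(rm := length ws - Suc i)) M''"
        using a fr R' by (simp add: I_def D exp' fr')
    qed (use rg J Y R' in \<open>auto simp: in_range_def fr'\<close>)
  next
    show "I 0 R0 (mem X B ys)" using out mem0 by (simp add: I_def R0_def D_def)
  qed (use len in \<open>auto simp: R0_def add.commute[of 17]\<close>)
  have Dzs: "D (length ws) = zs" by (simp add: D_def zs)
  have last: "wp w (Op Sub rt rout rh ;; Op Sub rt rt rOne ;; Store rh rt) (\<lambda>u. Q (Suc (Suc (Suc (Suc (t + u)))))) (R', M')"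
    if t: "t \<le> length ws * (14 * R rY + 17) + 1" and I: "I (length ws) R' M'" and m: "R' rm = 0" for t R' M'
  proof -
    have fr: "\<forall>r. r \<notin> {rin, rout, rt, rs, ru, ry, rw, rm, rh} \<longrightarrow> R' r = R r"
      and R': "R' rin = Suc (R rin) + length ws" "R' rout = B + length (ys @ 0 # zs)"
       "M' = mem X B (ys @ 0 # zs)" "R' rh = B + length ys" "R' rOne = 1"
      using I X(3) out by (simp_all add: I_def R0_def Dzs)
    have up: "(mem X B (ys @ 0 # zs))(B + length ys := v) = mem X B (ys @ v # zs)" for v
      by (rule mem_update[OF X(1)])
    have "length zs \<le> E * (R rY + 1)" using lenD[of "length ws"] Dzs by simp
    then have small: "Suc (length zs) < 2 ^ w" using out(2) by linarith
    have "length ws * (14 * R rY + 17) \<le> E * (14 * R rY + 17)"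
      using len(2) by (rule mult_right_mono) simp
    then have "4 + (t + 3) \<le> E * (14 * R rY + 17) + 8" using t by linarith
    then show ?thesis using small fr
      by (simp add: wp_simps R' up) (rule Q, simp_all add: R')
  qed
  have init: "Suc (R rin) < 2 ^ w" "length ws < 2 ^ w" "R rout < 2 ^ w" "Suc (R rout) < 2 ^ w"
    using hd(1) X len out by simp_all
  have "wp w (for_loop rm expand_word) (\<lambda>t. wp w (Op Sub rt rout rh ;; Op Sub rt rt rOne ;; Store rh rt)
      (\<lambda>u. Q (Suc (Suc (Suc (Suc (t + u))))))) (R0, mem X B ys)"
    by (rule wp_mono[OF loop]) (auto intro: last)
  then show ?thesis unfolding expand_set_def
    using init X hd by (simp add: wp_simps mem_input R0_def)
qed

definition expanded_sets :: "nat list \<Rightarrow> (nat \<Rightarrow> nat) \<Rightarrow> nat list list \<Rightarrow> nat list" where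
  "expanded_sets X R L =
     concat (map (\<lambda>ws. let zs = concat (map (expansion X R) ws) in length zs # zs) L)"

lemma length_expanded_sets:
  assumes "\<And>ws. ws \<in> set L \<Longrightarrow> length ws \<le> E"
  shows "length (expanded_sets X R L) \<le> length L * (E * (R rY + 1) + 1)"
  unfolding expanded_sets_def
proof (rule length_concat_le)
  fix ws assume "ws \<in> set L"
  have "length (concat (map (expansion X R) ws)) \<le> length ws * (R rY + 1)"
    by (rule length_concat_le[OF length_expansion])
  also have "\<dots> \<le> E * (R rY + 1)" using assms[OF \<open>ws \<in> set L\<close>] by (rule mult_right_mono) simp
  finally show "length (let zs = concat (map (expansion X R) ws) in length zs # zs) \<le> E * (R rY + 1) + 1"
    by (simp add: Let_def)
qed

lemma wp_expand_sets:
  assumes ready: "ready w Z X B R" and J: "R rJ < 2 ^ w" and Y: "R rY > 0"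
    and seg: "seg X (R rin) (concat (map (\<lambda>ws. length ws # ws) L))"
    and L: "length L = R rn * R rg" "length L < 2 ^ w"
    and range: "\<And>ws x. ws \<in> set L \<Longrightarrow> x \<in> set ws \<Longrightarrow> in_range Z R x"
    and len: "E < 2 ^ w" "\<And>ws. ws \<in> set L \<Longrightarrow> length ws \<le> E"
    and out: "R rout = B + length ys" "B + length ys + (length L + 1) * (E * (R rY + 1) + R rY + 4) < 2 ^ w"
    and Q: "\<And>t R' M'. t \<le> length L * (E * (14 * R rY + 17) + 10) + 2 \<Longrightarrow>
        (\<forall>r. r \<notin> {rin, rout, rt, rs, ru, ry, rw, rm, rh, rS} \<longrightarrow> R' r = R r) \<Longrightarrow>
        R' rin = R rin + length (concat (map (\<lambda>ws. length ws # ws) L)) \<Longrightarrow>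
        R' rout = B + length (ys @ expanded_sets X R L) \<Longrightarrow>
        M' = mem X B (ys @ expanded_sets X R L) \<Longrightarrow> Q t (R', M')"
  shows "wp w expand_sets Q (R, mem X B ys)"
proof -
  have X: "length X \<le> B" "B < 2 ^ w" "R rOne = 1" "R 0 = 0" "R rY < 2 ^ w"
    using ready by (auto simp: ready_def)
  define R0 where "R0 = R(rS := length L)"
  define P where "P = (\<lambda>i. R rin + length (concat (map (\<lambda>ws. length ws # ws) (take i L))))"
  define D where "D = (\<lambda>i. expanded_sets X R (take i L))"
  define I where "I = (\<lambda>i R' M'. (\<forall>r. r \<notin> {rin, rout, rt, rs, ru, ry, rw, rm, rh, rS} \<longrightarrow> R' r = R0 r) \<and>
     R' rin = P i \<and> R' rout = B + length (ys @ D i) \<and> M' = mem X B (ys @ D i))"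
  have lenD: "length (D i) \<le> length L * (E * (R rY + 1) + 1)" for i
  proof -
    have "length (D i) \<le> length (take i L) * (E * (R rY + 1) + 1)"
      unfolding D_def by (rule length_expanded_sets) (use len in \<open>auto dest: in_set_takeD\<close>)
    also have "\<dots> \<le> length L * (E * (R rY + 1) + 1)" by (intro mult_right_mono) auto
    finally show ?thesis .
  qed
  have loop: "wp w (for_loop rS expand_set)
       (\<lambda>t (R', M'). t \<le> length L * (E * (14 * R rY + 17) + 10) + 1 \<and> I (length L) R' M' \<and> R' rS = 0) (R0, mem X B ys)"
  proof (rule wp_for_loop[where I = I and N = "length L" and \<tau> = "E * (14 * R rY + 17) + 8"])
    fix i R' M' assume i: "i < length L" and I: "I i R' M'" and c: "R' rS = length L - i"
    have fr: "\<forall>r. r \<notin> {rin, rout, rt, rs, ru, ry, rw, rm, rh, rS} \<longrightarrow> R' r = R0 r"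
      and R': "R' rin = P i" "R' rout = B + length (ys @ D i)" "M' = mem X B (ys @ D i)"
      using I by (simp_all add: I_def)
    have fr': "R' 0 = R 0" "R' rOne = R rOne" "R' rThree = R rThree" "R' rY = R rY" "R' rQ = R rQ"
      "R' rP = R rP" "R' ra = R ra" "R' rp = R rp" "R' rc = R rc" "R' rq = R rq" "R' rJ = R rJ"
      using fr by (simp_all add: R0_def)
    have ready': "ready w Z X B R'" using ready by (subst ready_cong[of R' R]) (auto simp: fr')
    have exp': "expansion X R' = expansion X R" by (rule expansion_cong) (auto simp: fr')
    let ?zs = "concat (map (expansion X R) (L ! i))"
    have D: "D (Suc i) = D i @ length ?zs # ?zs"
      using i by (simp add: D_def take_Suc_conv_app_nth expanded_sets_def Let_def)
    have P: "P (Suc i) = P i + length (length (L ! i) # L ! i)"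
      using i by (simp add: P_def take_Suc_conv_app_nth)
    have seg': "seg X (R' rin) (length (L ! i) # L ! i)"
      using seg_concat_nth[OF seg i] by (simp add: R' P_def)
    have bnd: "(length L + 1) * (E * (R rY + 1) + R rY + 4) \<ge>
        length L * (E * (R rY + 1) + 1) + E * (R rY + 1) + R rY + 4"
    proof -
      have "length L * (E * (R rY + 1) + 1) \<le> length L * (E * (R rY + 1) + R rY + 4)"
        by (rule mult_left_mono) simp_all
      then show ?thesis by (simp add: add_mult_distrib)
    qed
    have rg: "in_range Z R' x" if "x \<in> set (L ! i)" for x
      using range[OF nth_mem[OF i] that] by (simp add: in_range_def fr')
    show "wp w expand_set (\<lambda>t (R'', M''). t \<le> E * (14 * R rY + 17) + 8 \<and> R'' rS = length L - i \<and> R'' rOne = 1 \<and>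
             I (Suc i) (R''(rS := length L - Suc i)) M'') (R', M')"
      unfolding R'(3)
    proof (rule wp_expand_set[OF ready' _ _ seg' _ _ _ R'(2), where zs = ?zs and E = E])
      show "B + length (ys @ D i) + E * (R' rY + 1) + R' rY + 4 < 2 ^ w"
        using out(2) lenD[of i] bnd by (simp only: fr' length_append)
    next
      show "length (L ! i) < 2 ^ w" using len i by (meson le_less_trans nth_mem)
    next
      fix t R'' M''
      assume a: "t \<le> E * (14 * R' rY + 17) + 8" "\<forall>r. r \<notin> {rin, rout, rt, rs, ru, ry, rw, rm, rh} \<longrightarrow> R'' r = R' r"
        "R'' rin = R' rin + length (length (L ! i) # L ! i)" "R'' rout = B + length ((ys @ D i) @ length ?zs # ?zs)"
        "M'' = mem X B ((ys @ D i) @ length ?zs # ?zs)"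
      have "R'' rS = length L - i" "R'' rOne = 1" using a(2) c X(3) by (simp_all add: fr')
      then show "case (R'', M'') of (R'', M'') \<Rightarrow> t \<le> E * (14 * R rY + 17) + 8 \<and> R'' rS = length L - i \<and> R'' rOne = 1 \<and>
             I (Suc i) (R''(rS := length L - Suc i)) M''"
        using a fr R' by (simp add: I_def D P exp' fr')
    qed (use rg i J Y len exp' in \<open>auto simp: fr'\<close>)
  next
    show "I 0 R0 (mem X B ys)" using out by (simp add: I_def R0_def D_def P_def expanded_sets_def)
  qed (use L X in \<open>auto simp: R0_def add.commute[of 10]\<close>)
  have Dzs: "D (length L) = expanded_sets X R L" by (simp add: D_def)
  show ?thesis unfolding expand_sets_def
    using L X by (simp add: wp_simps)
      (rule wp_mono[OF loop[unfolded R0_def L(1)]], clarsimp, rule Q,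
        simp_all add: I_def R0_def Dzs P_def flip: L(1))
qed

section \<open>Codes of the three problems and their coefficients\<close>

datatype problem = PrOV | PrXOR | PrSUM

text \<open>How many indices share a given digit \<open>j\<close>: in the first set the other
  \<open>k - 1\<close> digits are free, in the second set the guessed digit \<open>0\<close>, in the
  later sets nothing. \<open>mul_y\<close> is the distance between consecutive such indices.\<close>

definition num_y :: "nat \<Rightarrow> nat \<Rightarrow> nat \<Rightarrow> nat" where
  "num_y k b j = (if j = 0 then 2 ^ ((k - 1) * b) else if j = 1 then 2 ^ b else 1)"

definition mul_y :: "nat \<Rightarrow> nat \<Rightarrow> nat" where
  "mul_y b j = (if j = 0 then 2 ^ b else 1)"

text \<open>For \<open>j \<ge> 1\<close> this is the number whose ones are the positions that
  coordinate \<open>j\<close> is responsible for: \<open>2 ^ (2 * b) - 1\<close> for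
  \<open>j = 1\<close>, and a run of \<open>b\<close> ones from position \<open>j * b\<close> on
  otherwise. The summand \<open>num_y\<close> makes both cases one formula.\<close>

definition block :: "nat \<Rightarrow> nat \<Rightarrow> nat \<Rightarrow> nat" where
  "block k b j = 2 ^ (j * b) * (2 ^ b - 1) + num_y k b j - 1"

text \<open>Put \<open>Z = 2 ^ (k * b)\<close>. \<open>XOR\<close> uses \<open>u\<close> and the
  parts \<open>y\<close> of it unchanged. \<open>SUM\<close> uses \<open>Z + u\<close> and
  \<open>block - y\<close>, with an extra unit at \<open>j = 1\<close>: the blocks and this unit add
  up to \<open>Z\<close>, so the total is \<open>2 * Z + u\<close> minus the sum of the parts.
  \<open>OV\<close> writes \<open>u\<close> and its complement side by side in the first code; the
  other codes hold the complement of \<open>y\<close>, then \<open>y\<close> with ones outside its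
  own positions, then a flag bit. The formulas here and in \<open>code_pos\<close> and
  \<open>code_neg\<close> are constant term and slopes of these numbers.\<close>

fun code_add :: "problem \<Rightarrow> nat \<Rightarrow> nat \<Rightarrow> nat \<Rightarrow> nat" where
  "code_add PrXOR k b j = 0"
| "code_add PrSUM k b j = (if j = 0 then 2 ^ (k * b) else if j = 1 then block k b j + 1 else block k b j)"
| "code_add PrOV k b j = (if j = 0 then (2 ^ (k * b) - 1) * 2 ^ (k * b)
     else (2 ^ (k * b) - 1 - block k b j) * 2 ^ (k * b) + (2 ^ (k * b) - 1) + 2 ^ (k * b) * 2 ^ (k * b))"

fun code_pos :: "problem \<Rightarrow> nat \<Rightarrow> nat \<Rightarrow> nat \<Rightarrow> nat" where
  "code_pos PrXOR k b j = 1"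
| "code_pos PrSUM k b j = (if j = 0 then 1 else 0)"
| "code_pos PrOV k b j = (if j = 0 then 0 else 2 ^ (k * b) - 1)"

fun code_neg :: "problem \<Rightarrow> nat \<Rightarrow> nat \<Rightarrow> nat \<Rightarrow> nat" where
  "code_neg PrXOR k b j = 0"
| "code_neg PrSUM k b j = (if j = 0 then 0 else 1)"
| "code_neg PrOV k b j = (if j = 0 then 2 ^ (k * b) - 1 else 0)"

text \<open>Junk has to fail against every choice in the other sets. \<open>XOR\<close> gets a top
  bit that nobody cancels, \<open>SUM\<close> lacks the summand \<open>2 ^ (k * b)\<close> of a
  genuine code, and \<open>OV\<close> gets the flag bit that the codes of all other sets have as
  well.\<close>

fun code_junk :: "problem \<Rightarrow> nat \<Rightarrow> nat \<Rightarrow> nat \<Rightarrow> nat" where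
  "code_junk PrXOR k b j = (if j = 0 then 2 ^ (k * b) else 0)"
| "code_junk PrSUM k b j = 0"
| "code_junk PrOV k b j = (if j = 0 then 2 ^ (k * b) * 2 ^ (k * b) + (2 ^ (k * b) - 1) * 2 ^ (k * b) else 0)"

text \<open>\<open>SUM\<close> needs the modulus \<open>2 * 2 ^ (k * b)\<close>, \<open>XOR\<close>
  the top bit of junk, \<open>OV\<close> two copies of all positions and the flag. The width is
  linear in \<open>b\<close>, hence still \<open>o(log n)\<close>.\<close>

fun width :: "problem \<Rightarrow> nat \<Rightarrow> nat \<Rightarrow> nat" where
  "width PrOV k b = Suc (k * b + k * b)"
| "width PrXOR k b = Suc (k * b)"
| "width PrSUM k b = Suc (k * b)"

text \<open>For \<open>j \<noteq> 0\<close> the last four instructions leave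
  \<open>block k b j\<close> in \<open>rs\<close>, where \<open>setup_code\<close> expects
  it.\<close>

definition setup_range :: "nat \<Rightarrow> com" where
  "setup_range j = (if j = 0 then
       Op Div rY rZ rE ;; Op Add rP rOne 0 ;; Op Add rQ rE 0 ;; Const rJ 0
     else
       (if j = 1 then Op Add rY rE 0 else Op Add rY rOne 0) ;; Const rt j ;; Op Mul rt rt rb ;;
       Op Shl rP rOne rt ;; Op Add rQ rOne 0 ;; Const rJ 1 ;;
       Op Sub rt rE rOne ;; Op Mul rs rP rt ;; Op Add rs rs rY ;; Op Sub rs rs rOne)"

fun setup_code :: "problem \<Rightarrow> nat \<Rightarrow> com" where
  "setup_code PrXOR j = Const ra 0 ;; Const rp 1 ;; Const rq 0 ;; (if j = 0 then Op Add rc rZ 0 else Const rc 0)"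
| "setup_code PrSUM j = (if j = 0 then Op Add ra rZ 0 ;; Const rp 1 ;; Const rq 0 ;; Const rc 0
     else (if j = 1 then Op Add ra rs rOne else Op Add ra rs 0) ;; Const rp 0 ;; Const rq 1 ;; Const rc 0)"
| "setup_code PrOV j = (if j = 0 then
       Op Mul ra rF rZ ;; Const rp 0 ;; Op Add rq rF 0 ;; Op Mul rc rZ rZ ;; Op Add rc rc ra
     else
       Op Sub ra rF rs ;; Op Mul ra ra rZ ;; Op Add ra ra rF ;; Op Mul rt rZ rZ ;; Op Add ra ra rt ;;
       Op Add rp rF 0 ;; Const rq 0 ;; Const rc 0)"

lemma block_lt:
  assumes "2 \<le> k" "0 < j" "j < k"
  shows "block k b j < 2 ^ (k * b)"
proof -
  have *: "2 ^ (j * b) * 2 ^ b \<le> (2::nat) ^ (k * b)"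
  proof -
    have "2 ^ (j * b) * 2 ^ b = (2::nat) ^ (Suc j * b)" by (simp add: power_add)
    also have "\<dots> \<le> 2 ^ (k * b)" using assms by (intro power_increasing mult_right_mono) auto
    finally show ?thesis .
  qed
  have P: "num_y k b j \<le> 2 ^ (j * b)" using assms by (simp add: num_y_def)
  have "2 ^ (j * b) * (2 ^ b - 1) + num_y k b j \<le> 2 ^ (j * b) * 2 ^ b"
    using P by (simp add: algebra_simps)
  moreover have "0 < 2 ^ (j * b) * (2 ^ b - 1) + num_y k b j" using assms by (simp add: num_y_def)
  ultimately show ?thesis using * unfolding block_def by linarith
qed

lemma wp_setup_range:
  assumes "2 \<le> k" "j < k" "R 0 = 0" "R rOne = 1" "R rb = b" "R rZ = 2 ^ (k * b)" "R rE = 2 ^ b"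
    and W: "20 * (2 ^ (k * b) * 2 ^ (k * b)) < (2::nat) ^ w" "k * b < 2 ^ w" "k < 2 ^ w"
    and Q: "\<And>t R'. t \<le> 12 \<Longrightarrow> (\<forall>r. r \<notin> {rY, rP, rQ, rJ, rt, rs} \<longrightarrow> R' r = R r) \<Longrightarrow>
       R' rY = num_y k b j \<Longrightarrow> R' rP = 2 ^ (j * b) \<Longrightarrow> R' rQ = mul_y b j \<Longrightarrow> R' rJ = of_bool (j \<noteq> 0) \<Longrightarrow>
       (j \<noteq> 0 \<Longrightarrow> R' rs = block k b j) \<Longrightarrow> Q t (R', M)"
  shows "wp w (setup_range j) Q (R, M)"
proof -
  let ?Z = "2 ^ (k * b) :: nat"
  have ZZ: "?Z \<le> ?Z * ?Z" by simp
  have Z: "?Z < 2 ^ w" "1 < (2::nat) ^ w" using W(1) ZZ one_le_power[of "2::nat" "k * b"] by linarith+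
  have le: "2 ^ (i * b) \<le> ?Z" if "i \<le> k" for i
    using that by (intro power_increasing mult_right_mono) auto
  have E: "2 ^ b < (2::nat) ^ w" using le_less_trans[OF le[of 1] Z(1)] assms(1) by simp
  show ?thesis
  proof (cases "j = 0")
    case True
    have d: "?Z div 2 ^ b = 2 ^ ((k - 1) * b)"
      using assms(1) by (simp add: power_diff[symmetric] diff_mult_distrib mult_le_mono)
    have "(2::nat) ^ ((k - 1) * b) < 2 ^ w" using le_less_trans[OF le[of "k - 1"] Z(1)] by simp
    then show ?thesis using True assms Z E d
      by (simp add: setup_range_def wp_simps) (rule Q, simp_all add: num_y_def mul_y_def)
  next
    case False
    then have j: "0 < j" "j < k" using assms by auto
    have jb: "j * b < 2 ^ w" "j < 2 ^ w"
      using assms(2) W mult_right_mono[of j k b] by linarith+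
    have P: "2 ^ (j * b) < (2::nat) ^ w" using le_less_trans[OF le[of j] Z(1)] assms(2) by simp
    have s: "Suc (2 ^ (j * b) * (2 ^ b - 1) + num_y k b j - 1) = 2 ^ (j * b) * (2 ^ b - 1) + num_y k b j"
      using j by (simp add: num_y_def)
    have m: "2 ^ (j * b) * (2 ^ b - 1) + num_y k b j - 1 < ?Z"
      using block_lt[OF assms(1) j] by (simp add: block_def)
    have bl: "2 ^ (j * b) * (2 ^ b - 1) + num_y k b j < 2 ^ w"
      using s m Z(1) by linarith
    have bl2: "2 ^ (j * b) * (2 ^ b - 1) < (2::nat) ^ w" using bl by linarith
    have bl3: "2 ^ (j * b) * (2 ^ b - 1) + num_y k b j - 1 < (2::nat) ^ w" using bl by linarith
    have E1: "2 ^ b - 1 < (2::nat) ^ w" using E by linarith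
    show ?thesis
    proof (cases "j = 1")
      case True
      show ?thesis using E1 bl bl2 bl3 True assms(3-7) Z(2) E jb P
        by (simp add: setup_range_def wp_simps push_bit_eq_mult num_y_def)
          (rule Q; simp add: num_y_def mul_y_def block_def)
    next
      case False
      show ?thesis using E1 bl bl2 bl3 False j assms(3-7) Z(2) E jb P
        by (simp add: setup_range_def wp_simps push_bit_eq_mult num_y_def)
          (rule Q; simp add: num_y_def mul_y_def block_def)
    qed
  qed
qed

lemma wp_setup_code:
  assumes "2 \<le> k" "j < k" "R 0 = 0" "R rOne = 1" "R rZ = 2 ^ (k * b)" "R rF = 2 ^ (k * b) - 1"
    "j \<noteq> 0 \<Longrightarrow> R rs = block k b j"
    and W: "20 * (2 ^ (k * b) * 2 ^ (k * b)) < (2::nat) ^ w"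
    and Q: "\<And>t R'. t \<le> 10 \<Longrightarrow> (\<forall>r. r \<notin> {ra, rp, rq, rc, rt, rs} \<longrightarrow> R' r = R r) \<Longrightarrow>
       R' ra = code_add prob k b j \<Longrightarrow> R' rp = code_pos prob k b j \<Longrightarrow> R' rq = code_neg prob k b j \<Longrightarrow>
       R' rc = code_junk prob k b j \<Longrightarrow> Q t (R', M)"
  shows "wp w (setup_code prob j) Q (R, M)"
proof -
  let ?Z = "2 ^ (k * b) :: nat"
  have ZZ: "?Z \<le> ?Z * ?Z" by simp
  have Z: "?Z < 2 ^ w" "1 < (2::nat) ^ w" using W ZZ one_le_power[of "2::nat" "k * b"] by linarith+
  have b: "block k b j < ?Z" if "j \<noteq> 0" using block_lt assms that by simp
  have m: "x * ?Z \<le> ?Z * ?Z" if "x \<le> ?Z" for x using that by simp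
  have F: "(?Z - Suc 0) * ?Z \<le> ?Z * ?Z" "(?Z - Suc 0 - block k b j) * ?Z \<le> ?Z * ?Z" by (rule m, simp)+
  have c: "(?Z - Suc 0) * ?Z < 2 ^ w" "?Z * ?Z < 2 ^ w" "?Z * ?Z + (?Z - Suc 0) * ?Z < 2 ^ w"
    "(?Z - Suc 0 - block k b j) * ?Z < 2 ^ w"  "(?Z - Suc 0 - block k b j) * ?Z + (?Z - Suc 0) < 2 ^ w"
    "(?Z - Suc 0 - block k b j) * ?Z + (?Z - Suc 0) + ?Z * ?Z < 2 ^ w"
    "?Z - Suc 0 - block k b j < 2 ^ w" "?Z - Suc 0 < 2 ^ w"
    using F W ZZ by linarith+
  show ?thesis
  proof (cases prob)
    case PrXOR
    show ?thesis
    proof (cases "j = 0")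
      case True
      then show ?thesis using assms PrXOR Z by (simp add: wp_simps; rule Q; simp)
    next
      case False
      then show ?thesis using assms PrXOR Z by (simp add: wp_simps; rule Q; simp)
    qed
  next
    case PrSUM
    consider "j = 0" | "j = 1" | "j \<noteq> 0" "j \<noteq> 1" by blast
    then show ?thesis
    proof cases
      case 1
      then show ?thesis using assms PrSUM Z by (simp add: wp_simps; rule Q; simp)
    next
      case 2
      then have "block k b 1 < ?Z" using b by simp
      then have "Suc (block k b 1) < 2 ^ w" using Z(1) by linarith
      then show ?thesis using 2 assms PrSUM Z by (simp add: wp_simps; rule Q; simp)
    next
      case 3
      then have "block k b j < 2 ^ w" using less_trans[OF b Z(1)] by simp
      then show ?thesis using 3 assms PrSUM Z by (simp add: wp_simps; rule Q; simp)
    qed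
  next
    case PrOV
    show ?thesis
    proof (cases "j = 0")
      case True
      then show ?thesis using c assms PrOV Z by (simp add: wp_simps; rule Q; simp)
    next
      case False
      then show ?thesis using c assms PrOV Z by (simp add: wp_simps; rule Q; simp)
    qed
  qed
qed

definition code :: "problem \<Rightarrow> nat \<Rightarrow> nat \<Rightarrow> nat \<Rightarrow> nat \<Rightarrow> nat" where
  "code prob k b j = lin (code_add prob k b j) (code_pos prob k b j) (code_neg prob k b j)"

definition junk :: "problem \<Rightarrow> nat \<Rightarrow> nat \<Rightarrow> nat \<Rightarrow> nat" where
  "junk prob k b = lin (code_junk prob k b 0) (code_pos prob k b 0) (code_neg prob k b 0)"

definition word_image :: "problem \<Rightarrow> nat \<Rightarrow> nat \<Rightarrow> (nat \<Rightarrow> bool) \<Rightarrow> nat \<Rightarrow> nat \<Rightarrow> nat list" where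
  "word_image prob k b T j x =
     map (code prob k b j) (filter (\<lambda>u. T u \<or> j \<noteq> 0)
       (map (\<lambda>y. x * 2 ^ (j * b) + y * mul_y b j) [0..<num_y k b j])) @
     (if j = 0 then [junk prob k b x] else [])"

definition set_image :: "problem \<Rightarrow> nat \<Rightarrow> nat \<Rightarrow> (nat \<Rightarrow> bool) \<Rightarrow> nat \<Rightarrow> nat list \<Rightarrow> nat list" where
  "set_image prob k b T j ws = concat (map (word_image prob k b T j) ws)"

definition enc_list :: "nat list \<Rightarrow> nat list" where
  "enc_list ws = length ws # ws"

lemma pow_le: "i \<le> k \<Longrightarrow> 2 ^ (i * b) \<le> (2::nat) ^ (k * b)"
  by (intro power_increasing mult_right_mono) auto

lemma num_y_mult_le:
  assumes "2 \<le> k"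
  shows "2 ^ b * num_y k b j \<le> 2 ^ (k * b)"
proof -
  have "2 ^ b * 2 ^ ((k - 1) * b) = (2::nat) ^ (k * b)"
    using assms by (cases k) (simp_all add: power_add)
  moreover have "2 ^ b * 2 ^ b \<le> (2::nat) ^ (k * b)"
    using pow_le[OF assms, of b] by (simp add: power_add mult_2)
  moreover have "(2::nat) ^ b \<le> 2 ^ (k * b)"
    using pow_le[of 1 k b] assms by simp
  ultimately show ?thesis by (simp add: num_y_def)
qed

lemma num_y_pos: "num_y k b j > 0"
  by (simp add: num_y_def)

text \<open>In each case the index has two digits in a mixed radix, one given by \<open>x\<close>
  and the other by \<open>y\<close>. For \<open>j \<ge> 2\<close> only \<open>y = 0\<close> is
  possible.\<close>

lemma image_index_less:
  assumes "2 \<le> k" "j < k" "x < 2 ^ b" "y < num_y k b j"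
  shows "x * 2 ^ (j * b) + y * mul_y b j < 2 ^ (k * b)"
proof -
  have *: "a * m + c < d * m" if "c < m" "a < d" for a c d m :: nat
  proof -
    have "a * m + c < Suc a * m" using that by simp
    also have "\<dots> \<le> d * m" using that by (intro mult_right_mono) auto
    finally show ?thesis .
  qed
  consider "j = 0" | "j = 1" | "j \<ge> 2" by linarith
  then show ?thesis
  proof cases
    case 1
    then have "y * 2 ^ b + x < num_y k b j * 2 ^ b" using assms by (intro *) auto
    then show ?thesis using 1 num_y_mult_le[OF assms(1), of b j] by (simp add: mul_y_def mult.commute add.commute)
  next
    case 2
    then have "x * 2 ^ b + y < 2 ^ b * 2 ^ b" using assms by (intro *) (auto simp: num_y_def)
    then show ?thesis using 2 num_y_mult_le[OF assms(1), of b j] by (simp add: mul_y_def num_y_def)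
  next
    case 3
    then have "x * 2 ^ (j * b) + y < 2 ^ b * 2 ^ (j * b)" using assms by (intro *) (auto simp: num_y_def)
    also have "\<dots> = 2 ^ (Suc j * b)" by (simp add: power_add)
    also have "\<dots> \<le> 2 ^ (k * b)" using assms by (intro pow_le) simp
    finally show ?thesis using 3 by (simp add: mul_y_def)
  qed
qed

lemma code_bounds:
  assumes "2 \<le> k" "j < k"
  shows "code_add prob k b j \<le> 3 * (2 ^ (k * b) * 2 ^ (k * b))" "code_pos prob k b j \<le> 2 ^ (k * b)"
    "code_neg prob k b j \<le> 2 ^ (k * b)" "code_junk prob k b j \<le> 2 * (2 ^ (k * b) * 2 ^ (k * b))"
proof -
  let ?Z = "2 ^ (k * b) :: nat"
  have ZZ: "?Z \<le> ?Z * ?Z" by simp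
  have Z1: "1 \<le> ?Z" by simp
  have b: "block k b j < ?Z" if "j \<noteq> 0" using block_lt assms that by simp
  have m: "x * ?Z \<le> ?Z * ?Z" if "x \<le> ?Z" for x using that by simp
  have F: "(?Z - 1) * ?Z \<le> ?Z * ?Z" "(?Z - 1 - block k b j) * ?Z \<le> ?Z * ?Z" by (rule m, simp)+
  show "code_add prob k b j \<le> 3 * (?Z * ?Z)"
  proof (cases prob)
    case PrSUM
    have "code_add prob k b j \<le> ?Z" using b PrSUM by (auto simp: Suc_le_eq)
    then show ?thesis using ZZ by linarith
  next
    case PrOV
    show ?thesis
    proof (cases "j = 0")
      case True
      then show ?thesis using F PrOV by (simp only: code_add.simps refl if_True; linarith)
    next
      case False
      then show ?thesis using F ZZ PrOV by (simp only: code_add.simps if_False; linarith)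
    qed
  qed simp
  show "code_pos prob k b j \<le> ?Z" "code_neg prob k b j \<le> ?Z" by (cases prob; simp)+
  show "code_junk prob k b j \<le> 2 * (?Z * ?Z)"
  proof (cases prob)
    case PrXOR
    then show ?thesis using ZZ by auto
  next
    case PrOV
    show ?thesis
    proof (cases "j = 0")
      case True
      then show ?thesis using F PrOV by (simp only: code_junk.simps refl if_True; linarith)
    qed (simp add: PrOV)
  qed simp
qed

text \<open>The bridge from registers to mathematics: from here on the output is described without
  machine states, and the predicate \<open>T\<close> stands for the truth table found at address
  \<open>3\<close>.\<close>

lemma expansion_eq_word_image:
  assumes "R rY = num_y k b j" "R rP = 2 ^ (j * b)" "R rQ = mul_y b j" "R rJ = of_bool (j \<noteq> 0)"
    "R ra = code_add prob k b j" "R rp = code_pos prob k b j" "R rq = code_neg prob k b j"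
    "R rc = code_junk prob k b j"
  shows "expansion X R = word_image prob k b (\<lambda>u. X ! (3 + u) \<noteq> 0) j"
  unfolding expansion_def candidates_def word_image_def fun_eq_iff code_def junk_def
  by (cases "j = 0") (simp_all add: assms)

definition base :: "nat \<Rightarrow> nat \<Rightarrow> nat \<Rightarrow> nat \<Rightarrow> nat \<Rightarrow> nat list \<Rightarrow> nat \<Rightarrow> (nat \<Rightarrow> nat) \<Rightarrow> bool" where
  "base w k n g b X B R \<longleftrightarrow> R 0 = 0 \<and> R rOne = 1 \<and> R rThree = 3 \<and> R rn = n \<and> R rg = g \<and> R rb = b \<and>
     R rZ = 2 ^ (k * b) \<and> R rE = 2 ^ b \<and> R rF = 2 ^ (k * b) - 1 \<and> R rB = B \<and>
     3 + 2 ^ (k * b) \<le> length X \<and> length X \<le> B \<and> (\<forall>x\<in>set X. x < 2 ^ w) \<and> B < 2 ^ w"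

text \<open>By \<open>code_bounds\<close> the codes and the values met on the way to them are at
  most a few multiples of the square of \<open>2 ^ (k * b)\<close>; the factor \<open>20\<close>
  leaves ample room.\<close>

definition fits :: "nat \<Rightarrow> nat \<Rightarrow> nat \<Rightarrow> nat \<Rightarrow> nat \<Rightarrow> bool" where
  "fits w k n g b \<longleftrightarrow> 20 * (2 ^ (k * b) * 2 ^ (k * b)) < (2::nat) ^ w \<and> k * b < 2 ^ w \<and> k < 2 ^ w \<and> n * g < 2 ^ w"

text \<open>As \<open>k\<close> is a constant, the loop over the sets is unrolled when the program
  is built, with \<open>j\<close> as an immediate operand. There is no skip instruction, so the
  empty case overwrites a scratch register.\<close>

primrec phases :: "problem \<Rightarrow> nat list \<Rightarrow> com" where
  "phases prob [] = Const rt 0"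
| "phases prob (j # js) = setup_range j ;; setup_code prob j ;; expand_sets ;; phases prob js"

text \<open>One set of \<open>n\<close> vectors is stored as \<open>n * g\<close> consecutive lists
  with their lengths. Boundaries between vectors leave no trace in memory, so the program treats all
  components alike.\<close>

definition valid_part :: "nat \<Rightarrow> nat \<Rightarrow> nat \<Rightarrow> nat list list \<Rightarrow> bool" where
  "valid_part n g b L \<longleftrightarrow> length L = n * g \<and> (\<forall>ws\<in>set L. length ws \<le> 2 ^ b \<and> (\<forall>x\<in>set ws. x < 2 ^ b))"

definition part_image :: "problem \<Rightarrow> nat \<Rightarrow> nat \<Rightarrow> (nat \<Rightarrow> bool) \<Rightarrow> nat \<Rightarrow> nat list list \<Rightarrow> nat list" where
  "part_image prob k b T j L = concat (map (\<lambda>ws. enc_list (set_image prob k b T j ws)) L)"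

text \<open>Both rest on \<open>2 ^ b * num_y k b j \<le> 2 ^ (k * b)\<close>: the indices of all
  words of length \<open>b\<close> together are no more than the tuples. The first bound is for the
  cells written for one component, the second (\<open>41 = 14 + 17 + 10\<close>) for the steps spent
  on it.\<close>

lemma size_bound:
  assumes "2 \<le> k"
  shows "2 ^ b * (num_y k b j + 1) + num_y k b j + 4 \<le> 8 * 2 ^ (k * b)"
    "2 ^ b * (14 * num_y k b j + 17) + 10 \<le> 41 * 2 ^ (k * b)"
proof -
  let ?Z = "2 ^ (k * b) :: nat"
  have a: "2 ^ b * num_y k b j \<le> ?Z" by (rule num_y_mult_le[OF assms])
  have b: "(2::nat) ^ b \<le> ?Z" using pow_le[of 1 k b] assms by simp
  have "1 * num_y k b j \<le> 2 ^ b * num_y k b j" by (rule mult_right_mono) simp_all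
  then have c: "num_y k b j \<le> ?Z" using a by linarith
  have d: "1 \<le> ?Z" by simp
  show "2 ^ b * (num_y k b j + 1) + num_y k b j + 4 \<le> 8 * ?Z"
    using a b c d unfolding distrib_left by linarith
  have "2 ^ b * (14 * num_y k b j + 17) = 14 * (2 ^ b * num_y k b j) + 17 * 2 ^ b"
    by (simp add: algebra_simps)
  then show "2 ^ b * (14 * num_y k b j + 17) + 10 \<le> 41 * ?Z"
    using a b c d by linarith
qed

lemma length_part_image:
  assumes "2 \<le> k" "valid_part n g b L"
  shows "length (part_image prob k b T j L) \<le> n * g * (8 * 2 ^ (k * b))"
proof -
  have w: "length (word_image prob k b T j x) \<le> num_y k b j + 1" for x
  proof -
    have "length (filter P (map (\<lambda>y. x * 2 ^ (j * b) + y * mul_y b j) [0..<num_y k b j])) \<le> num_y k b j" for P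
      by (rule le_trans[OF length_filter_le]) simp
    then show ?thesis unfolding word_image_def by (simp only: length_append length_map) auto
  qed
  have "length (part_image prob k b T j L) \<le> length L * (8 * 2 ^ (k * b))"
    unfolding part_image_def
  proof (rule length_concat_le)
    fix ws assume ws: "ws \<in> set L"
    have "length (set_image prob k b T j ws) \<le> length ws * (num_y k b j + 1)"
      unfolding set_image_def by (rule length_concat_le[OF w])
    also have "\<dots> \<le> 2 ^ b * (num_y k b j + 1)"
      using assms(2) ws by (intro mult_right_mono) (auto simp: valid_part_def)
    finally show "length (enc_list (set_image prob k b T j ws)) \<le> 8 * 2 ^ (k * b)"
      using size_bound(1)[OF assms(1), of b j] by (simp add: enc_list_def)
  qed
  then show ?thesis using assms(2) by (simp add: valid_part_def)
qed

text \<open>Registers above \<open>28\<close> are promised to keep their values, so that the exit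
  code can restore the initial register state by clearing finitely many of them.\<close>

lemma wp_phases:
  assumes "2 \<le> k" "fits w k n g b"
    and "base w k n g b X B R" "\<forall>j\<in>set js. j < k" "length Ls = length js"
    and "\<forall>L\<in>set Ls. valid_part n g b L"
    and "seg X (R rin) (concat (map (\<lambda>L. concat (map enc_list L)) Ls))"
    and "R rout = B + length ys" "B + length ys + length js * ((n * g + 1) * (8 * 2 ^ (k * b))) < 2 ^ w"
    and "\<And>t R' M'. t \<le> length js * (n * g * (41 * 2 ^ (k * b)) + 26) + 1 \<Longrightarrow>
        base w k n g b X B R' \<Longrightarrow> (\<forall>r>28. R' r = R r) \<Longrightarrow>
        R' rout = B + length (ys @ concat (map2 (part_image prob k b (\<lambda>u. X ! (3 + u) \<noteq> 0)) js Ls)) \<Longrightarrow>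
        M' = mem X B (ys @ concat (map2 (part_image prob k b (\<lambda>u. X ! (3 + u) \<noteq> 0)) js Ls)) \<Longrightarrow> Q t (R', M')"
  shows "wp w (phases prob js) Q (R, mem X B ys)"
  using assms(3-)
proof (induction js arbitrary: R Ls ys Q)
  case Nil
  have *: "base w k n g b X B (R(rt := 0))" using Nil(1) by (simp add: base_def)
  show ?case by (simp add: wp_simps) (rule Nil(8)[OF _ *], use Nil(3,6) in simp_all)
next
  case (Cons j js)
  let ?T = "\<lambda>u. X ! (3 + u) \<noteq> 0" and ?Z = "2 ^ (k * b) :: nat"
  obtain L Ls' where Ls: "Ls = L # Ls'" using Cons.prems(3) by (cases Ls) auto
  have j: "j < k" using Cons.prems by simp
  have W: "20 * (?Z * ?Z) < 2 ^ w" "k * b < 2 ^ w" "k < 2 ^ w" "n * g < 2 ^ w"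
    using assms(2) by (simp_all add: fits_def)
  have b0: "R 0 = 0" "R rOne = 1" "R rThree = 3" "R rn = n" "R rg = g" "R rb = b" "R rZ = ?Z" "R rE = 2 ^ b"
    "R rF = ?Z - 1" "R rB = B" "3 + ?Z \<le> length X" "length X \<le> B" "\<forall>x\<in>set X. x < 2 ^ w" "B < 2 ^ w"
    using Cons.prems(1) by (simp_all add: base_def)
  have L: "length L = n * g" "\<And>ws. ws \<in> set L \<Longrightarrow> length ws \<le> 2 ^ b"
    "\<And>ws x. ws \<in> set L \<Longrightarrow> x \<in> set ws \<Longrightarrow> x < 2 ^ b"
    using Cons.prems(4) by (auto simp: Ls valid_part_def)
  have seg: "seg X (R rin) (concat (map enc_list L))"
    "seg X (R rin + length (concat (map enc_list L))) (concat (map (\<lambda>L. concat (map enc_list L)) Ls'))"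
    using Cons.prems(5) by (simp_all add: Ls seg_append)
  have ZZ: "?Z \<le> ?Z * ?Z" "1 \<le> ?Z" by simp_all
  have E: "(2::nat) ^ b \<le> ?Z" using pow_le[of 1 k b] assms(1) by simp
  have Y: "num_y k b j \<le> ?Z"
    using num_y_mult_le[OF assms(1), of b j] le_trans[of "num_y k b j" "2 ^ b * num_y k b j" ?Z] by simp
  have len_L: "length (part_image prob k b ?T j L) \<le> n * g * (8 * ?Z)"
    using length_part_image[OF assms(1), of n g b L] Cons.prems(4) by (simp add: Ls)
  show ?case unfolding phases.simps wp_Seq
  proof (rule wp_setup_range[OF assms(1) j b0(1,2,6,7,8) W(1-3)])
    fix t :: nat and R1
    assume t1: "t \<le> 12" and fr1: "\<forall>r. r \<notin> {rY, rP, rQ, rJ, rt, rs} \<longrightarrow> R1 r = R r"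
      and R1: "R1 rY = num_y k b j" "R1 rP = 2 ^ (j * b)" "R1 rQ = mul_y b j" "R1 rJ = of_bool (j \<noteq> 0)"
        "j \<noteq> 0 \<Longrightarrow> R1 rs = block k b j"
    have b1: "R1 0 = 0" "R1 rOne = 1" "R1 rZ = ?Z" "R1 rF = ?Z - 1"
      using fr1 b0 by simp_all
    show "wp w (setup_code prob j) (\<lambda>ta. wp w expand_sets (\<lambda>tb. wp w (phases prob js) (\<lambda>u. Q (t + (ta + (tb + u)))))) (R1, mem X B ys)"
    proof (rule wp_setup_code[OF assms(1) j b1 R1(5) W(1)])
      fix ta :: nat and R2
      assume t2: "ta \<le> 10" and fr2: "\<forall>r. r \<notin> {ra, rp, rq, rc, rt, rs} \<longrightarrow> R2 r = R1 r"
        and R2: "R2 ra = code_add prob k b j" "R2 rp = code_pos prob k b j" "R2 rq = code_neg prob k b j"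
          "R2 rc = code_junk prob k b j"
      have R2': "R2 rY = num_y k b j" "R2 rP = 2 ^ (j * b)" "R2 rQ = mul_y b j" "R2 rJ = of_bool (j \<noteq> 0)"
        using fr2 R1 by simp_all
      have R2b: "R2 r = R r" if "r \<notin> {rY, rP, rQ, rJ, rt, rs, ra, rp, rq, rc}" for r
        using fr1 fr2 that by simp
      have lin: "code_add prob k b j + u * code_pos prob k b j < 2 ^ w \<and>
        code_junk prob k b j + u * code_pos prob k b j < 2 ^ w \<and> u * code_neg prob k b j < 2 ^ w" if "u < ?Z" for u
      proof -
        note cb = code_bounds[OF assms(1) j, of prob b]
        have "u * code_pos prob k b j \<le> ?Z * ?Z" "u * code_neg prob k b j \<le> ?Z * ?Z"
          using that cb by (auto intro: mult_mono)
        then show ?thesis using cb W(1) by linarith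
      qed
      have ready: "ready w ?Z X B R2"
      proof -
        have "?Z + ?Z < 2 ^ w" "num_y k b j < 2 ^ w" using W(1) ZZ Y by linarith+
        moreover have "mul_y b j \<le> ?Z" using E ZZ(2) by (simp add: mul_y_def)
        ultimately show ?thesis unfolding ready_def R2 R2'
          using b0 lin by (simp add: R2b)
      qed
      have exp: "expansion X R2 = word_image prob k b ?T j"
        by (rule expansion_eq_word_image[OF R2' R2])
      have es: "expanded_sets X R2 L = part_image prob k b ?T j L"
        by (simp add: expanded_sets_def part_image_def exp set_image_def enc_list_def Let_def)
      show "wp w expand_sets (\<lambda>tb. wp w (phases prob js) (\<lambda>u. Q (t + (ta + (tb + u))))) (R2, mem X B ys)"
      proof (rule wp_expand_sets[OF ready, where L = L and E = "2 ^ b"])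
        show "seg X (R2 rin) (concat (map (\<lambda>ws. length ws # ws) L))"
          using seg(1) by (simp add: R2b enc_list_def[abs_def])
        show "B + length ys + (length L + 1) * (2 ^ b * (R2 rY + 1) + R2 rY + 4) < 2 ^ w"
        proof -
          have "(n * g + 1) * (2 ^ b * (num_y k b j + 1) + num_y k b j + 4) \<le> (n * g + 1) * (8 * ?Z)"
            using size_bound(1)[OF assms(1), of b j] by (rule mult_left_mono) simp
          also have "\<dots> \<le> length (j # js) * ((n * g + 1) * (8 * ?Z))" by simp
          finally show ?thesis using Cons.prems(7) unfolding R2' L(1) by linarith
        qed
        show "in_range ?Z R2 x" if "ws \<in> set L" "x \<in> set ws" for ws x
          using image_index_less[OF assms(1) j L(3)[OF that]] less_le_trans[OF L(3)[OF that] E]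
          by (simp add: in_range_def R2')
        have "1 < (2::nat) ^ w" using W(1) ZZ by linarith
        then show "R2 rJ < 2 ^ w" by (simp add: R2')
        show "2 ^ b < (2::nat) ^ w" using E W(1) ZZ by linarith
      next
        fix tb :: nat and R3 M3
        assume t3: "tb \<le> length L * (2 ^ b * (14 * R2 rY + 17) + 10) + 2"
          and fr3: "\<forall>r. r \<notin> {rin, rout, rt, rs, ru, ry, rw, rm, rh, rS} \<longrightarrow> R3 r = R2 r"
          and R3: "R3 rin = R2 rin + length (concat (map (\<lambda>ws. length ws # ws) L))"
            "R3 rout = B + length (ys @ expanded_sets X R2 L)"
          and M3: "M3 = mem X B (ys @ expanded_sets X R2 L)"
        have R3b: "R3 r = R r" if "r \<notin> {rin, rout, rt, rs, ru, ry, rw, rm, rh, rS, rY, rP, rQ, rJ, ra, rp, rq, rc}" for r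
          using fr3 R2b that by simp
        have base3: "base w k n g b X B R3" using b0 by (simp add: base_def R3b)
        have time3: "tb \<le> n * g * (41 * ?Z) + 2"
        proof -
          have "n * g * (2 ^ b * (14 * num_y k b j + 17) + 10) \<le> n * g * (41 * ?Z)"
            using size_bound(2)[OF assms(1), of b j] by (rule mult_left_mono) simp
          then show ?thesis using t3 unfolding R2' L(1) by linarith
        qed
        show "wp w (phases prob js) (\<lambda>u. Q (t + (ta + (tb + u)))) (R3, M3)"
          unfolding M3
        proof (rule Cons.IH[OF base3, where Ls = Ls'])
          show "seg X (R3 rin) (concat (map (\<lambda>L. concat (map enc_list L)) Ls'))"
            using seg(2) by (simp add: R3 R2b enc_list_def[abs_def])
          show "B + length (ys @ expanded_sets X R2 L) + length js * ((n * g + 1) * (8 * ?Z)) < 2 ^ w"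
          proof -
            have "length (expanded_sets X R2 L) \<le> (n * g + 1) * (8 * ?Z)"
              using len_L unfolding es by (simp add: add_mult_distrib)
            then show ?thesis using Cons.prems(7) by (simp add: add_mult_distrib)
          qed
        next
          fix u :: nat and R4 M4
          assume t4: "u \<le> length js * (n * g * (41 * ?Z) + 26) + 1"
            and 4: "base w k n g b X B R4" "\<forall>r>28. R4 r = R3 r"
              "R4 rout = B + length ((ys @ expanded_sets X R2 L) @ concat (map2 (part_image prob k b ?T) js Ls'))"
              "M4 = mem X B ((ys @ expanded_sets X R2 L) @ concat (map2 (part_image prob k b ?T) js Ls'))"
          show "Q (t + (ta + (tb + u))) (R4, M4)"
          proof (rule Cons.prems(8)[OF _ 4(1)])
            show "t + (ta + (tb + u)) \<le> length (j # js) * (n * g * (41 * ?Z) + 26) + 1"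
              using t1 t2 time3 t4 by (simp add: add_mult_distrib)
          qed (use 4 R3b in \<open>auto simp: Ls es\<close>)
        qed (use Cons.prems Ls R3 in auto)
      qed (use L W R2b b0 num_y_pos in \<open>auto simp: R2' Cons.prems(6)\<close>)
    qed
  qed
qed

section \<open>Entry and exit code of the reduction\<close>

fun store_width :: "problem \<Rightarrow> com" where
  "store_width PrOV = Op Add rt rt rt"
| "store_width PrXOR = Op Add rt rt 0"
| "store_width PrSUM = Op Add rt rt 0"

text \<open>\<open>rt\<close> still holds \<open>k * b\<close> when \<open>store_width\<close> is
  reached; doubling it there for \<open>OV\<close> and adding one afterwards yields the new word
  width.\<close>

definition prologue :: "problem \<Rightarrow> nat \<Rightarrow> com" where
  "prologue prob k =
     Const rOne 1 ;; Const rThree 3 ;; Load rn 0 ;; Load rg rOne ;; Op Add rt rOne rOne ;; Load rb rt ;;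
     Const rs k ;; Op Mul rt rs rb ;; Op Shl rZ rOne rt ;; Op Shl rE rOne rb ;; Op Sub rF rZ rOne ;;
     Op Add rin rThree rZ ;; Op Add rh rE rOne ;; Op Mul rw rn rg ;; Op Mul rw rw rs ;; Op Mul rw rw rh ;;
     Op Add rB rin rw ;; Op Add rout rB 0 ;;
     Store rout rn ;; Op Add rout rout rOne ;; Store rout rg ;; Op Add rout rout rOne ;;
     store_width prob ;; Op Add rt rt rOne ;; Store rout rt ;; Op Add rout rout rOne"

text \<open>Used with \<open>28\<close>, the largest register that the reduction writes. Together
  with clearing the memory this makes the state literally equal to \<open>initial ys\<close>, so
  that the given program can follow by \<open>Seq\<close>.\<close>

primrec clear_regs :: "nat \<Rightarrow> com" where
  "clear_regs 0 = Const 0 0"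
| "clear_regs (Suc m) = Const (Suc m) 0 ;; clear_regs m"

definition epilogue :: com where
  "epilogue =
     Op Sub rS rout rB ;; Const rin 0 ;; Op Add rh rB 0 ;;
     for_loop rS (Load rt rh ;; Store rin rt ;; Op Add rin rin rOne ;; Op Add rh rh rOne) ;;
     Op Add rm rB 0 ;; for_loop rm (Store rin 0 ;; Op Add rin rin rOne) ;;
     clear_regs 28"

definition reduction :: "problem \<Rightarrow> nat \<Rightarrow> com" where
  "reduction prob k = prologue prob k ;; phases prob [0..<k] ;; epilogue"

text \<open>The input carries no total length, so the output starts behind the largest possible
  input: three parameters, the truth table, and for each of the \<open>n * g * k\<close> components
  a length and at most \<open>2 ^ b\<close> words.\<close>

definition out_base :: "nat \<Rightarrow> nat \<Rightarrow> nat \<Rightarrow> nat \<Rightarrow> nat" where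
  "out_base k n g b = 3 + 2 ^ (k * b) + n * g * k * (2 ^ b + 1)"

lemma mem_initial: "snd (initial X) = mem X B []"
  by (auto simp: initial_def mem_def fun_eq_iff)

lemma wp_clear_regs:
  assumes "\<And>R'. (\<forall>r. R' r = (if r \<le> m then 0 else R r)) \<Longrightarrow> Q (Suc m) (R', M)"
  shows "wp w (clear_regs m) Q (R, M)"
  using assms
proof (induction m arbitrary: R Q)
  case (Suc m)
  show ?case by (simp add: wp_simps) (rule Suc.IH, rule Suc.prems, auto)
qed (simp add: wp_simps)

text \<open>Copying upwards is safe even if source and target overlap, as cell \<open>B + i\<close>
  is read in round \<open>i\<close> and written no earlier than in round \<open>B + i\<close>.
  Afterwards the \<open>B\<close> cells behind the copy are zeroed; they contain whatever is left of
  the input and of the original output, since all of it lies below \<open>B + S\<close>.\<close>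

lemma wp_epilogue:
  assumes R: "R 0 = 0" "R rOne = 1" "R rB = B" "R rout = B + length ys" "\<forall>r>28. R r = 0"
    and X: "length X \<le> B" "\<forall>y\<in>set ys. y < 2 ^ w" "B + length ys + 1 < 2 ^ w"
    and Q: "\<And>t. t \<le> 6 * length ys + 4 * B + 40 \<Longrightarrow> Q t (initial ys)"
  shows "wp w epilogue Q (R, mem X B ys)"
proof -
  define S where "S = length ys"
  define M1 where "M1 = (\<lambda>i a. if a < i then ys ! a else mem X B ys a)"
  define M2 where "M2 = (\<lambda>i a. if a < S then ys ! a else if a < S + i then 0 else mem X B ys a)"
  define R0 where "R0 = R(rS := S, rin := 0, rh := B)"
  define I where "I = (\<lambda>i R' M'. (\<forall>r. r \<notin> {rS, rin, rh, rt} \<longrightarrow> R' r = R0 r) \<and> R' rin = i \<and> R' rh = B + i \<and> M' = M1 i)"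
  have loop1: "wp w (for_loop rS (Load rt rh ;; Store rin rt ;; Op Add rin rin rOne ;; Op Add rh rh rOne))
     (\<lambda>t (R', M'). t \<le> S * 6 + 1 \<and> I S R' M') (R0, mem X B ys)"
  proof (rule wp_for_loop[where I = I and N = S and \<tau> = 4])
    fix i R' M' assume i: "i < S" and I: "I i R' M'" and c: "R' rS = S - i"
    have fr: "\<forall>r. r \<notin> {rS, rin, rh, rt} \<longrightarrow> R' r = R0 r" and R': "R' rin = i" "R' rh = B + i" "M' = M1 i"
      using I by (simp_all add: I_def)
    have one: "R0 rOne = 1" using R by (simp add: R0_def)
    have M: "M1 i (B + i) = ys ! i" "ys ! i < 2 ^ w"
      using i X by (simp_all add: M1_def S_def mem_output)
    have up: "(M1 i)(i := ys ! i) = M1 (Suc i)"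
      by (auto simp: M1_def fun_eq_iff less_Suc_eq)
    have sm: "Suc i < 2 ^ w" "Suc (B + i) < 2 ^ w" using i X(3) by (simp_all add: S_def)
    show "wp w (Load rt rh ;; Store rin rt ;; Op Add rin rin rOne ;; Op Add rh rh rOne)
       (\<lambda>t (R'', M''). t \<le> 4 \<and> R'' rS = S - i \<and> R'' rOne = 1 \<and> I (Suc i) (R''(rS := S - Suc i)) M'') (R', M')"
      using fr one c sm M by (simp add: wp_simps R' up I_def)
  next
    show "I 0 R0 (mem X B ys)" by (simp add: I_def R0_def M1_def)
  qed (use X R in \<open>auto simp: S_def R0_def\<close>)
  have loop2: "wp w (for_loop rm (Store rin 0 ;; Op Add rin rin rOne))
     (\<lambda>t (R'', M''). t \<le> B * 4 + 1 \<and> (\<forall>r>28. R'' r = 0) \<and> M'' = M2 B) (R'(rm := B), M1 S)"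
    if fr: "\<forall>r. r \<notin> {rS, rin, rh, rt} \<longrightarrow> R' r = R r" and R': "R' rin = S" for R'
  proof (rule wp_for_loop[where N = B and \<tau> = 2 and
      I = "\<lambda>i R'' M''. (\<forall>r. r \<notin> {rS, rin, rh, rt, rm} \<longrightarrow> R'' r = R r) \<and> R'' rin = S + i \<and> M'' = M2 i"])
    fix i R'' M''
    assume i: "i < B" and c: "R'' rm = B - i"
      and I: "(\<forall>r. r \<notin> {rS, rin, rh, rt, rm} \<longrightarrow> R'' r = R r) \<and> R'' rin = S + i \<and> M'' = M2 i"
    have up: "(M2 i)(S + i := 0) = M2 (Suc i)"
      by (auto simp: M2_def fun_eq_iff less_Suc_eq)
    have sm: "Suc (S + i) < 2 ^ w" using i X(3) by (simp add: S_def)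
    show "wp w (Store rin 0 ;; Op Add rin rin rOne) (\<lambda>t (R', M'). t \<le> 2 \<and> R' rm = B - i \<and> R' rOne = 1 \<and>
       ((\<forall>r. r \<notin> {rS, rin, rh, rt, rm} \<longrightarrow> (R'(rm := B - Suc i)) r = R r) \<and>
         (R'(rm := B - Suc i)) rin = S + Suc i \<and> M' = M2 (Suc i))) (R'', M'')"
      using I R c sm by (simp add: wp_simps up)
  next
    show "(\<forall>r. r \<notin> {rS, rin, rh, rt, rm} \<longrightarrow> (R'(rm := B)) r = R r) \<and> (R'(rm := B)) rin = S + 0 \<and> M1 S = M2 0"
      using fr R' by (auto simp: M1_def M2_def fun_eq_iff)
  qed (use X R in auto)
  have fin: "M2 B = snd (initial ys)"
    using X(1) by (auto simp: M2_def initial_def fun_eq_iff mem_def S_def)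
  have clear: "wp w (clear_regs 28) (\<lambda>u. Q (Suc (Suc (Suc (Suc (t1 + (t2 + u))))))) (R'', M2 B)"
    if "t1 \<le> S * 6 + 1" "t2 \<le> B * 4 + 1" "\<forall>r>28. R'' r = 0" for t1 t2 R''
  proof (rule wp_clear_regs)
    fix R3 assume "\<forall>r. R3 r = (if r \<le> 28 then 0 else R'' r)"
    then have "(R3, M2 B) = initial ys"
      using that(3) fin by (auto simp: initial_def fun_eq_iff)
    then show "Q (Suc (Suc (Suc (Suc (t1 + (t2 + Suc 28)))))) (R3, M2 B)"
      using Q that(1,2) by (simp add: S_def)
  qed
  have "wp w (for_loop rS (Load rt rh ;; Store rin rt ;; Op Add rin rin rOne ;; Op Add rh rh rOne))
     (\<lambda>t1. wp w (Op Add rm rB 0 ;; for_loop rm (Store rin 0 ;; Op Add rin rin rOne) ;; clear_regs 28)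
        (\<lambda>u. Q (Suc (Suc (Suc (t1 + u)))))) (R0, mem X B ys)"
  proof (rule wp_mono[OF loop1], clarify)
    fix t1 R' M' assume t1: "t1 \<le> S * 6 + 1" and I: "I S R' M'"
    have fr: "\<forall>r. r \<notin> {rS, rin, rh, rt} \<longrightarrow> R' r = R r" and R': "R' rin = S" "M' = M1 S"
      using I by (simp_all add: I_def R0_def)
    have "wp w (for_loop rm (Store rin 0 ;; Op Add rin rin rOne))
      (\<lambda>t2. wp w (clear_regs 28) (\<lambda>u. Q (Suc (Suc (Suc (Suc (t1 + (t2 + u)))))))) (R'(rm := B), M1 S)"
      by (rule wp_mono[OF loop2[OF fr R'(1)]]) (auto intro: clear[OF t1])
    then show "wp w (Op Add rm rB 0 ;; for_loop rm (Store rin 0 ;; Op Add rin rin rOne) ;; clear_regs 28)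
        (\<lambda>u. Q (Suc (Suc (Suc (t1 + u))))) (R', M')"
      using fr R X(3) by (simp add: wp_Seq wp_Op R'(2))
  qed
  then show ?thesis unfolding epilogue_def
    using R X(3) by (simp add: wp_Seq wp_Op wp_Const R0_def S_def)
qed

lemma wp_prologue:
  assumes "X = [n, g, b] @ tbl @ xs" "length tbl = 2 ^ (k * b)" "length X \<le> out_base k n g b"
    and B: "B = out_base k n g b" and "B + 3 < 2 ^ w" "2 \<le> k"
    and "fits w k n g b" "\<forall>x\<in>set X. x < 2 ^ w" "width prob k b < 2 ^ w"
    and Q: "\<And>t R'. t \<le> 30 \<Longrightarrow> base w k n g b X B R' \<Longrightarrow> \<forall>r>28. R' r = 0 \<Longrightarrow> R' rin = 3 + 2 ^ (k * b) \<Longrightarrow>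
        R' rout = B + length [n, g, width prob k b] \<Longrightarrow> Q t (R', mem X B [n, g, width prob k b])"
  shows "wp w (prologue prob k) Q (initial X)"
proof -
  let ?Z = "2 ^ (k * b) :: nat"
  have X: "mem X B [] 0 = n" "mem X B [] (Suc 0) = g" "mem X B [] 2 = b" "length X \<ge> 3 + ?Z"
    "n < 2 ^ w" "g < 2 ^ w" "b < 2 ^ w"
    using assms(1,2,8) by (simp_all add: mem_def)
  have X2: "mem X B [] (Suc (Suc 0)) = b" using X(3) by (simp add: numeral_2_eq_2)
  have W: "20 * (?Z * ?Z) < 2 ^ w" "k * b < 2 ^ w" "k < 2 ^ w" "n * g < 2 ^ w"
    using assms(7) by (simp_all add: fits_def)
  have ZZ: "?Z \<le> ?Z * ?Z" "1 \<le> ?Z" by simp_all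
  have E: "(2::nat) ^ b \<le> ?Z" using pow_le[of 1 k b] assms(6) by simp
  have s: "Suc 0 < 2 ^ w" "2 < (2::nat) ^ w" "3 < (2::nat) ^ w" "?Z < 2 ^ w" "(2::nat) ^ b < 2 ^ w" "?Z - Suc 0 < 2 ^ w"
    "3 + ?Z < 2 ^ w" "Suc (2 ^ b) < (2::nat) ^ w"
    using W(1) ZZ E by linarith+
  have B': "B = 3 + ?Z + n * g * k * Suc (2 ^ b)" using B by (simp add: out_base_def)
  have p: "n * g * k * Suc (2 ^ b) < 2 ^ w" "B < 2 ^ w" "Suc B < 2 ^ w" "Suc (Suc B) < 2 ^ w" "Suc (Suc (Suc B)) < 2 ^ w"
    using assms(5) B' by linarith+
  have "n * g * k \<le> n * g * k * Suc (2 ^ b)" by simp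
  then have p2: "n * g * k < 2 ^ w" using p(1) by linarith
  have mem3: "(mem X B [])(B := x, Suc B := y, Suc (Suc B) := z) = mem X B [x, y, z]" for x y z
  proof -
    have "length X \<le> B" using assms(3) B by simp
    from mem_append[OF this, of "[]" x] mem_append[OF this, of "[x]" y] mem_append[OF this, of "[x, y]" z]
    show ?thesis by (simp add: numeral_2_eq_2)
  qed
  have init: "initial X = ((\<lambda>_. 0), mem X B [])"
    using mem_initial[of X B] by (simp add: initial_def)
  have base: "base w k n g b X B R'" if "R' 0 = 0" "R' rOne = 1" "R' rThree = 3" "R' rn = n" "R' rg = g" "R' rb = b"
     "R' rZ = ?Z" "R' rE = 2 ^ b" "R' rF = ?Z - 1" "R' rB = B" for R'
    using that assms X p by (simp add: base_def)
  have Beq: "3 + ?Z + (n * g * k + n * g * k * 2 ^ b) = B" using B' by simp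
  have QI: "Q t (R', mem X B [n, g, x])" if "x = width prob k b" "t \<le> 30" "\<forall>r>28. R' r = 0"
    "R' 0 = 0" "R' rOne = 1" "R' rThree = 3" "R' rn = n" "R' rg = g" "R' rb = b"
    "R' rZ = ?Z" "R' rE = 2 ^ b" "R' rF = ?Z - 1" "R' rB = B" "R' rin = 3 + ?Z" "R' rout = Suc (Suc (Suc B))"
    for t R' x
    unfolding that(1) using that by (intro Q base) simp_all
  show ?thesis
  proof (cases prob)
    case PrOV
    have "width prob k b < 2 ^ w" by fact
    then show ?thesis unfolding init prologue_def
      using s p p2 W X(1,2,5-) by (simp add: wp_simps X2 push_bit_eq_mult Beq mem3 PrOV) (rule QI; simp add: PrOV)
  next
    case PrXOR
    have "width prob k b < 2 ^ w" by fact
    then show ?thesis unfolding init prologue_def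
      using s p p2 W X(1,2,5-) by (simp add: wp_simps X2 push_bit_eq_mult Beq mem3 PrXOR) (rule QI; simp add: PrXOR)
  next
    case PrSUM
    have "width prob k b < 2 ^ w" by fact
    then show ?thesis unfolding init prologue_def
      using s p p2 W X(1,2,5-) by (simp add: wp_simps X2 push_bit_eq_mult Beq mem3 PrSUM) (rule QI; simp add: PrSUM)
  qed
qed

lemma exec_reduction:
  assumes "2 \<le> k" "X = [n, g, b] @ tbl @ concat (map (\<lambda>L. concat (map enc_list L)) Ls)"
    and "length tbl = 2 ^ (k * b)" "length Ls = k" "\<forall>L\<in>set Ls. valid_part n g b L"
    and "fits w k n g b" "\<forall>x\<in>set X. x < 2 ^ w" "width prob k b < 2 ^ w"
    and W: "out_base k n g b + 3 + k * ((n * g + 1) * (8 * 2 ^ (k * b))) + 1 < 2 ^ w"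
    and ys: "ys = [n, g, width prob k b] @
        concat (map2 (part_image prob k b (\<lambda>u. X ! (3 + u) \<noteq> 0)) [0..<k] Ls)"
      "\<forall>y\<in>set ys. y < 2 ^ w"
  shows "\<exists>t \<le> 200 * ((k + 1) * ((n * g + 1) * 2 ^ (k * b))). exec w (reduction prob k) (initial X) t (initial ys)"
proof -
  let ?Z = "2 ^ (k * b) :: nat" and ?B = "out_base k n g b"
  let ?T = "\<lambda>u. X ! (3 + u) \<noteq> 0"
  have E: "(2::nat) ^ b \<le> ?Z" "1 \<le> ?Z" using pow_le[of 1 k b] assms(1) by simp_all
  have len1: "length (concat (map (\<lambda>L. concat (map enc_list L)) Ls)) \<le> length Ls * (n * g * (2 ^ b + 1))"
  proof (rule length_concat_le)
    fix L assume "L \<in> set Ls"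
    then have L: "valid_part n g b L" using assms by simp
    then have "length (concat (map enc_list L)) \<le> length L * (2 ^ b + 1)"
      by (intro length_concat_le) (auto simp: valid_part_def enc_list_def)
    then show "length (concat (map enc_list L)) \<le> n * g * (2 ^ b + 1)" using L by (simp add: valid_part_def)
  qed
  then have lenX: "length X \<le> ?B" using assms(2,3,4) by (simp add: out_base_def algebra_simps)
  have "length (concat (map2 (part_image prob k b ?T) js Ls')) \<le> length js * (n * g * (8 * ?Z))"
    if "length Ls' = length js" "\<forall>L\<in>set Ls'. valid_part n g b L" for js Ls'
    using that
  proof (induction js Ls' rule: list_induct2'[case_names nil cons1 cons2 both])
    case (both j js L Ls')
    then show ?case using length_part_image[OF assms(1), of n g b L prob ?T j] by simp
  qed simp_all
  from this[of Ls "[0..<k]"] have lenY: "length ys \<le> 3 + k * (n * g * (8 * ?Z))"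
    using assms(4,5) by (simp add: ys)
  have small: "?B + length ys + 1 < 2 ^ w"
  proof -
    have "k * (n * g * (8 * ?Z)) \<le> k * ((n * g + 1) * (8 * ?Z))" by (intro mult_left_mono mult_right_mono) auto
    then show ?thesis using lenY W by linarith
  qed
  have Bb: "?B \<le> 4 * ?Z + 2 * (n * g * k * ?Z)"
  proof -
    have "n * g * k * (2 ^ b + 1) \<le> n * g * k * (2 * ?Z)" using E by (intro mult_left_mono) linarith+
    then show ?thesis using E unfolding out_base_def by linarith
  qed
  have seg: "seg X (3 + ?Z) (concat (map (\<lambda>L. concat (map enc_list L)) Ls))"
    unfolding seg_def using assms(2,3) by (simp add: nth_append numeral_3_eq_3)
  have "wp w (reduction prob k) (\<lambda>t s. t \<le> 200 * ((k + 1) * ((n * g + 1) * ?Z)) \<and> s = initial ys) (initial X)"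
    unfolding reduction_def wp_Seq
  proof (rule wp_prologue[OF assms(2,3) lenX refl _ assms(1,6,7,8)])
    show "?B + 3 < 2 ^ w" using W by linarith
  next
    fix t :: nat and R1
    assume 1: "t \<le> 30" "base w k n g b X ?B R1" "\<forall>r>28. R1 r = 0" "R1 rin = 3 + ?Z"
      "R1 rout = ?B + length [n, g, width prob k b]"
    show "wp w (phases prob [0..<k]) (\<lambda>ta. wp w epilogue (\<lambda>u s. t + (ta + u) \<le> 200 * ((k + 1) * ((n * g + 1) * ?Z)) \<and>
      s = initial ys)) (R1, mem X ?B [n, g, width prob k b])"
    proof (rule wp_phases[OF assms(1,6) 1(2) _ _ assms(5) _ 1(5)])
      show "seg X (R1 rin) (concat (map (\<lambda>L. concat (map enc_list L)) Ls))" using seg 1(4) by simp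
      show "?B + length [n, g, width prob k b] + length [0..<k] * ((n * g + 1) * (8 * ?Z)) < 2 ^ w"
        using W by simp
    next
      fix ta :: nat and R2 M2
      assume 2: "ta \<le> length [0..<k] * (n * g * (41 * ?Z) + 26) + 1" "base w k n g b X ?B R2" "\<forall>r>28. R2 r = R1 r"
        "R2 rout = ?B + length ([n, g, width prob k b] @ concat (map2 (part_image prob k b ?T) [0..<k] Ls))"
        "M2 = mem X ?B ([n, g, width prob k b] @ concat (map2 (part_image prob k b ?T) [0..<k] Ls))"
      have M2: "M2 = mem X ?B ys" "R2 rout = ?B + length ys" using 2 by (simp_all add: ys)
      show "wp w epilogue (\<lambda>u s. t + (ta + u) \<le> 200 * ((k + 1) * ((n * g + 1) * ?Z)) \<and> s = initial ys) (R2, M2)"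
        unfolding M2(1)
      proof (rule wp_epilogue[where R = R2 and X = X and B = ?B and ys = ys])
        fix u assume u: "u \<le> 6 * length ys + 4 * ?B + 40"
        have aux: "t + (ta + u) \<le> 30 + (A + 1) + (6 * C + 4 * D + 40)"
          if "ta \<le> A + 1" "l \<le> C" "B' \<le> D" "u \<le> 6 * l + 4 * B' + 40" for A C D l B' :: nat
          using that 1(1) by linarith
        have "t + (ta + u) \<le> 30 + (k * (n * g * (41 * ?Z) + 26) + 1) + (6 * (3 + k * (n * g * (8 * ?Z))) + 4 * (4 * ?Z + 2 * (n * g * k * ?Z)) + 40)"
          by (rule aux[OF 2(1)[unfolded length_upt minus_nat.diff_0] lenY Bb u])
        \<comment> \<open>\<open>97 = 41 + 6 * 8 + 4 * 2\<close>: the phases, copying the output at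
          \<open>6\<close> steps per cell, and clearing at \<open>4\<close> steps per cell below the
          output.\<close>
        also have "\<dots> = 97 * (n * g * k * ?Z) + 26 * k + 16 * ?Z + 89"
          by (simp add: algebra_simps)
        also have "\<dots> \<le> 200 * ((k + 1) * ((n * g + 1) * ?Z))"
        proof -
          have "k \<le> k * ?Z" by simp
          moreover have "200 * ((k + 1) * ((n * g + 1) * ?Z)) =
              200 * (n * g * k * ?Z) + 200 * (k * ?Z) + 200 * (n * g * ?Z) + 200 * ?Z"
            by (simp add: algebra_simps)
          ultimately show ?thesis using E(2) by linarith
        qed
        finally show "t + (ta + u) \<le> 200 * ((k + 1) * ((n * g + 1) * ?Z)) \<and> initial ys = initial ys" by simp
      qed (use 1(3) 2(2,3) M2(2) lenX ys(2) small in \<open>simp_all add: base_def\<close>)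
    qed (use assms(4) in auto)
  qed
  then show ?thesis unfolding wp_def by blast
qed

section \<open>Encoding the words of a tuple\<close>

definition bits_of :: "nat \<Rightarrow> nat \<Rightarrow> bits" where
  "bits_of b x = map (bit x) [0..<b]"

lemma length_bits_of [simp]: "length (bits_of b x) = b"
  by (simp add: bits_of_def)

lemma nth_bits_of [simp]: "a < b \<Longrightarrow> bits_of b x ! a = bit x a"
  by (simp add: bits_of_def)

lemma bits_val_bits_of: "bits_val (bits_of b x) = take_bit b x"
  by (simp add: bits_val_def bits_of_def horner_sum_bit_eq_take_bit)

lemma bits_val_bits_of_less: "x < 2 ^ b \<Longrightarrow> bits_val (bits_of b x) = x"
  by (simp add: bits_val_bits_of take_bit_nat_eq_self)

lemma bit_bits_val: "bit (bits_val w) a \<longleftrightarrow> a < length w \<and> w ! a"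
  by (simp add: bits_val_def bit_horner_sum_bit_iff)

lemma bits_of_bits_val: "length w = b \<Longrightarrow> bits_of b (bits_val w) = w"
  by (rule nth_equalityI) (simp_all add: bit_bits_val)

lemma nat_less_exp_iff: "(x::nat) < 2 ^ n \<longleftrightarrow> (\<forall>a\<ge>n. \<not> bit x a)"
proof
  assume "x < 2 ^ n"
  then have "take_bit n x = x" by (rule take_bit_nat_eq_self)
  then show "\<forall>a\<ge>n. \<not> bit x a" by (metis bit_take_bit_iff linorder_not_le)
next
  assume *: "\<forall>a\<ge>n. \<not> bit x a"
  have "take_bit n x = x"
    by (rule bit_eqI) (use * in \<open>auto simp: bit_take_bit_iff not_le[symmetric]\<close>)
  then show "x < 2 ^ n" by (simp add: take_bit_nat_eq_self_iff)
qed

lemma bits_val_less: "length w = b \<Longrightarrow> bits_val w < 2 ^ b"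
  by (simp add: nat_less_exp_iff bit_bits_val)

lemma bits_of_inj: "x < 2 ^ b \<Longrightarrow> y < 2 ^ b \<Longrightarrow> bits_of b x = bits_of b y \<Longrightarrow> x = y"
  by (metis bits_val_bits_of_less)

fun prob_fun :: "problem \<Rightarrow> nat \<Rightarrow> bits list \<Rightarrow> bool" where
  "prob_fun PrOV = f_OV"
| "prob_fun PrXOR = f_XOR"
| "prob_fun PrSUM = f_SUM"

lemma f_OV_bits_of: "f_OV b (map (bits_of b) xs) \<longleftrightarrow> (\<forall>a<b. \<exists>x\<in>set xs. \<not> bit x a)"
proof -
  have "(\<Prod>w\<leftarrow>map (bits_of b) xs. of_bool (w ! a) :: nat) = 0 \<longleftrightarrow> (\<exists>x\<in>set xs. \<not> bit x a)" if "a < b" for a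
    using that by (induction xs) auto
  then show ?thesis unfolding f_OV_def by auto
qed

lemma f_XOR_bits_of: "f_XOR b (map (bits_of b) xs) \<longleftrightarrow> (\<forall>a<b. \<not> bit (fold xor xs 0) a)"
proof -
  have map2: "map2 (\<lambda>x y. x \<noteq> y) (bits_of b x) (bits_of b z) = bits_of b (xor x z)" for x z
    by (rule nth_equalityI) (simp_all add: bit_xor_iff)
  have "fold (map2 (\<lambda>x y. x \<noteq> y)) (map (bits_of b) xs) (bits_of b z) = bits_of b (fold xor xs z)" for z
    by (induction xs arbitrary: z) (simp_all only: list.map fold_simps map2)
  moreover have "replicate b False = bits_of b 0" by (rule nth_equalityI) simp_all
  ultimately have "f_XOR b (map (bits_of b) xs) \<longleftrightarrow> bits_of b (fold xor xs 0) = bits_of b 0"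
    unfolding f_XOR_def by simp
  also have "\<dots> \<longleftrightarrow> (\<forall>a<b. \<not> bit (fold xor xs 0) a)"
    by (auto simp: list_eq_iff_nth_eq)
  finally show ?thesis .
qed

lemma f_SUM_bits_of:
  assumes "\<And>x. x \<in> set xs \<Longrightarrow> x < 2 ^ b"
  shows "f_SUM b (map (bits_of b) xs) \<longleftrightarrow> sum_list xs mod 2 ^ b = 0"
proof -
  have "map (bits_val \<circ> bits_of b) xs = xs"
    using assms by (intro map_idI) (simp add: bits_val_bits_of_less)
  then show ?thesis unfolding f_SUM_def by (simp add: comp_def)
qed

text \<open>Coordinate \<open>j \<ge> 1\<close> is responsible for the bits of digit \<open>j\<close>; coordinate \<open>1\<close> also takes digit \<open>0\<close>.\<close>

definition own :: "nat \<Rightarrow> nat \<Rightarrow> nat \<Rightarrow> bool" where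
  "own b j a \<longleftrightarrow> (if j = 1 then a < 2 * b else j * b \<le> a \<and> a < j * b + b)"

text \<open>The bits stay at their places in \<open>u\<close> instead of being shifted down. Hence
  the parts for different \<open>j \<ge> 1\<close> have disjoint supports and can be put together by
  addition or by exclusive or.\<close>

definition part :: "nat \<Rightarrow> nat \<Rightarrow> nat \<Rightarrow> nat" where
  "part b j u = (if j = 1 then take_bit (2 * b) u else push_bit (j * b) (take_bit b (drop_bit (j * b) u)))"

lemma bit_part: "bit (part b j u) a \<longleftrightarrow> bit u a \<and> own b j a"
  by (auto simp: part_def own_def bit_take_bit_iff bit_push_bit_iff bit_drop_bit_eq)

text \<open>The only possible owner of position \<open>a\<close> is
  \<open>max 1 (a div b)\<close>.\<close>

lemma own_unique:
  assumes "own b i a" "own b j a" "1 \<le> i" "1 \<le> j"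
  shows "i = j"
proof -
  have *: "j = max 1 (a div b)" if "own b j a" "1 \<le> j" for j
  proof (cases "j = 1")
    case True
    then have "a div b < 2" using that by (simp add: own_def less_mult_imp_div_less)
    then show ?thesis using True by simp
  next
    case False
    then have "a div b = j" using that
      by (intro div_nat_eqI) (auto simp: own_def mult.commute add.commute)
    then show ?thesis using that False by simp
  qed
  show ?thesis using *[of i] *[of j] assms by simp
qed

lemma own_exists:
  assumes "a < k * b" "2 \<le> k"
  obtains j where "j \<in> {1..<k}" "own b j a"
proof (cases "a < 2 * b")
  case True
  then show ?thesis using that[of 1] assms by (simp add: own_def)
next
  case False
  have b: "b > 0" using assms by (cases b) auto
  have 1: "2 \<le> a div b" using False b by (simp add: less_eq_div_iff_mult_less_eq)
  have 2: "a div b < k" using assms by (simp add: less_mult_imp_div_less)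
  have "a div b * b \<le> a" "a < a div b * b + b"
    using div_mult_mod_eq[of a b] mod_less_divisor[OF b, of a] by linarith+
  then show ?thesis using that[of "a div b"] 1 2 by (simp add: own_def)
qed

lemma own_less:
  assumes "own b j a" "j < k" "2 \<le> k"
  shows "a < k * b"
proof (cases "j = 1")
  case True
  have "2 * b \<le> k * b" using assms(3) by (rule mult_right_mono) simp
  moreover have "a < 2 * b" using True assms(1) by (simp add: own_def)
  ultimately show ?thesis by linarith
next
  case False
  then show ?thesis using assms mult_right_mono[of "Suc j" k b] by (simp add: own_def)
qed

lemma part_less: "j < k \<Longrightarrow> 2 \<le> k \<Longrightarrow> part b j u < 2 ^ (k * b)"
  unfolding nat_less_exp_iff bit_part using own_less by (meson linorder_not_le)

text \<open>Each \<open>y j\<close> vanishes outside its own positions, so equality with a part of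
  \<open>u\<close> comes down to one bit per position and owner. The bitwise tests of
  \<open>OV\<close> and \<open>XOR\<close> are brought into this form.\<close>

lemma all_part_iff:
  assumes "2 \<le> k" "\<And>j. j \<in> {1..<k} \<Longrightarrow> part b j (y j) = y j"
  shows "(\<forall>j\<in>{1..<k}. y j = part b j u) \<longleftrightarrow>
     (\<forall>a<k * b. \<forall>j\<in>{1..<k}. own b j a \<longrightarrow> bit (y j) a = bit u a)"
proof
  assume "\<forall>j\<in>{1..<k}. y j = part b j u"
  then show "\<forall>a<k * b. \<forall>j\<in>{1..<k}. own b j a \<longrightarrow> bit (y j) a = bit u a"
    by (simp add: bit_part)
next
  assume *: "\<forall>a<k * b. \<forall>j\<in>{1..<k}. own b j a \<longrightarrow> bit (y j) a = bit u a"
  show "\<forall>j\<in>{1..<k}. y j = part b j u"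
  proof
    fix j assume j: "j \<in> {1..<k}"
    show "y j = part b j u"
    proof (rule bit_eqI)
      fix a
      have "bit (y j) a \<longleftrightarrow> bit (y j) a \<and> own b j a"
        using assms(2)[OF j] bit_part[of b j "y j" a] by simp
      also have "\<dots> \<longleftrightarrow> bit u a \<and> own b j a"
        using * j own_less[of b j a k] assms(1) by auto
      finally show "bit (y j) a = bit (part b j u) a" by (simp add: bit_part)
    qed
  qed
qed

text \<open>The supports are pairwise disjoint, so the addition has no carries and is a bitwise
  or.\<close>

lemma bit_sum_parts:
  assumes "2 \<le> k" "\<And>j. j \<in> {1..<k} \<Longrightarrow> part b j (y j) = y j" "m \<le> k"
  shows "bit (\<Sum>j\<in>{1..<m}. y j) a \<longleftrightarrow> (\<exists>j\<in>{1..<m}. bit (y j) a)"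
  using assms(3)
proof (induction m arbitrary: a)
  case (Suc m)
  show ?case
  proof (cases "m = 0")
    case False
    have b: "bit (y j) c \<Longrightarrow> own b j c" if "j \<in> {1..<k}" for j c
      using assms(2)[OF that] bit_part[of b j "y j" c] by simp
    have "and (\<Sum>j\<in>{1..<m}. y j) (y m) = 0"
    proof (rule bit_eqI)
      fix c
      show "bit (and (\<Sum>j\<in>{1..<m}. y j) (y m)) c = bit 0 c"
        using Suc b own_unique[of b _ c m] False by (auto simp: bit_and_iff) (metis atLeastLessThan_iff less_imp_le
          less_trans nat_less_le Suc_le_eq One_nat_def neq0_conv)
    qed
    then have "(\<Sum>j\<in>{1..<Suc m}. y j) = or (\<Sum>j\<in>{1..<m}. y j) (y m)"
      using False by (simp add: disjunctive_add_eq_or)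
    then show ?thesis using Suc False by (auto simp: bit_or_iff less_Suc_eq)
  qed simp
qed simp

lemma sum_parts_eq_iff:
  assumes "2 \<le> k" "u < 2 ^ (k * b)" "\<And>j. j \<in> {1..<k} \<Longrightarrow> part b j (y j) = y j"
  shows "u = (\<Sum>j\<in>{1..<k}. y j) \<longleftrightarrow> (\<forall>j\<in>{1..<k}. y j = part b j u)"
proof -
  have b: "bit (y j) c \<Longrightarrow> own b j c" if "j \<in> {1..<k}" for j c
    using assms(3)[OF that] bit_part[of b j "y j" c] by simp
  have s: "bit (\<Sum>j\<in>{1..<k}. y j) a \<longleftrightarrow> (\<exists>j\<in>{1..<k}. bit (y j) a)" for a
    by (rule bit_sum_parts[OF assms(1,3)]) auto
  show ?thesis
  proof
    assume u: "u = (\<Sum>j\<in>{1..<k}. y j)"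
    have "bit (y j) a = bit u a" if "j \<in> {1..<k}" "own b j a" for j a
      using s[of a] that b own_unique[of b _ a j] unfolding u by (metis atLeastLessThan_iff)
    then show "\<forall>j\<in>{1..<k}. y j = part b j u" using all_part_iff[OF assms(1,3)] by blast
  next
    assume *: "\<forall>j\<in>{1..<k}. y j = part b j u"
    show "u = (\<Sum>j\<in>{1..<k}. y j)"
    proof (rule bit_eqI)
      fix a
      show "bit u a = bit (\<Sum>j\<in>{1..<k}. y j) a"
      proof (cases "a < k * b")
        case True
        then obtain j where "j \<in> {1..<k}" "own b j a" using own_exists assms(1) by blast
        then show ?thesis unfolding s using * by (auto simp: bit_part)
      next
        case False
        then have "\<not> bit u a" using assms(2) by (simp add: nat_less_exp_iff)
        then show ?thesis unfolding s using * by (simp add: bit_part)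
      qed
    qed
  qed
qed

section \<open>Bit patterns of the codes\<close>

lemma bit_block:
  assumes "1 \<le> j"
  shows "bit (block k b j) a \<longleftrightarrow> own b j a"
proof (cases "j = 1")
  case True
  have "block k b 1 = 2 ^ b * (2 ^ b - 1) + 2 ^ b - 1" by (simp add: block_def num_y_def)
  also have "\<dots> = 2 ^ (2 * b) - 1"
    by (simp add: diff_mult_distrib2 mult_2 power_add)
  also have "\<dots> = mask (2 * b)" by (simp add: mask_eq_exp_minus_1)
  finally show ?thesis using True by (simp add: bit_mask_iff own_def)
next
  case False
  have "block k b j = push_bit (j * b) (mask b)"
    using assms False by (simp add: block_def num_y_def push_bit_eq_mult mask_eq_exp_minus_1 mult.commute)
  then show ?thesis using False assms by (auto simp: bit_push_bit_iff bit_mask_iff own_def)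
qed

text \<open>All ones of \<open>y\<close> are ones of the block, so the block is \<open>y\<close>
  plus the remaining ones, without carries.\<close>

lemma part_le_block:
  assumes "1 \<le> j" "part b j y = y"
  shows "y \<le> block k b j"
proof -
  have y: "bit y a \<Longrightarrow> own b j a" for a using assms(2) bit_part[of b j y a] by simp
  have "and y (xor y (block k b j)) = 0"
    by (rule bit_eqI) (use y assms(1) in \<open>auto simp: bit_and_iff bit_xor_iff bit_block\<close>)
  then have "y + xor y (block k b j) = or y (xor y (block k b j))" by (rule disjunctive_add_eq_or)
  also have "\<dots> = block k b j"
    by (rule bit_eqI) (use y assms(1) in \<open>auto simp: bit_or_iff bit_xor_iff bit_block\<close>)
  finally show ?thesis by linarith
qed

text \<open>Subtracting from \<open>n\<close> ones never borrows, so it flips each of the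
  \<open>n\<close> bits; formally, the result is the exclusive or with
  \<open>mask n\<close>.\<close>

lemma bit_complement:
  assumes "x < 2 ^ n"
  shows "bit (2 ^ n - 1 - x :: nat) a \<longleftrightarrow> a < n \<and> \<not> bit x a"
proof -
  let ?c = "xor (mask n) x"
  have lt: "bit x a \<Longrightarrow> a < n" for a using assms by (meson nat_less_exp_iff not_le)
  have "and x ?c = 0"
    by (rule bit_eqI) (auto simp: bit_and_iff bit_xor_iff bit_mask_iff dest: lt)
  then have "x + ?c = or x ?c" by (rule disjunctive_add_eq_or)
  also have "\<dots> = mask n"
    by (rule bit_eqI) (auto simp: bit_or_iff bit_xor_iff bit_mask_iff dest: lt)
  finally have "2 ^ n - 1 - x = ?c" by (simp add: mask_eq_exp_minus_1)
  then show ?thesis by (auto simp: bit_xor_iff bit_mask_iff dest: lt)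
qed

lemma bit_concat:
  assumes "x < 2 ^ n"
  shows "bit (x + 2 ^ n * y :: nat) a \<longleftrightarrow> (if a < n then bit x a else bit y (a - n))"
proof -
  have "and x (push_bit n y) = 0"
    by (rule bit_eqI) (use assms in \<open>auto simp: bit_and_iff bit_push_bit_iff nat_less_exp_iff\<close>)
  then have "x + 2 ^ n * y = or x (push_bit n y)"
    by (simp add: disjunctive_add_eq_or[symmetric] push_bit_eq_mult mult.commute)
  then show ?thesis using assms by (auto simp: bit_or_iff bit_push_bit_iff nat_less_exp_iff)
qed


lemma code_XOR: "code PrXOR k b j u = u" "junk PrXOR k b u = 2 ^ (k * b) + u"
  by (simp_all add: code_def junk_def lin_def)

lemma code_SUM:
  "code PrSUM k b 0 u = 2 ^ (k * b) + u" "junk PrSUM k b u = u"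
  "j \<noteq> 0 \<Longrightarrow> code PrSUM k b j y = block k b j + of_bool (j = 1) - y"
  by (simp_all add: code_def junk_def lin_def)

lemma code_OV_0:
  assumes "u < 2 ^ (k * b)"
  shows "code PrOV k b 0 u = u + 2 ^ (k * b) * (2 ^ (k * b) - 1 - u)"
    "junk PrOV k b u = (u + 2 ^ (k * b) * (2 ^ (k * b) - 1 - u)) + 2 ^ (k * b) * 2 ^ (k * b)"
proof -
  \<comment> \<open>With \<open>c\<close> for the complement, \<open>2 ^ (k * b)\<close> is
    \<open>Suc (u + c)\<close>, and the truncated subtractions give way to a polynomial identity in
    \<open>u\<close> and \<open>c\<close>.\<close>
  define c where "c = 2 ^ (k * b) - 1 - u"
  have Z: "2 ^ (k * b) = Suc (u + c)" using assms by (simp add: c_def)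
  have "code PrOV k b 0 u = (u + c) * Suc (u + c) - u * (u + c)"
    "junk PrOV k b u = Suc (u + c) * Suc (u + c) + (u + c) * Suc (u + c) - u * (u + c)"
    by (simp_all add: code_def junk_def lin_def Z)
  moreover have "u + c \<le> (u + c) * (u + c)" by (cases "u + c") auto
  ultimately show "code PrOV k b 0 u = u + 2 ^ (k * b) * (2 ^ (k * b) - 1 - u)"
    "junk PrOV k b u = (u + 2 ^ (k * b) * (2 ^ (k * b) - 1 - u)) + 2 ^ (k * b) * 2 ^ (k * b)"
    unfolding Z by (simp_all add: algebra_simps)
qed

lemma code_OV:
  assumes "j \<noteq> 0" "y \<le> block k b j" "block k b j < 2 ^ (k * b)"
  shows "code PrOV k b j y = (2 ^ (k * b) - 1 - y) + 2 ^ (k * b) * ((2 ^ (k * b) - 1 - block k b j + y) + 2 ^ (k * b) * 1)"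
proof -
  define c d where "c = 2 ^ (k * b) - 1 - block k b j" and "d = block k b j - y"
  have Z: "2 ^ (k * b) = Suc (y + d + c)" and m: "block k b j = y + d" using assms by (simp_all add: c_def d_def)
  have "code PrOV k b j y = c * Suc (y + d + c) + (y + d + c) + Suc (y + d + c) * Suc (y + d + c) + y * (y + d + c)"
    using assms(1) by (simp add: code_def lin_def Z m)
  then show ?thesis unfolding Z m by (simp add: algebra_simps)
qed

lemma bit_code_OV_0:
  assumes "u < 2 ^ (k * b)" "a < k * b"
  shows "bit (code PrOV k b 0 u) a \<longleftrightarrow> bit u a" "bit (code PrOV k b 0 u) (k * b + a) \<longleftrightarrow> \<not> bit u a"
    "\<not> bit (code PrOV k b 0 u) (k * b + k * b)"
  using assms by (simp_all only: code_OV_0 bit_concat bit_complement) simp_all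

text \<open>A zero in the lower half reports a one of \<open>y\<close>; a zero in the upper half
  reports a zero of \<open>y\<close> at a position owned by \<open>j\<close>. The ones outside the
  own positions prevent a coordinate that is not the owner from settling a position of the upper
  half.\<close>

lemma bit_code_OV:
  assumes "2 \<le> k" "j \<in> {1..<k}" "part b j y = y" "a < k * b"
  shows "bit (code PrOV k b j y) a \<longleftrightarrow> \<not> bit y a"
    "bit (code PrOV k b j y) (k * b + a) \<longleftrightarrow> \<not> own b j a \<or> bit y a"
proof -
  let ?F = "2 ^ (k * b) - 1 :: nat"
  have j: "j \<noteq> 0" "1 \<le> j" "j < k" using assms by auto
  have bl: "y \<le> block k b j" "block k b j < 2 ^ (k * b)"
    using part_le_block assms block_lt j by auto
  have y: "bit y a \<Longrightarrow> own b j a" for a using assms(3) bit_part[of b j y a] by simp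
  have bc: "bit (?F - block k b j) c \<longleftrightarrow> c < k * b \<and> \<not> own b j c" for c
    by (simp only: bit_complement[OF bl(2)] bit_block[OF j(2)])
  have "and (?F - block k b j) y = 0"
    by (rule bit_eqI) (use y in \<open>auto simp only: bit_and_iff bc bit_0_eq bot_apply bot_bool_def\<close>)
  then have or: "?F - block k b j + y = or (?F - block k b j) y" by (rule disjunctive_add_eq_or)
  have b2: "bit (?F - block k b j + y) c \<longleftrightarrow> (c < k * b \<and> \<not> own b j c) \<or> bit y c" for c
    unfolding or bit_or_iff bc ..
  have small: "?F - y < 2 ^ (k * b)" "?F - block k b j + y < 2 ^ (k * b)" using bl by linarith+
  have y2: "y < 2 ^ (k * b)" using bl by linarith
  show "bit (code PrOV k b j y) a \<longleftrightarrow> \<not> bit y a"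
    using assms(4) by (simp only: code_OV[OF j(1) bl] bit_concat[OF small(1)] bit_complement[OF y2]) simp
  show "bit (code PrOV k b j y) (k * b + a) \<longleftrightarrow> \<not> own b j a \<or> bit y a"
    using assms(4) by (simp only: code_OV[OF j(1) bl] bit_concat[OF small(1)] bit_concat[OF small(2)] b2) simp
qed

lemma bit_flag_OV:
  assumes "2 \<le> k" "j \<in> {1..<k}" "part b j y = y"
  shows "bit (code PrOV k b j y) (k * b + k * b)"
proof -
  have j: "j \<noteq> 0" "1 \<le> j" "j < k" using assms by auto
  have bl: "y \<le> block k b j" "block k b j < 2 ^ (k * b)"
    using part_le_block assms block_lt j by auto
  have small: "2 ^ (k * b) - 1 - y < (2::nat) ^ (k * b)" "2 ^ (k * b) - 1 - block k b j + y < 2 ^ (k * b)" using bl by linarith+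
  show ?thesis by (simp only: code_OV[OF j(1) bl] bit_concat[OF small(1)] bit_concat[OF small(2)]) (simp add: bit_0)
qed

text \<open>At most the summand \<open>i\<close> has the bit \<open>a\<close>. The index
  \<open>i\<close> may lie outside the list: for \<open>js = [1..<k]\<close>, the choice
  \<open>i = 0\<close> expresses that no summand has the bit.\<close>

lemma bit_fold_xor:
  assumes "distinct js" "\<And>j. j \<in> set js \<Longrightarrow> bit (y j) a \<Longrightarrow> j = i"
  shows "bit (fold xor (map y js) z) a \<longleftrightarrow> bit (z::nat) a \<noteq> (i \<in> set js \<and> bit (y i) a)"
  using assms by (induction js arbitrary: z) (auto simp: bit_xor_iff)

text \<open>A telescoping sum: for \<open>j \<ge> 2\<close> the block is
  \<open>2 ^ (Suc j * b) - 2 ^ (j * b)\<close>, and the extra unit turns block \<open>1\<close> into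
  \<open>2 ^ (2 * b)\<close>.\<close>

lemma sum_block:
  assumes "2 \<le> m"
  shows "(\<Sum>j\<in>{1..<m}. block k b j + of_bool (j = 1)) = 2 ^ (m * b)"
  using assms
proof (induction m rule: nat_induct_at_least)
  case base
  have "{1..<2} = {1::nat}" by auto
  then show ?case by (simp add: block_def num_y_def diff_mult_distrib2 power_add mult_2)
next
  case (Suc m)
  have "block k b m + of_bool (m = 1) = 2 ^ (m * b) * 2 ^ b - 2 ^ (m * b)"
    using Suc(1) by (simp add: block_def num_y_def diff_mult_distrib2)
  moreover have "(2::nat) ^ (m * b) \<le> 2 ^ (m * b) * 2 ^ b" by simp
  ultimately show ?case using Suc by (simp add: power_add mult.commute)
qed

lemma block_plus_ge:
  assumes "j \<in> {1..<k}" "part b j y = y"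
  shows "y \<le> block k b j + of_bool (j = 1)"
  using part_le_block[of j b y k] assms by simp

lemma sum_code_SUM:
  assumes "2 \<le> k" "\<And>j. j \<in> {1..<k} \<Longrightarrow> part b j (y j) = y j"
  shows "(\<Sum>j\<in>{1..<k}. code PrSUM k b j (y j)) + (\<Sum>j\<in>{1..<k}. y j) = 2 ^ (k * b)"
proof -
  have "(\<Sum>j\<in>{1..<k}. code PrSUM k b j (y j)) + (\<Sum>j\<in>{1..<k}. y j) =
    (\<Sum>j\<in>{1..<k}. block k b j + of_bool (j = 1))"
    unfolding sum.distrib[symmetric]
    using block_plus_ge[OF _ assms(2)] by (intro sum.cong) (simp_all add: code_SUM)
  then show ?thesis using sum_block[OF assms(1)] by simp
qed

lemma sum_parts_less:
  assumes "2 \<le> k" "\<And>j. j \<in> {1..<k} \<Longrightarrow> part b j (y j) = y j"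
  shows "(\<Sum>j\<in>{1..<k}. y j) < 2 ^ (k * b)"
  unfolding nat_less_exp_iff
proof (intro allI impI)
  fix a assume "k * b \<le> a"
  then have "\<not> bit (y j) a" if "j \<in> {1..<k}" for j
    using assms(2)[OF that] bit_part[of b j "y j" a] own_less[of b j a k] assms(1) that by auto
  then show "\<not> bit (\<Sum>j\<in>{1..<k}. y j) a" using bit_sum_parts[OF assms, of k a] by simp
qed

text \<open>Without this bound \<open>bits_of\<close> would cut codes off, and distinct codes could
  become the same word. For \<open>OV\<close> both halves are digits in radix
  \<open>2 ^ (k * b)\<close>, and the flag doubles the range.\<close>

lemma code_less:
  assumes "2 \<le> k"
  shows "u < 2 ^ (k * b) \<Longrightarrow> code prob k b 0 u < 2 ^ width prob k b"
    "x < 2 ^ b \<Longrightarrow> junk prob k b x < 2 ^ width prob k b"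
    "j \<in> {1..<k} \<Longrightarrow> part b j y = y \<Longrightarrow> code prob k b j y < 2 ^ width prob k b"
proof -
  let ?Z = "2 ^ (k * b) :: nat"
  have E: "(2::nat) ^ b \<le> ?Z" using pow_le[of 1 k b] assms by simp
  have m: "u + ?Z * v < ?Z * ?Z" if "u < ?Z" "v < ?Z" for u v
  proof -
    have "u + ?Z * v < ?Z * Suc v" using that(1) by simp
    also have "\<dots> \<le> ?Z * ?Z" using that(2) by (intro mult_left_mono) auto
    finally show ?thesis .
  qed
  have w: "2 ^ width PrOV k b = 2 * (?Z * ?Z)" by (simp add: power_add)
  { assume u: "u < ?Z"
    have "u + ?Z * (?Z - 1 - u) < ?Z * ?Z" by (rule m) (use u in auto)
    then show "code prob k b 0 u < 2 ^ width prob k b" using u w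
      by (cases prob) (auto simp: code_XOR code_SUM code_OV_0 simp del: width.simps(1) One_nat_def) }
  { assume "x < 2 ^ b"
    then have x: "x < ?Z" using E by linarith
    have "x + ?Z * (?Z - 1 - x) < ?Z * ?Z" by (rule m) (use x in auto)
    then show "junk prob k b x < 2 ^ width prob k b" using x w
      by (cases prob) (auto simp: code_XOR code_SUM code_OV_0 simp del: width.simps(1) One_nat_def) }
  { assume j: "j \<in> {1..<k}" and y: "part b j y = y"
    then have j': "j \<noteq> 0" "1 \<le> j" "j < k" by auto
    have bl: "y \<le> block k b j" "block k b j < ?Z"
      using part_le_block y block_lt j' assms by auto
    have 1: "(?Z - 1 - y) + ?Z * (?Z - 1 - block k b j + y) < ?Z * ?Z" by (rule m) (use bl in auto)
    have "code PrOV k b j y = ((?Z - 1 - y) + ?Z * (?Z - 1 - block k b j + y)) + ?Z * ?Z"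
      unfolding code_OV[OF j'(1) bl] by (simp only: distrib_left mult_1_right add.assoc)
    then have 2: "code PrOV k b j y < 2 ^ width PrOV k b" using 1 w by linarith
    have "block k b j + of_bool (j = 1) - y \<le> ?Z" using bl by auto
    also have "\<dots> < 2 ^ Suc (k * b)" by simp
    finally show "code prob k b j y < 2 ^ width prob k b" using 2 bl j'
      by (cases prob) (simp_all add: code_XOR code_SUM) }
qed

text \<open>Let \<open>i\<close> own position \<open>a\<close>. For \<open>OV\<close>, position
  \<open>a\<close> of the codes excludes that \<open>u\<close> has a one where \<open>y i\<close>
  has a zero, and position \<open>k * b + a\<close> excludes the reverse. For \<open>XOR\<close>,
  the bits of \<open>u\<close> and \<open>y i\<close> have to cancel. For \<open>SUM\<close>, the
  total is \<open>2 * Z + u - Y\<close>, where \<open>u\<close> and the sum \<open>Y\<close> of the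
  parts are below \<open>Z = 2 ^ (k * b)\<close>, and it is divisible by \<open>2 * Z\<close> only
  if \<open>u = Y\<close>.\<close>

theorem prob_fun_code:
  assumes k: "2 \<le> k" and u: "u < 2 ^ (k * b)" and y: "\<And>j. j \<in> {1..<k} \<Longrightarrow> part b j (y j) = y j"
  shows "prob_fun prob (width prob k b)
      (map (bits_of (width prob k b)) (code prob k b 0 u # map (\<lambda>j. code prob k b j (y j)) [1..<k])) \<longleftrightarrow>
    (\<forall>j\<in>{1..<k}. y j = part b j u)"
proof (cases prob)
  case PrOV
  have own: "bit (y j) a \<Longrightarrow> own b j a" if "j \<in> {1..<k}" for j a
    using y[OF that] bit_part[of b j "y j" a] by simp
  let ?N = "k * b"
  have "prob_fun prob (width prob k b)
      (map (bits_of (width prob k b)) (code prob k b 0 u # map (\<lambda>j. code prob k b j (y j)) [1..<k])) \<longleftrightarrow>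
    (\<forall>a<Suc (?N + ?N). \<not> bit (code PrOV k b 0 u) a \<or> (\<exists>j\<in>{1..<k}. \<not> bit (code PrOV k b j (y j)) a))"
    using f_OV_bits_of[of "width PrOV k b" "code PrOV k b 0 u # map (\<lambda>j. code PrOV k b j (y j)) [1..<k]"]
    unfolding PrOV prob_fun.simps by auto
  \<comment> \<open>Positions are grouped in pairs. The single one left over, the flag, imposes no
    condition, because the code of \<open>u\<close> has a zero there.\<close>
  also have "\<dots> \<longleftrightarrow> (\<forall>a<?N. (\<not> bit (code PrOV k b 0 u) a \<or> (\<exists>j\<in>{1..<k}. \<not> bit (code PrOV k b j (y j)) a)) \<and>
     (\<not> bit (code PrOV k b 0 u) (?N + a) \<or> (\<exists>j\<in>{1..<k}. \<not> bit (code PrOV k b j (y j)) (?N + a))))"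
    (is "(\<forall>a<_. ?P a) \<longleftrightarrow> (\<forall>a<_. ?P a \<and> ?P (?N + a))")
  proof (intro iffI allI impI)
    fix a assume *: "\<forall>a<?N. ?P a \<and> ?P (?N + a)" and a: "a < Suc (?N + ?N)"
    consider "a < ?N" | "?N \<le> a" "a - ?N < ?N" | "a = ?N + ?N" using a by linarith
    then show "?P a"
    proof cases
      case 2
      then show ?thesis using *[rule_format, of "a - ?N"] by simp
    next
      case 3
      have "\<not> bit (code PrOV k b 0 u) (?N + ?N)"
        by (simp only: code_OV_0[OF u] bit_concat[OF u] bit_complement[OF u]) simp
      then show ?thesis using 3 by simp
    qed (use * in blast)
  qed auto
  also have "\<dots> \<longleftrightarrow> (\<forall>a<?N. \<forall>j\<in>{1..<k}. own b j a \<longrightarrow> bit (y j) a = bit u a)"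
  proof (intro all_cong)
    fix a assume a: "a < ?N"
    obtain i where i: "i \<in> {1..<k}" "own b i a" using own_exists a k by blast
    have "j = i" if "j \<in> {1..<k}" "own b j a" for j using own_unique[OF that(2) i(2)] that i by auto
    then have own_i: "own b j a \<longleftrightarrow> j = i" if "j \<in> {1..<k}" for j using i that by blast
    have "(\<exists>j\<in>{1..<k}. \<not> bit (code PrOV k b j (y j)) a) \<longleftrightarrow> (\<exists>j\<in>{1..<k}. bit (y j) a)"
      using bit_code_OV(1)[OF k _ y a] by (intro bex_cong refl) simp
    also have "\<dots> \<longleftrightarrow> bit (y i) a"
    proof
      assume "\<exists>j\<in>{1..<k}. bit (y j) a"
      then obtain j where j: "j \<in> {1..<k}" "bit (y j) a" by blast
      then have "j = i" using own_i[OF j(1)] own[OF j] by simp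
      then show "bit (y i) a" using j by simp
    qed (use i in blast)
    finally have 1: "(\<exists>j\<in>{1..<k}. \<not> bit (code PrOV k b j (y j)) a) \<longleftrightarrow> bit (y i) a" .
    have "(\<exists>j\<in>{1..<k}. \<not> bit (code PrOV k b j (y j)) (?N + a)) \<longleftrightarrow> (\<exists>j\<in>{1..<k}. own b j a \<and> \<not> bit (y j) a)"
      using bit_code_OV(2)[OF k _ y a] by (intro bex_cong refl) simp
    also have "\<dots> \<longleftrightarrow> \<not> bit (y i) a" using own_i i by auto
    finally have 2: "(\<exists>j\<in>{1..<k}. \<not> bit (code PrOV k b j (y j)) (?N + a)) \<longleftrightarrow> \<not> bit (y i) a" .
    have 3: "(\<forall>j\<in>{1..<k}. own b j a \<longrightarrow> bit (y j) a = bit u a) \<longleftrightarrow> bit (y i) a = bit u a"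
      using own_i i by auto
    show "(\<not> bit (code PrOV k b 0 u) a \<or> (\<exists>j\<in>{1..<k}. \<not> bit (code PrOV k b j (y j)) a)) \<and>
     (\<not> bit (code PrOV k b 0 u) (?N + a) \<or> (\<exists>j\<in>{1..<k}. \<not> bit (code PrOV k b j (y j)) (?N + a))) \<longleftrightarrow>
      (\<forall>j\<in>{1..<k}. own b j a \<longrightarrow> bit (y j) a = bit u a)"
      unfolding 1 2 3 bit_code_OV_0(1,2)[OF u a] by blast
  qed
  also have "\<dots> \<longleftrightarrow> (\<forall>j\<in>{1..<k}. y j = part b j u)" by (rule all_part_iff[OF k y, symmetric])
  finally show ?thesis .
next
  case PrXOR
  have own: "bit (y j) a \<Longrightarrow> own b j a" if "j \<in> {1..<k}" for j a
    using y[OF that] bit_part[of b j "y j" a] by simp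
  let ?N = "k * b"
  let ?x = "fold xor (map y [1..<k]) u"
  have top: "\<not> bit ?x ?N"
    using bit_fold_xor[of "[1..<k]" y ?N 0 u] u own own_less[of b _ ?N k] k by (auto simp: nat_less_exp_iff)
  have "prob_fun prob (width prob k b)
      (map (bits_of (width prob k b)) (code prob k b 0 u # map (\<lambda>j. code prob k b j (y j)) [1..<k])) \<longleftrightarrow>
    (\<forall>a<Suc ?N. \<not> bit ?x a)"
    using f_XOR_bits_of[of "width PrXOR k b" "u # map y [1..<k]"]
    unfolding PrXOR prob_fun.simps by (simp add: code_XOR)
  also have "\<dots> \<longleftrightarrow> (\<forall>a<?N. \<not> bit ?x a)" using top less_Suc_eq by auto
  also have "\<dots> \<longleftrightarrow> (\<forall>a<?N. \<forall>j\<in>{1..<k}. own b j a \<longrightarrow> bit (y j) a = bit u a)"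
  proof (intro all_cong)
    fix a assume a: "a < ?N"
    obtain i where i: "i \<in> {1..<k}" "own b i a" using own_exists a k by blast
    have un: "j = i" if "j \<in> {1..<k}" "own b j a" for j using own_unique[OF that(2) i(2)] that i by auto
    have "bit ?x a \<longleftrightarrow> bit u a \<noteq> (i \<in> set [1..<k] \<and> bit (y i) a)"
    proof (rule bit_fold_xor)
      fix j assume "j \<in> set [1..<k]" "bit (y j) a"
      then show "j = i" by (intro un own) simp_all
    qed simp
    moreover have "own b j a \<longleftrightarrow> j = i" if "j \<in> {1..<k}" for j using i un that by blast
    ultimately show "\<not> bit ?x a \<longleftrightarrow> (\<forall>j\<in>{1..<k}. own b j a \<longrightarrow> bit (y j) a = bit u a)"
      using i by auto
  qed
  also have "\<dots> \<longleftrightarrow> (\<forall>j\<in>{1..<k}. y j = part b j u)" by (rule all_part_iff[OF k y, symmetric])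
  finally show ?thesis .
next
  case PrSUM
  let ?Z = "2 ^ (k * b) :: nat" and ?Y = "\<Sum>j\<in>{1..<k}. y j"
  have lt: "x < 2 ^ width PrSUM k b" if "x \<in> set (code PrSUM k b 0 u # map (\<lambda>j. code PrSUM k b j (y j)) [1..<k])" for x
    using that code_less(1)[OF k u, of PrSUM] code_less(3)[OF k _ y, of _ PrSUM] by auto
  have "sum_list (code PrSUM k b 0 u # map (\<lambda>j. code PrSUM k b j (y j)) [1..<k]) =
      ?Z + u + (\<Sum>j\<in>{1..<k}. code PrSUM k b j (y j))"
    by (simp add: code_SUM interv_sum_list_conv_sum_set_nat)
  also have "\<dots> = 2 * ?Z + u - ?Y" using sum_code_SUM[OF k y] by linarith
  finally have s: "sum_list (code PrSUM k b 0 u # map (\<lambda>j. code PrSUM k b j (y j)) [1..<k]) = 2 * ?Z + u - ?Y" .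
  have Y: "?Y < ?Z" by (rule sum_parts_less[OF k y])
  have "(2 * ?Z + u - ?Y) mod (2 * ?Z) = 0 \<longleftrightarrow> u = ?Y"
  proof
    assume *: "(2 * ?Z + u - ?Y) mod (2 * ?Z) = 0"
    show "u = ?Y"
    proof (rule ccontr)
      assume "u \<noteq> ?Y"
      then consider "u < ?Y" | "?Y < u" by linarith
      then show False
      proof cases
        case 1
        then have "2 * ?Z + u - ?Y < 2 * ?Z" "2 * ?Z + u - ?Y > 0" using Y by linarith+
        then show False using * by simp
      next
        case 2
        have "2 * ?Z + u - ?Y = (u - ?Y) + 2 * ?Z" using 2 by linarith
        moreover have "u - ?Y < 2 * ?Z" "u - ?Y > 0" using 2 u by linarith+
        ultimately show False using * by (simp only: mod_add_self2) simp
      qed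
    qed
  qed simp
  moreover have "2 * ?Z = 2 ^ width PrSUM k b" by simp
  ultimately show ?thesis using f_SUM_bits_of[OF lt] s sum_parts_eq_iff[OF k u y]
    unfolding PrSUM prob_fun.simps by metis
qed

text \<open>The flag is one in all \<open>k\<close> words (\<open>OV\<close>), the top bit is one in
  the junk word only (\<open>XOR\<close>), or the total \<open>x + (Z - Y)\<close> lies strictly
  between \<open>0\<close> and the modulus \<open>2 * Z\<close> (\<open>SUM\<close>).\<close>

theorem prob_fun_junk:
  assumes k: "2 \<le> k" and x: "x < 2 ^ b" and y: "\<And>j. j \<in> {1..<k} \<Longrightarrow> part b j (y j) = y j"
  shows "\<not> prob_fun prob (width prob k b)
      (map (bits_of (width prob k b)) (junk prob k b x # map (\<lambda>j. code prob k b j (y j)) [1..<k]))"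
proof (cases prob)
  case PrOV
  let ?N = "k * b" and ?Z = "2 ^ (k * b) :: nat"
  have "(2::nat) ^ b \<le> ?Z" using pow_le[of 1 k b] k by simp
  then have xZ: "x < ?Z" using x by linarith
  have "junk PrOV k b x = x + ?Z * ((?Z - 1 - x) + ?Z * 1)"
    unfolding code_OV_0(2)[OF xZ] by (simp only: distrib_left mult_1_right add.assoc)
  moreover have "?Z - 1 - x < ?Z" using xZ by linarith
  ultimately have "bit (junk PrOV k b x) (?N + ?N)"
    using xZ by (simp only: bit_concat) (simp add: bit_0)
  moreover have "bit (code PrOV k b j (y j)) (?N + ?N)" if "j \<in> {1..<k}" for j
    by (rule bit_flag_OV[OF k that y[OF that]])
  ultimately show ?thesis unfolding PrOV prob_fun.simps f_OV_bits_of by auto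
next
  case PrXOR
  let ?N = "k * b" and ?Z = "2 ^ (k * b) :: nat"
  have own: "bit (y j) a \<Longrightarrow> own b j a" if "j \<in> {1..<k}" for j a
    using y[OF that] bit_part[of b j "y j" a] by simp
  have "(2::nat) ^ b \<le> ?Z" using pow_le[of 1 k b] k by simp
  then have xZ: "x < ?Z" using x by linarith
  have "bit (x + ?Z * 1) ?N" unfolding bit_concat[OF xZ] by (simp add: bit_0)
  then have "bit (fold xor (map y [1..<k]) (?Z + x)) ?N"
    using bit_fold_xor[of "[1..<k]" y ?N 0 "?Z + x"] own own_less[of b _ ?N k] k by (auto simp: add.commute)
  then show ?thesis
    using f_XOR_bits_of[of "width PrXOR k b" "(?Z + x) # map y [1..<k]"]
    unfolding PrXOR prob_fun.simps by (auto simp: code_XOR)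
next
  case PrSUM
  let ?Z = "2 ^ (k * b) :: nat" and ?Y = "\<Sum>j\<in>{1..<k}. y j"
  have "(2::nat) ^ b \<le> ?Z" using pow_le[of 1 k b] k by simp
  then have xZ: "x < ?Z" using x by linarith
  have lt: "c < 2 ^ width PrSUM k b" if "c \<in> set (junk PrSUM k b x # map (\<lambda>j. code PrSUM k b j (y j)) [1..<k])" for c
    using that code_less(2)[OF k x, of PrSUM] code_less(3)[OF k _ y, of _ PrSUM] by auto
  have "sum_list (junk PrSUM k b x # map (\<lambda>j. code PrSUM k b j (y j)) [1..<k]) =
      x + (\<Sum>j\<in>{1..<k}. code PrSUM k b j (y j))"
    by (simp add: code_SUM interv_sum_list_conv_sum_set_nat)
  also have "\<dots> = x + (?Z - ?Y)" using sum_code_SUM[OF k y] by linarith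
  finally have s: "sum_list (junk PrSUM k b x # map (\<lambda>j. code PrSUM k b j (y j)) [1..<k]) = x + (?Z - ?Y)" .
  have "?Y < ?Z" by (rule sum_parts_less[OF k y])
  then have "x + (?Z - ?Y) > 0" "x + (?Z - ?Y) < 2 ^ width PrSUM k b" using xZ by simp_all
  then have "(x + (?Z - ?Y)) mod 2 ^ width PrSUM k b \<noteq> 0" by (simp only: mod_less)
  then show ?thesis using f_SUM_bits_of[OF lt] s unfolding PrSUM prob_fun.simps by metis
qed

section \<open>Images of instances\<close>

definition dig :: "nat \<Rightarrow> nat \<Rightarrow> nat \<Rightarrow> nat" where
  "dig b j u = take_bit b (drop_bit (j * b) u)"

lemma bit_dig: "bit (dig b j u) a \<longleftrightarrow> a < b \<and> bit u (j * b + a)"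
  by (simp add: dig_def bit_take_bit_iff bit_drop_bit_eq)

lemma dig_less: "dig b j u < 2 ^ b"
  by (simp add: dig_def)

lemma dig_part: "1 \<le> j \<Longrightarrow> dig b j (part b j u) = dig b j u"
  by (rule bit_eqI) (auto simp: bit_dig bit_part own_def)

lemma dig_eq: "dig b j u = u div 2 ^ (j * b) mod 2 ^ b"
  by (simp add: dig_def take_bit_eq_mod drop_bit_eq_div)

text \<open>The arguments on which coordinate \<open>j\<close> uses its code: whole tuples in the
  first set, parts in the others.\<close>

definition index_set :: "nat \<Rightarrow> nat \<Rightarrow> nat \<Rightarrow> nat set" where
  "index_set k b j = (if j = 0 then {..<2 ^ (k * b)} else {y. part b j y = y})"

text \<open>Translates the arithmetic progression that the program runs through into digits:
  division by \<open>2 ^ b\<close> separates the given digit \<open>x\<close> from the free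
  ones.\<close>

lemma index_image:
  assumes "2 \<le> k" "x < 2 ^ b"
  shows "(\<lambda>y. x * 2 ^ (j * b) + y * mul_y b j) ` {..<num_y k b j} = {y \<in> index_set k b j. dig b j y = x}"
proof -
  consider "j = 0" | "j = 1" | "j \<ge> 2" by linarith
  then show ?thesis
  proof cases
    case 1
    have Z: "2 ^ ((k - 1) * b) * 2 ^ b = (2::nat) ^ (k * b)"
      using assms by (cases k) (simp_all add: power_add mult.commute)
    show ?thesis
    proof (intro set_eqI iffI)
      fix y assume "y \<in> (\<lambda>y. x * 2 ^ (j * b) + y * mul_y b j) ` {..<num_y k b j}"
      then obtain i where i: "i < 2 ^ ((k - 1) * b)" "y = x + i * 2 ^ b"
        using 1 by (auto simp: num_y_def mul_y_def)
      have "y < Suc i * 2 ^ b" using i assms by simp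
      also have "\<dots> \<le> 2 ^ ((k - 1) * b) * 2 ^ b" using i by (intro mult_right_mono) auto
      finally show "y \<in> {y \<in> index_set k b j. dig b j y = x}"
        using 1 i assms Z by (simp add: index_set_def dig_eq)
    next
      fix y assume "y \<in> {y \<in> index_set k b j. dig b j y = x}"
      then have y: "y < 2 ^ (k * b)" "y mod 2 ^ b = x" using 1 by (simp_all add: index_set_def dig_eq)
      have "y div 2 ^ b < 2 ^ ((k - 1) * b)"
        using y(1) Z by (intro less_mult_imp_div_less) simp
      moreover have "y = x + y div 2 ^ b * 2 ^ b" using y(2) div_mult_mod_eq[of y "2 ^ b"] by linarith
      ultimately show "y \<in> (\<lambda>y. x * 2 ^ (j * b) + y * mul_y b j) ` {..<num_y k b j}"
        using 1 by (intro image_eqI[of _ _ "y div 2 ^ b"]) (auto simp: num_y_def mul_y_def)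
    qed
  next
    case 2
    have Z: "2 ^ b * 2 ^ b = (2::nat) ^ (2 * b)" by (simp add: mult_2 power_add)
    have fix_iff: "part b 1 y = y \<longleftrightarrow> y < 2 ^ (2 * b)" for y
      by (simp add: part_def take_bit_nat_eq_self_iff)
    show ?thesis
    proof (intro set_eqI iffI)
      fix y assume "y \<in> (\<lambda>y. x * 2 ^ (j * b) + y * mul_y b j) ` {..<num_y k b j}"
      then obtain i where i: "i < 2 ^ b" "y = x * 2 ^ b + i" using 2 by (auto simp: num_y_def mul_y_def)
      have "y < Suc x * 2 ^ b" using i by simp
      also have "\<dots> \<le> 2 ^ b * 2 ^ b" using assms by (intro mult_right_mono) auto
      finally show "y \<in> {y \<in> index_set k b j. dig b j y = x}"
        using 2 i assms Z fix_iff by (simp add: index_set_def dig_eq)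
    next
      fix y assume "y \<in> {y \<in> index_set k b j. dig b j y = x}"
      then have y: "y < 2 ^ (2 * b)" "y div 2 ^ b mod 2 ^ b = x" using 2 fix_iff by (simp_all add: index_set_def dig_eq)
      have "y div 2 ^ b < 2 ^ b" using y(1) Z by (intro less_mult_imp_div_less) simp
      then have "y = x * 2 ^ b + y mod 2 ^ b" using y(2) div_mult_mod_eq[of y "2 ^ b"] by simp
      then show "y \<in> (\<lambda>y. x * 2 ^ (j * b) + y * mul_y b j) ` {..<num_y k b j}"
        using 2 by (intro image_eqI[of _ _ "y mod 2 ^ b"]) (auto simp: num_y_def mul_y_def)
    qed
  next
    case 3
    have fix_iff: "part b j y = y \<longleftrightarrow> y = dig b j y * 2 ^ (j * b)" for y
      using 3 by (auto simp: part_def dig_def push_bit_eq_mult)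
    have dx: "dig b j (x * 2 ^ (j * b)) = x" using assms(2) by (simp add: dig_eq)
    have "(\<lambda>y. x * 2 ^ (j * b) + y * mul_y b j) ` {..<num_y k b j} = {x * 2 ^ (j * b)}"
      using 3 by (simp add: num_y_def mul_y_def lessThan_Suc)
    moreover have "y \<in> index_set k b j \<and> dig b j y = x \<longleftrightarrow> y = x * 2 ^ (j * b)" for y
    proof
      assume "y \<in> index_set k b j \<and> dig b j y = x"
      then have p: "part b j y = y" and d: "dig b j y = x" using 3 by (simp_all add: index_set_def)
      have "y = dig b j y * 2 ^ (j * b)" by (rule iffD1[OF fix_iff p])
      then show "y = x * 2 ^ (j * b)" unfolding d .
    next
      assume "y = x * 2 ^ (j * b)"
      then show "y \<in> index_set k b j \<and> dig b j y = x"
        using 3 fix_iff[of y] dx by (simp add: index_set_def)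
    qed
    ultimately show ?thesis by simp
  qed
qed

lemma index_inj: "inj (\<lambda>y. x * 2 ^ (j * b) + y * mul_y b j)"
  by (rule injI) (simp add: mul_y_def split: if_splits)

lemma part_zero: "part b j 0 = 0"
  by (rule bit_eqI) (simp add: bit_part)

lemma part_part: "part b j (part b j u) = part b j u"
  by (rule bit_eqI) (auto simp: bit_part)

text \<open>No formula is inverted. By \<open>prob_fun_code\<close> a code determines which codes of
  the other sets it is compatible with, and these determine its argument.\<close>

lemma code_inj:
  assumes k: "2 \<le> k" and j: "j < k"
  shows "inj_on (code prob k b j) (index_set k b j)"
proof (rule inj_onI)
  fix u v assume u: "u \<in> index_set k b j" and v: "v \<in> index_set k b j" and eq: "code prob k b j u = code prob k b j v"
  show "u = v"
  proof (cases "j = 0")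
    case True
    then have lt: "u < 2 ^ (k * b)" "v < 2 ^ (k * b)" using u v by (simp_all add: index_set_def)
    have "\<forall>i\<in>{1..<k}. part b i u = part b i v"
      using prob_fun_code[OF k lt(1), of "\<lambda>i. part b i u" prob] prob_fun_code[OF k lt(2), of "\<lambda>i. part b i u" prob]
        eq True by (simp add: part_part)
    moreover have "u = (\<Sum>i\<in>{1..<k}. part b i u)" "v = (\<Sum>i\<in>{1..<k}. part b i v)"
      using sum_parts_eq_iff[OF k lt(1), of "\<lambda>i. part b i u"] sum_parts_eq_iff[OF k lt(2), of "\<lambda>i. part b i v"]
      by (simp_all add: part_part)
    ultimately show ?thesis by (metis (no_types, lifting) sum.cong)
  next
    case False
    then have j': "j \<in> {1..<k}" using j by simp
    have fx: "part b j u = u" "part b j v = v" using u v False by (simp_all add: index_set_def)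
    \<comment> \<open>All other coordinates get the part \<open>0\<close>. The sum of these parts is
      a number compatible with the code of \<open>u\<close>, hence also with the equal code of
      \<open>v\<close>.\<close>
    define y where "y = (\<lambda>w i. if i = j then w else (0::nat))"
    have p: "part b i (y u i) = y u i" "part b i (y v i) = y v i" for i
      using fx part_zero by (simp_all add: y_def)
    have lt: "(\<Sum>i\<in>{1..<k}. y u i) < 2 ^ (k * b)" by (rule sum_parts_less[OF k p(1)])
    have 1: "\<forall>i\<in>{1..<k}. y u i = part b i (\<Sum>i\<in>{1..<k}. y u i)"
      using sum_parts_eq_iff[OF k lt p(1)] by simp
    have "(\<lambda>i. code prob k b i (y u i)) = (\<lambda>i. code prob k b i (y v i))"
      using eq by (auto simp: y_def)
    then have "\<forall>i\<in>{1..<k}. y v i = part b i (\<Sum>i\<in>{1..<k}. y u i)"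
      using prob_fun_code[OF k lt p(1), of prob] prob_fun_code[OF k lt p(2), of prob] 1 by simp
    then have "y v j = y u j" using 1 j' by simp
    then show ?thesis by (simp add: y_def)
  qed
qed

text \<open>A genuine code is compatible with the parts of its own \<open>u\<close>, junk with no
  parts at all.\<close>

lemma junk_neq_code:
  assumes k: "2 \<le> k" and "x < 2 ^ b" "u < 2 ^ (k * b)"
  shows "junk prob k b x \<noteq> code prob k b 0 u"
  using prob_fun_code[OF k assms(3), of "\<lambda>i. part b i u" prob] prob_fun_junk[OF k assms(2), of "\<lambda>i. part b i u" prob]
  by (auto simp: part_part)

lemma junk_inj:
  assumes k: "2 \<le> k" and "x < 2 ^ b" "x' < 2 ^ b" "junk prob k b x = junk prob k b x'"
  shows "x = x'"
proof (cases prob)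
  case PrOV
  let ?Z = "2 ^ (k * b) :: nat"
  have "(2::nat) ^ b \<le> ?Z" using pow_le[of 1 k b] k by simp
  then have lt: "x < ?Z" "x' < ?Z" using assms by linarith+
  \<comment> \<open>The lower half of a junk code is the word itself.\<close>
  have junk: "junk PrOV k b y mod ?Z = y" if "y < ?Z" for y
  proof -
    have "junk PrOV k b y = y + ?Z * ((?Z - 1 - y) + ?Z)"
      unfolding code_OV_0(2)[OF that] by (simp only: distrib_left add.assoc)
    then show ?thesis using that by (simp only: mod_mult_self2 mod_less)
  qed
  have "x = junk PrOV k b x mod ?Z" by (rule junk[OF lt(1), symmetric])
  also have "\<dots> = junk PrOV k b x' mod ?Z" using assms(4) unfolding PrOV by (rule arg_cong)
  also have "\<dots> = x'" by (rule junk[OF lt(2)])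
  finally show ?thesis .
qed (use assms in \<open>simp_all add: code_XOR code_SUM\<close>)

section \<open>Images of single words\<close>

lemma set_word_image:
  assumes "2 \<le> k" "x < 2 ^ b"
  shows "set (word_image prob k b T j x) =
    code prob k b j ` {u \<in> index_set k b j. dig b j u = x \<and> (T u \<or> j \<noteq> 0)} \<union> (if j = 0 then {junk prob k b x} else {})"
proof -
  have "set (filter (\<lambda>u. T u \<or> j \<noteq> 0) (map (\<lambda>y. x * 2 ^ (j * b) + y * mul_y b j) [0..<num_y k b j])) =
      {u \<in> (\<lambda>y. x * 2 ^ (j * b) + y * mul_y b j) ` {..<num_y k b j}. T u \<or> j \<noteq> 0}"
    by (simp only: set_filter set_map set_upt atLeast0LessThan)
  also have "\<dots> = {u \<in> index_set k b j. dig b j u = x \<and> (T u \<or> j \<noteq> 0)}"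
    unfolding index_image[OF assms] by blast
  finally have F: "set (filter (\<lambda>u. T u \<or> j \<noteq> 0) (map (\<lambda>y. x * 2 ^ (j * b) + y * mul_y b j) [0..<num_y k b j])) =
      {u \<in> index_set k b j. dig b j u = x \<and> (T u \<or> j \<noteq> 0)}" .
  have G: "set (if j = 0 then [junk prob k b x] else []) = (if j = 0 then {junk prob k b x} else {})"
    by (cases "j = 0") (simp_all only: if_True if_False list.set simp_thms)
  show ?thesis unfolding word_image_def set_append list.set_map F G ..
qed

lemma word_imageE:
  assumes "2 \<le> k" "x < 2 ^ b" "c \<in> set (word_image prob k b T j x)"
  obtains u where "u \<in> index_set k b j" "dig b j u = x" "T u \<or> j \<noteq> 0" "c = code prob k b j u"
    | "j = 0" "c = junk prob k b x"
proof -
  from assms(3)[unfolded set_word_image[OF assms(1,2)]]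
  consider "c \<in> code prob k b j ` {u \<in> index_set k b j. dig b j u = x \<and> (T u \<or> j \<noteq> 0)}" |
    "c \<in> (if j = 0 then {junk prob k b x} else {})" by blast
  then show thesis
  proof cases
    case 1
    then show thesis using that(1) by blast
  next
    case 2
    then show thesis using that(2) by (cases "j = 0") simp_all
  qed
qed

lemma distinct_word_image:
  assumes "2 \<le> k" "j < k" "x < 2 ^ b"
  shows "distinct (word_image prob k b T j x)"
proof -
  let ?us = "filter (\<lambda>u. T u \<or> j \<noteq> 0) (map (\<lambda>y. x * 2 ^ (j * b) + y * mul_y b j) [0..<num_y k b j])"
  have sub: "set ?us \<subseteq> index_set k b j"
    unfolding set_filter set_map set_upt atLeast0LessThan index_image[OF assms(1,3)] by blast
  have "distinct ?us"
    by (rule distinct_filter) (unfold distinct_map, use index_inj[of x j b] inj_on_subset[OF _ subset_UNIV] in \<open>blast intro: distinct_upt\<close>)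
  then have d: "distinct (map (code prob k b j) ?us)"
    unfolding distinct_map using inj_on_subset[OF code_inj[OF assms(1,2)] sub] by blast
  show ?thesis
  proof (cases "j = 0")
    case True
    have "junk prob k b x \<notin> set (map (code prob k b j) ?us)"
      using junk_neq_code[OF assms(1,3), of _ prob] sub True by (auto simp: index_set_def)
    then show ?thesis using d True unfolding word_image_def by simp
  qed (use d in \<open>simp add: word_image_def\<close>)
qed

text \<open>A genuine code determines its argument, whose digit \<open>j\<close> is the word; a junk
  code determines the word directly, and the two kinds never coincide.\<close>

lemma word_image_disjoint:
  assumes "2 \<le> k" "j < k" "x < 2 ^ b" "x' < 2 ^ b"
    and c: "c \<in> set (word_image prob k b T j x)" "c \<in> set (word_image prob k b T j x')"
  shows "x = x'"
  using assms(1,3) c(1)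
proof (cases rule: word_imageE)
  case (1 u)
  note u = this
  from assms(1,4) c(2) show ?thesis
  proof (cases rule: word_imageE)
    case (1 v)
    then have "u = v" using inj_onD[OF code_inj[OF assms(1,2)], of prob b u v] u by simp
    then show ?thesis using u 1 by simp
  next
    case 2
    then show ?thesis using junk_neq_code[OF assms(1,4), of u prob] u by (simp add: index_set_def)
  qed
next
  case 2
  note u = this
  from assms(1,4) c(2) show ?thesis
  proof (cases rule: word_imageE)
    case (1 v)
    then show ?thesis using junk_neq_code[OF assms(1,3), of v prob] u by (simp add: index_set_def)
  next
    case 2
    then show ?thesis using junk_inj[OF assms(1,3,4), of prob] u by simp
  qed
qed

text \<open>In the first set \<open>f\<close> may reject every tuple that starts with the word; then
  the junk alone keeps the image nonempty.\<close>

lemma word_image_nonempty: "word_image prob k b T j x \<noteq> []"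
proof (cases "j = 0")
  case False
  then have "filter (\<lambda>u. T u \<or> j \<noteq> 0) us = us" for us by (induction us) simp_all
  then show ?thesis unfolding word_image_def using num_y_pos[of k b j] by simp
qed (simp add: word_image_def)

lemma word_image_less:
  assumes "2 \<le> k" "j < k" "x < 2 ^ b" "c \<in> set (word_image prob k b T j x)"
  shows "c < 2 ^ width prob k b"
  using assms(1,3,4)
proof (cases rule: word_imageE)
  case (1 u)
  then show ?thesis using code_less(1,3)[OF assms(1), where b = b and prob = prob] assms(2)
    by (cases "j = 0") (simp_all add: index_set_def)
next
  case 2
  then show ?thesis using code_less(2)[OF assms(1,3)] by simp
qed


section \<open>Images of word sets, vectors and instances\<close>

definition words_image :: "problem \<Rightarrow> nat \<Rightarrow> nat \<Rightarrow> (nat \<Rightarrow> bool) \<Rightarrow> nat \<Rightarrow> bits set \<Rightarrow> bits set" where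
  "words_image prob k b T j A = bits_of (width prob k b) ` (\<Union>w\<in>A. set (word_image prob k b T j (bits_val w)))"

definition vec_map :: "problem \<Rightarrow> nat \<Rightarrow> nat \<Rightarrow> (nat \<Rightarrow> bool) \<Rightarrow> nat \<Rightarrow> fvec \<Rightarrow> fvec" where
  "vec_map prob k b T j v = map (words_image prob k b T j) v"

definition instance_map :: "problem \<Rightarrow> nat \<Rightarrow> nat \<Rightarrow> (nat \<Rightarrow> bool) \<Rightarrow> fvec set list \<Rightarrow> fvec set list" where
  "instance_map prob k b T Vs = map (\<lambda>j. vec_map prob k b T j ` (Vs ! j)) [0..<k]"

lemma bits_val_inj: "length w = b \<Longrightarrow> length w' = b \<Longrightarrow> bits_val w = bits_val w' \<Longrightarrow> w = w'"
  by (metis bits_of_bits_val)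

text \<open>The images of words are nonempty and pairwise disjoint, so any single element of an
  image reveals that its word belongs to the set.\<close>

lemma words_image_inj:
  assumes k: "2 \<le> k" "j < k"
    and A: "\<And>w. w \<in> A \<Longrightarrow> length w = b" "\<And>w. w \<in> A' \<Longrightarrow> length w = b"
    and eq: "words_image prob k b T j A = words_image prob k b T j A'"
  shows "A = A'"
proof -
  have sub: "C \<subseteq> C'" if C: "\<And>w. w \<in> C \<Longrightarrow> length w = b" "\<And>w. w \<in> C' \<Longrightarrow> length w = b"
    and le: "words_image prob k b T j C \<subseteq> words_image prob k b T j C'" for C C'
  proof
    fix w assume w: "w \<in> C"
    let ?W = "\<lambda>w. set (word_image prob k b T j (bits_val w))"
    obtain c where c: "c \<in> ?W w" using word_image_nonempty[of prob k b T j "bits_val w"] by (meson last_in_set)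
    have "bits_of (width prob k b) c \<in> words_image prob k b T j C" unfolding words_image_def using w c by blast
    then have "bits_of (width prob k b) c \<in> words_image prob k b T j C'" using le by blast
    then obtain w' c' where w': "w' \<in> C'" "c' \<in> ?W w'" "bits_of (width prob k b) c = bits_of (width prob k b) c'"
      unfolding words_image_def by blast
    have lt: "bits_val w < 2 ^ b" "bits_val w' < 2 ^ b" using C w w'(1) by (simp_all add: bits_val_less)
    have "c = c'"
      by (rule bits_of_inj[OF word_image_less[OF k lt(1) c] word_image_less[OF k lt(2) w'(2)] w'(3)])
    then have "bits_val w = bits_val w'" using word_image_disjoint[OF k lt c] w'(2) by simp
    then have "w = w'" using bits_val_inj C w w'(1) by blast
    then show "w \<in> C'" using w'(1) by simp
  qed
  show ?thesis
  proof
    show "A \<subseteq> A'" by (rule sub[OF A]) (simp_all add: eq)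
    show "A' \<subseteq> A" by (rule sub[OF A(2,1)]) (simp_all add: eq)
  qed
qed

lemma fvecs_length: "v \<in> fvecs g b \<Longrightarrow> A \<in> set v \<Longrightarrow> w \<in> A \<Longrightarrow> length w = b"
  unfolding fvecs_def by blast

lemma fvecs_dim: "v \<in> fvecs g b \<Longrightarrow> length v = g"
  unfolding fvecs_def by blast

lemma fvec_component_inj:
  assumes v: "v \<in> fvecs g b" "v' \<in> fvecs g b" and i: "v ! i \<in> set v" "v' ! i \<in> set v'"
    and k: "2 \<le> k" "j < k"
    and e: "words_image prob k b T j (v ! i) = words_image prob k b T j (v' ! i)"
  shows "v ! i = v' ! i"
proof -
  have l1: "\<And>w. w \<in> v ! i \<Longrightarrow> length w = b" by (rule fvecs_length[OF v(1) i(1)])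
  have l2: "\<And>w. w \<in> v' ! i \<Longrightarrow> length w = b" by (rule fvecs_length[OF v(2) i(2)])
  show ?thesis
    by (rule words_image_inj[where k = k and j = j and b = b and prob = prob and T = T and
          A = "v ! i" and A' = "v' ! i"])
      (fact k, fact k, erule l1, erule l2, fact e)
qed

lemma vec_map_inj:
  assumes "2 \<le> k" "j < k"
  shows "inj_on (vec_map prob k b T j) (fvecs g b)"
proof (rule inj_onI)
  fix v v' assume v: "v \<in> fvecs g b" "v' \<in> fvecs g b" and eq: "vec_map prob k b T j v = vec_map prob k b T j v'"
  have len: "length v = length v'" by (simp only: fvecs_dim[OF v(1)] fvecs_dim[OF v(2)])
  show "v = v'"
  proof (rule nth_equalityI[OF len])
    fix i assume i: "i < length v"
    then have i': "i < length v'" using len by simp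
    have "words_image prob k b T j (v ! i) = words_image prob k b T j (v' ! i)"
      using arg_cong[OF eq, of "\<lambda>xs. xs ! i"] i i' by (simp only: vec_map_def nth_map)
    then show "v ! i = v' ! i"
      by (rule fvec_component_inj[OF v nth_mem[OF i] nth_mem[OF i'] assms])
  qed
qed

lemma vec_map_fvecs: "vec_map prob k b T j v \<in> fvecs g (width prob k b)" if "v \<in> fvecs g b"
  using that by (auto simp: vec_map_def fvecs_def words_image_def)

text \<open>Each new set must again have exactly \<open>n\<close> vectors, so no two vectors may be
  merged; this is the purpose of \<open>vec_map_inj\<close>.\<close>

lemma fk_instance_map:
  assumes "2 \<le> k" "fk_instance k n g b Vs"
  shows "fk_instance k n g (width prob k b) (instance_map prob k b T Vs)"
proof -
  have "vec_map prob k b T j ` (Vs ! j) \<subseteq> fvecs g (width prob k b) \<and> card (vec_map prob k b T j ` (Vs ! j)) = n"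
    if j: "j < k" for j
  proof -
    have V: "Vs ! j \<subseteq> fvecs g b" "card (Vs ! j) = n" using assms(2) j by (auto simp: fk_instance_def)
    have "inj_on (vec_map prob k b T j) (Vs ! j)" using inj_on_subset[OF vec_map_inj[OF assms(1) j] V(1)] .
    then have "card (vec_map prob k b T j ` (Vs ! j)) = n" using V(2) by (simp add: card_image)
    then show ?thesis using V(1) vec_map_fvecs by blast
  qed
  then show ?thesis using assms(2) by (auto simp: fk_instance_def instance_map_def)
qed

lemma concat_map_concat: "concat (map f (concat Ls)) = concat (map (\<lambda>L. concat (map f L)) Ls)"
  by (induction Ls) simp_all

lemma list_all2_choice:
  assumes "list_all2 P xs ys" "\<And>x y. x \<in> set xs \<Longrightarrow> P x y \<Longrightarrow> \<exists>z. Q x y z"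
  shows "\<exists>zs. length zs = length xs \<and> (\<forall>i<length xs. Q (xs ! i) (ys ! i) (zs ! i))"
proof -
  have "\<exists>z. i < length xs \<longrightarrow> Q (xs ! i) (ys ! i) z" for i
  proof (cases "i < length xs")
    case True
    then show ?thesis using assms(2)[OF nth_mem[OF True] list_all2_nthD[OF assms(1) True]] by blast
  qed simp
  then have "\<forall>i. \<exists>z. i < length xs \<longrightarrow> Q (xs ! i) (ys ! i) z" by blast
  from choice[OF this] obtain f where f: "\<forall>i. i < length xs \<longrightarrow> Q (xs ! i) (ys ! i) (f i)" ..
  then show ?thesis by (intro exI[of _ "map f [0..<length xs]"]) simp
qed

definition valid_words :: "nat \<Rightarrow> nat list \<Rightarrow> bool" where
  "valid_words b L \<longleftrightarrow> length L \<le> 2 ^ b \<and> (\<forall>x\<in>set L. x < 2 ^ b)"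

text \<open>Encodings must be free of repetitions. The concatenated output is, because the images of
  different words are disjoint and each of them is listed without repetition.\<close>

lemma enc_bits_set_map:
  assumes k: "2 \<le> k" "j < k" and enc: "enc_bits_set A xs" and A: "\<And>w. w \<in> A \<Longrightarrow> length w = b"
  shows "\<exists>L. xs = enc_list L \<and> valid_words b L \<and>
    enc_bits_set (words_image prob k b T j A) (enc_list (set_image prob k b T j L))"
proof -
  obtain ws where ws: "distinct ws" "set ws = A" "xs = length ws # map bits_val ws"
    using enc by (auto simp: enc_bits_set_def)
  let ?b = "width prob k b"
  let ?im = "\<lambda>w. word_image prob k b T j (bits_val w)"
  have len: "length w = b" if "w \<in> set ws" for w using A ws(2) that by blast
  have lt: "bits_val w < 2 ^ b" if "w \<in> set ws" for w using len[OF that] by (simp add: bits_val_less)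
  have inj: "inj_on bits_val (set ws)" using len bits_val_inj[of _ b] by (intro inj_onI) simp
  have "length ws = card (bits_val ` set ws)" using ws(1) inj by (simp add: card_image distinct_card)
  also have "\<dots> \<le> card {..<(2::nat) ^ b}" using lt by (intro card_mono) auto
  finally have "length ws \<le> 2 ^ b" by simp
  then have val: "valid_words b (map bits_val ws)" using lt by (auto simp: valid_words_def)
  define zs where "zs = concat (map ?im ws)"
  have zlt: "z < 2 ^ ?b" if "z \<in> set zs" for z
    using that word_image_less[OF k lt] by (auto simp: zs_def)
  have "distinct zs" unfolding zs_def using ws(1) len
  proof (induction ws)
    case (Cons w ws)
    have "set (?im w) \<inter> set (concat (map ?im ws)) = {}"
    proof (rule ccontr)
      assume "set (?im w) \<inter> set (concat (map ?im ws)) \<noteq> {}"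
      then obtain w' c where c: "w' \<in> set ws" "c \<in> set (?im w)" "c \<in> set (?im w')" by auto
      have "bits_val w = bits_val w'"
        using word_image_disjoint[OF k bits_val_less bits_val_less c(2,3)] Cons.prems(2) c(1) by simp
      then have "w = w'" using bits_val_inj[of w b w'] Cons.prems(2)[of w] Cons.prems(2)[of w'] c(1) by simp
      then show False using Cons.prems(1) c(1) by simp
    qed
    moreover have "distinct (?im w)" using distinct_word_image[OF k bits_val_less] Cons.prems(2) by simp
    ultimately show ?case using Cons by simp
  qed simp
  moreover have "inj_on (bits_of ?b) (set zs)" using zlt bits_of_inj[of _ ?b] by (intro inj_onI) simp
  ultimately have d: "distinct (map (bits_of ?b) zs)" by (simp add: distinct_map)
  have s: "set (map (bits_of ?b) zs) = words_image prob k b T j A"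
    by (auto simp: zs_def words_image_def ws(2))
  have v: "map bits_val (map (bits_of ?b) zs) = zs"
    using zlt by (simp add: map_idI bits_val_bits_of_less)
  have si: "set_image prob k b T j (map bits_val ws) = zs" by (simp add: set_image_def zs_def comp_def)
  have "enc_bits_set (words_image prob k b T j A) (enc_list zs)"
    unfolding enc_bits_set_def using d s v
    by (intro exI[of _ "map (bits_of ?b) zs"]) (simp add: enc_list_def)
  then show ?thesis using ws(3) val si by (intro exI[of _ "map bits_val ws"]) (simp add: enc_list_def)
qed

lemma enc_fvec_map:
  assumes k: "2 \<le> k" "j < k" and enc: "enc_fvec v xs" and v: "v \<in> fvecs g b"
  shows "\<exists>L. xs = concat (map enc_list L) \<and> length L = g \<and> (\<forall>ws\<in>set L. valid_words b ws) \<and>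
    enc_fvec (vec_map prob k b T j v) (concat (map (\<lambda>ws. enc_list (set_image prob k b T j ws)) L))"
proof -
  obtain xss where xss: "list_all2 enc_bits_set v xss" "xs = concat xss" using enc by (auto simp: enc_fvec_def)
  have len: "length xss = length v" "length v = g" using list_all2_lengthD[OF xss(1)] fvecs_dim[OF v] by simp_all
  have "\<exists>L. length L = length v \<and> (\<forall>i<length v. xss ! i = enc_list (L ! i) \<and> valid_words b (L ! i) \<and>
      enc_bits_set (words_image prob k b T j (v ! i)) (enc_list (set_image prob k b T j (L ! i))))"
  proof (rule list_all2_choice[OF xss(1)])
    fix A ys assume A: "A \<in> set v" "enc_bits_set A ys"
    show "\<exists>L. ys = enc_list L \<and> valid_words b L \<and>
      enc_bits_set (words_image prob k b T j A) (enc_list (set_image prob k b T j L))"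
    proof (rule enc_bits_set_map[OF k A(2)])
      show "length w = b" if "w \<in> A" for w by (rule fvecs_length[OF v A(1) that])
    qed
  qed
  then obtain L where L: "length L = length v" "\<And>i. i < length v \<Longrightarrow> xss ! i = enc_list (L ! i) \<and> valid_words b (L ! i) \<and>
      enc_bits_set (words_image prob k b T j (v ! i)) (enc_list (set_image prob k b T j (L ! i)))" by blast
  have "xss = map enc_list L" using L len by (intro nth_equalityI) simp_all
  moreover have "\<forall>ws\<in>set L. valid_words b ws" using L by (metis in_set_conv_nth)
  moreover have "list_all2 enc_bits_set (vec_map prob k b T j v) (map (\<lambda>ws. enc_list (set_image prob k b T j ws)) L)"
    using L by (simp add: list_all2_conv_all_nth vec_map_def)
  ultimately show ?thesis using xss(2) L(1) len unfolding enc_fvec_def by blast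
qed

lemma enc_fvec_words_image:
  assumes k: "2 \<le> k" "j < k" and enc: "enc_fvec_set V xs" and V: "V \<subseteq> fvecs g b" "card V = n"
  shows "\<exists>L. xs = concat (map enc_list L) \<and> valid_part n g b L \<and>
    enc_fvec_set (vec_map prob k b T j ` V) (part_image prob k b T j L)"
proof -
  obtain vs xss where vs: "distinct vs" "set vs = V" "list_all2 enc_fvec vs xss" "xs = concat xss"
    using enc by (auto simp: enc_fvec_set_def)
  have len: "length xss = length vs" "length vs = n"
    using vs V(2) by (auto simp: list_all2_lengthD distinct_card)
  have "\<exists>Ls. length Ls = length vs \<and> (\<forall>i<length vs. xss ! i = concat (map enc_list (Ls ! i)) \<and> length (Ls ! i) = g \<and>
      (\<forall>ws\<in>set (Ls ! i). valid_words b ws) \<and>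
      enc_fvec (vec_map prob k b T j (vs ! i)) (concat (map (\<lambda>ws. enc_list (set_image prob k b T j ws)) (Ls ! i))))"
  proof (rule list_all2_choice[OF vs(3)])
    fix v ys assume v: "v \<in> set vs" "enc_fvec v ys"
    show "\<exists>L. ys = concat (map enc_list L) \<and> length L = g \<and> (\<forall>ws\<in>set L. valid_words b ws) \<and>
      enc_fvec (vec_map prob k b T j v) (concat (map (\<lambda>ws. enc_list (set_image prob k b T j ws)) L))"
    proof (rule enc_fvec_map[OF k v(2)])
      show "v \<in> fvecs g b" using V(1) vs(2) v(1) by blast
    qed
  qed
  then obtain Ls where Ls: "length Ls = length vs"
    "\<And>i. i < length vs \<Longrightarrow> xss ! i = concat (map enc_list (Ls ! i)) \<and> length (Ls ! i) = g \<and>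
      (\<forall>ws\<in>set (Ls ! i). valid_words b ws) \<and>
      enc_fvec (vec_map prob k b T j (vs ! i)) (concat (map (\<lambda>ws. enc_list (set_image prob k b T j ws)) (Ls ! i)))"
    by blast
  define L where "L = concat Ls"
  have "xss = map (\<lambda>L. concat (map enc_list L)) Ls" using Ls len by (intro nth_equalityI) simp_all
  then have 1: "xs = concat (map enc_list L)" by (simp add: vs(4) L_def concat_map_concat)
  have "\<forall>M\<in>set Ls. length M = g \<and> (\<forall>ws\<in>set M. valid_words b ws)" using Ls by (metis in_set_conv_nth)
  moreover from this have "length (concat Ls) = length Ls * g" by (induction Ls) auto
  ultimately have 2: "valid_part n g b L"
    using Ls(1) len by (auto simp: valid_part_def L_def valid_words_def)
  have 3: "part_image prob k b T j L = concat (map (\<lambda>M. concat (map (\<lambda>ws. enc_list (set_image prob k b T j ws)) M)) Ls)"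
    by (simp only: part_image_def L_def concat_map_concat)
  have "distinct (map (vec_map prob k b T j) vs)"
    using vs inj_on_subset[OF vec_map_inj[OF k] V(1)] by (simp add: distinct_map)
  moreover have "list_all2 enc_fvec (map (vec_map prob k b T j) vs)
      (map (\<lambda>M. concat (map (\<lambda>ws. enc_list (set_image prob k b T j ws)) M)) Ls)"
    using Ls by (simp add: list_all2_conv_all_nth)
  ultimately have "enc_fvec_set (vec_map prob k b T j ` V) (part_image prob k b T j L)"
    unfolding enc_fvec_set_def 3 using vs(2) by (intro exI conjI) (auto simp del: map_map)
  then show ?thesis using 1 2 by blast
qed

lemma enc_instance_map:
  assumes k: "2 \<le> k" and inst: "fk_instance k n g b Vs" and enc: "enc_instance Vs xs"
  shows "\<exists>Ls. xs = concat (map (\<lambda>L. concat (map enc_list L)) Ls) \<and> length Ls = k \<and>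
    (\<forall>L\<in>set Ls. valid_part n g b L) \<and>
    enc_instance (instance_map prob k b T Vs) (concat (map2 (part_image prob k b T) [0..<k] Ls))"
proof -
  obtain xss where xss: "list_all2 enc_fvec_set Vs xss" "xs = concat xss" using enc by (auto simp: enc_instance_def)
  have len: "length xss = k" "length Vs = k" using xss(1) inst by (auto simp: list_all2_lengthD fk_instance_def)
  have "\<exists>L. xss ! j = concat (map enc_list L) \<and> valid_part n g b L \<and>
    enc_fvec_set (vec_map prob k b T j ` (Vs ! j)) (part_image prob k b T j L)" if "j < k" for j
    using that xss(1) inst len by (intro enc_fvec_words_image[OF k]) (auto simp: list_all2_conv_all_nth fk_instance_def)
  then obtain F where F: "\<And>j. j < k \<Longrightarrow> xss ! j = concat (map enc_list (F j)) \<and> valid_part n g b (F j) \<and>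
    enc_fvec_set (vec_map prob k b T j ` (Vs ! j)) (part_image prob k b T j (F j))" by metis
  have "xss = map (\<lambda>L. concat (map enc_list L)) (map F [0..<k])"
    using F len by (intro nth_equalityI) (simp_all del: map_map)
  moreover have "list_all2 enc_fvec_set (instance_map prob k b T Vs) (map2 (part_image prob k b T) [0..<k] (map F [0..<k]))"
    using F by (simp add: list_all2_conv_all_nth instance_map_def)
  ultimately show ?thesis using xss(2) F unfolding enc_instance_def
    by (intro exI[of _ "map F [0..<k]"] conjI) (auto simp del: map_map)
qed

section \<open>Counting\<close>

lemma in_listset_iff: "xs \<in> listset As \<longleftrightarrow> length xs = length As \<and> (\<forall>i<length As. xs ! i \<in> As ! i)"
proof (induction As arbitrary: xs)
  case (Cons A As)
  show ?case
    by (cases xs) (auto simp: set_Cons_def Cons.IH less_Suc_eq_0_disj)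
qed auto

lemma finite_listset: "(\<And>A. A \<in> set As \<Longrightarrow> finite A) \<Longrightarrow> finite (listset As)"
proof (induction As)
  case (Cons A As)
  have "listset (A # As) = (\<lambda>(x, xs). x # xs) ` (A \<times> listset As)" by (auto simp: set_Cons_def)
  then show ?case using Cons by simp
qed simp

lemma dig_exists:
  assumes "\<And>j. j < k \<Longrightarrow> d j < 2 ^ b"
  shows "\<exists>u < 2 ^ (k * b). \<forall>j<k. dig b j u = d j"
  using assms
proof (induction k)
  case (Suc k)
  then obtain u where u: "u < 2 ^ (k * b)" "\<forall>j<k. dig b j u = d j" by auto
  have dk: "d k < 2 ^ b" using Suc.prems by simp
  let ?v = "u + 2 ^ (k * b) * d k"
  have "?v < 2 ^ (k * b) * Suc (d k)" using u(1) by simp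
  also have "\<dots> \<le> 2 ^ (k * b) * 2 ^ b" using dk by (intro mult_left_mono) auto
  also have "\<dots> = 2 ^ (Suc k * b)" by (simp add: power_add)
  finally have v: "?v < 2 ^ (Suc k * b)" .
  have "dig b j ?v = d j" if "j < Suc k" for j
  proof (cases "j = k")
    case True
    then show ?thesis using dk u(1) by (simp add: dig_eq)
  next
    case False
    then have j: "j < k" using that by simp
    have "dig b j ?v = dig b j u"
    proof (rule bit_eqI)
      fix a
      have "j * b + a < k * b" if "a < b"
      proof -
        have "j * b + a < Suc j * b" using that by simp
        also have "\<dots> \<le> k * b" using j by (intro mult_right_mono) auto
        finally show ?thesis .
      qed
      then show "bit (dig b j ?v) a = bit (dig b j u) a"
        using bit_concat[OF u(1), of "d k"] by (auto simp: bit_dig)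
    qed
    then show ?thesis using u(2) j by simp
  qed
  then show ?case using v by blast
qed simp

lemma dig_inject:
  assumes "u < 2 ^ (k * b)" "v < 2 ^ (k * b)" "\<And>j. j < k \<Longrightarrow> dig b j u = dig b j v"
  shows "u = v"
proof (rule bit_eqI)
  fix a
  show "bit u a = bit v a"
  proof (cases "a < k * b")
    case True
    then have b: "b > 0" by (cases b) auto
    have "a div b < k" using True by (simp add: less_mult_imp_div_less)
    then have "bit (dig b (a div b) u) (a mod b) = bit (dig b (a div b) v) (a mod b)" using assms(3) by simp
    then show ?thesis using b by (simp add: bit_dig)
  next
    case False
    then show ?thesis using assms(1,2) by (simp add: nat_less_exp_iff)
  qed
qed

definition tuple_of :: "nat \<Rightarrow> nat \<Rightarrow> nat \<Rightarrow> bits list" where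
  "tuple_of k b u = map (\<lambda>j. bits_of b (dig b j u)) [0..<k]"

lemma truth_table_nth:
  assumes "u < 2 ^ (k * b)"
  shows "truth_table k b f ! u = of_bool (f (tuple_of k b u))"
proof -
  have "map (\<lambda>a. bit u (j * b + a)) [0..<b] = bits_of b (dig b j u)" for j
    by (rule nth_equalityI) (simp_all add: bit_dig)
  then show ?thesis using assms by (simp add: truth_table_def tuple_of_def)
qed

text \<open>Parametrises the satisfying tuples of the original component sets by numbers
  \<open>u\<close>. \<open>bij_codeword\<close> does the same for the new component sets, so the two
  counts agree.\<close>

lemma bij_tuple_of:
  assumes As: "length As = k" "\<And>A w. A \<in> set As \<Longrightarrow> w \<in> A \<Longrightarrow> length w = b"
  shows "bij_betw (tuple_of k b) {u. u < 2 ^ (k * b) \<and> (\<forall>j<k. bits_of b (dig b j u) \<in> As ! j) \<and> f (tuple_of k b u)}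
    {ws \<in> listset As. f ws}"
proof (rule bij_betwI')
  fix u v
  assume u: "u \<in> {u. u < 2 ^ (k * b) \<and> (\<forall>j<k. bits_of b (dig b j u) \<in> As ! j) \<and> f (tuple_of k b u)}"
    and v: "v \<in> {u. u < 2 ^ (k * b) \<and> (\<forall>j<k. bits_of b (dig b j u) \<in> As ! j) \<and> f (tuple_of k b u)}"
  show "tuple_of k b u = tuple_of k b v \<longleftrightarrow> u = v"
  proof
    assume eq: "tuple_of k b u = tuple_of k b v"
    have "dig b j u = dig b j v" if "j < k" for j
    proof (rule bits_of_inj[OF dig_less dig_less])
      show "bits_of b (dig b j u) = bits_of b (dig b j v)"
        using arg_cong[OF eq, of "\<lambda>xs. xs ! j"] that by (simp add: tuple_of_def)
    qed
    then show "u = v" using dig_inject u v by blast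
  qed simp
next
  fix u assume "u \<in> {u. u < 2 ^ (k * b) \<and> (\<forall>j<k. bits_of b (dig b j u) \<in> As ! j) \<and> f (tuple_of k b u)}"
  then show "tuple_of k b u \<in> {ws \<in> listset As. f ws}"
    using As(1) by (simp add: in_listset_iff) (simp add: tuple_of_def)
next
  fix ws assume "ws \<in> {ws \<in> listset As. f ws}"
  then have ws: "length ws = k" "\<And>j. j < k \<Longrightarrow> ws ! j \<in> As ! j" "f ws" using As(1) by (simp_all add: in_listset_iff)
  have len: "length (ws ! j) = b" if "j < k" for j
    using As(2)[OF nth_mem ws(2)] As(1) that by simp
  obtain u where u: "u < 2 ^ (k * b)" "\<forall>j<k. dig b j u = bits_val (ws ! j)"
    using dig_exists[of k "\<lambda>j. bits_val (ws ! j)" b] bits_val_less len by blast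
  have t: "bits_of b (dig b j u) = ws ! j" if "j < k" for j
    using u(2) that bits_of_bits_val[OF len[OF that]] by simp
  have eq: "tuple_of k b u = ws"
    by (rule nth_equalityI) (simp_all add: tuple_of_def ws(1) t)
  show "\<exists>u\<in>{u. u < 2 ^ (k * b) \<and> (\<forall>j<k. bits_of b (dig b j u) \<in> As ! j) \<and> f (tuple_of k b u)}. ws = tuple_of k b u"
    by (rule bexI[of _ u]) (use eq u(1) t ws in simp_all)
qed

definition codeword :: "problem \<Rightarrow> nat \<Rightarrow> nat \<Rightarrow> nat \<Rightarrow> bits list" where
  "codeword prob k b u = map (bits_of (width prob k b))
     (code prob k b 0 u # map (\<lambda>j. code prob k b j (part b j u)) [1..<k])"

lemma length_codeword: "2 \<le> k \<Longrightarrow> length (codeword prob k b u) = k"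
  by (simp add: codeword_def)

lemma nth_codeword:
  assumes "2 \<le> k" "j < k"
  shows "codeword prob k b u ! j =
    bits_of (width prob k b) (if j = 0 then code prob k b 0 u else code prob k b j (part b j u))"
  using assms by (cases j) (simp_all add: codeword_def del: map_map)

text \<open>In a satisfying tuple the first word cannot be junk, so it is the code of some
  \<open>u\<close>, and the test forces every other argument to be the matching part of
  \<open>u\<close>. This includes the guess of digit \<open>0\<close>, so each \<open>u\<close>
  arises from one tuple only.\<close>

lemma bij_codeword:
  assumes k: "2 \<le> k" and As: "length As = k" "\<And>A w. A \<in> set As \<Longrightarrow> w \<in> A \<Longrightarrow> length w = b"
    and As'_def: "As' = map (\<lambda>j. words_image prob k b T j (As ! j)) [0..<k]"
  shows "bij_betw (codeword prob k b) {u. u < 2 ^ (k * b) \<and> (\<forall>j<k. bits_of b (dig b j u) \<in> As ! j) \<and> T u}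
    {ws \<in> listset As'. prob_fun prob (width prob k b) ws}"
proof (rule bij_betwI')
  let ?b = "width prob k b"
  let ?U = "{u. u < 2 ^ (k * b) \<and> (\<forall>j<k. bits_of b (dig b j u) \<in> As ! j) \<and> T u}"
  {
    fix u v assume u: "u \<in> ?U" and v: "v \<in> ?U"
    show "codeword prob k b u = codeword prob k b v \<longleftrightarrow> u = v"
    proof
      assume "codeword prob k b u = codeword prob k b v"
      then have "codeword prob k b u ! 0 = codeword prob k b v ! 0" by simp
      then have "bits_of ?b (code prob k b 0 u) = bits_of ?b (code prob k b 0 v)"
        by (simp add: codeword_def)
      moreover have "code prob k b 0 u < 2 ^ ?b" "code prob k b 0 v < 2 ^ ?b" using code_less(1)[OF k] u v by blast+
      ultimately have c: "code prob k b 0 u = code prob k b 0 v" using bits_of_inj by blast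
      have inj: "inj_on (code prob k b 0) (index_set k b 0)" by (rule code_inj[OF k]) (use k in simp)
      show "u = v" by (rule inj_onD[OF inj c]) (use u v in \<open>simp_all add: index_set_def\<close>)
    qed simp
  next
    fix u assume u: "u \<in> ?U"
    have mem: "codeword prob k b u ! j \<in> As' ! j" if j: "j < k" for j
    proof -
      let ?w = "bits_of b (dig b j u)"
      have bv: "bits_val ?w = dig b j u" by (rule bits_val_bits_of_less[OF dig_less])
      let ?c = "if j = 0 then code prob k b 0 u else code prob k b j (part b j u)"
      have c: "?c \<in> set (word_image prob k b T j (bits_val ?w))"
      proof (cases "j = 0")
        case True
        then show ?thesis unfolding bv set_word_image[OF k dig_less] using u
          by (intro UnI1 image_eqI[of _ _ u]) (simp_all add: index_set_def)
      next
        case False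
        then show ?thesis unfolding bv set_word_image[OF k dig_less]
          by (intro UnI1 image_eqI[of _ _ "part b j u"]) (simp_all add: index_set_def part_part dig_part)
      qed
      have w: "?w \<in> As ! j" using u j by blast
      have "bits_of ?b ?c \<in> words_image prob k b T j (As ! j)"
        unfolding words_image_def by (rule imageI, rule UN_I, rule w, rule c)
      then show ?thesis using j by (simp only: nth_codeword[OF k j] As'_def nth_map_upt) simp
    qed
    have "prob_fun prob ?b (codeword prob k b u)"
      unfolding codeword_def using prob_fun_code[OF k, of u b "\<lambda>j. part b j u" prob] u part_part by blast
    then show "codeword prob k b u \<in> {ws \<in> listset As'. prob_fun prob ?b ws}"
      using mem length_codeword[OF k] by (simp add: in_listset_iff As'_def)
  next
    fix ws assume "ws \<in> {ws \<in> listset As'. prob_fun prob ?b ws}"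
    then have ws: "length ws = k" "\<And>j. j < k \<Longrightarrow> ws ! j \<in> words_image prob k b T j (As ! j)" "prob_fun prob ?b ws"
      by (simp_all add: in_listset_iff As'_def)
    have "\<exists>w c. w \<in> As ! j \<and> c \<in> set (word_image prob k b T j (bits_val w)) \<and> ws ! j = bits_of ?b c" if "j < k" for j
      using ws(2)[OF that] unfolding words_image_def by blast
    then obtain w c where wc: "\<And>j. j < k \<Longrightarrow> w j \<in> As ! j"
      "\<And>j. j < k \<Longrightarrow> c j \<in> set (word_image prob k b T j (bits_val (w j)))" "\<And>j. j < k \<Longrightarrow> ws ! j = bits_of ?b (c j)"
      by metis
    have len: "length (w j) = b" if "j < k" for j using As(2)[OF nth_mem wc(1)] As(1) that by simp
    have lt: "bits_val (w j) < 2 ^ b" if "j < k" for j using bits_val_less[OF len[OF that]] .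
    have k0: "0 < k" using k by simp
    have "\<exists>y. part b j y = y \<and> dig b j y = bits_val (w j) \<and> c j = code prob k b j y" if "j \<in> {1..<k}" for j
    proof -
      have jk: "j < k" using that by simp
      from k lt[OF jk] wc(2)[OF jk] show ?thesis
      proof (cases rule: word_imageE)
        case (1 u)
        then show ?thesis using that by (intro exI[of _ u]) (simp add: index_set_def)
      qed (use that in simp)
    qed
    then obtain y where y: "\<And>j. j \<in> {1..<k} \<Longrightarrow> part b j (y j) = y j"
      "\<And>j. j \<in> {1..<k} \<Longrightarrow> dig b j (y j) = bits_val (w j)" "\<And>j. j \<in> {1..<k} \<Longrightarrow> c j = code prob k b j (y j)"
      by metis
    have ws_eq: "ws = map (bits_of ?b) (c 0 # map (\<lambda>j. code prob k b j (y j)) [1..<k])"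
    proof (rule nth_equalityI)
      fix j assume "j < length ws"
      then have j: "j < k" using ws(1) by simp
      show "ws ! j = map (bits_of ?b) (c 0 # map (\<lambda>j. code prob k b j (y j)) [1..<k]) ! j"
        using j wc(3)[OF j] y(3)[of j] k by (cases j) simp_all
    qed (use ws(1) k in simp)
    from k lt[OF k0] wc(2)[OF k0] show "\<exists>u\<in>?U. ws = codeword prob k b u"
    proof (cases rule: word_imageE)
      case (1 u)
      then have u: "u < 2 ^ (k * b)" "dig b 0 u = bits_val (w 0)" "T u" "c 0 = code prob k b 0 u"
        by (simp_all add: index_set_def)
      have yp: "\<forall>j\<in>{1..<k}. y j = part b j u"
        using prob_fun_code[OF k u(1) y(1), of prob] ws(3) unfolding ws_eq u(4) by blast
      have d: "dig b j u = bits_val (w j)" if "j < k" for j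
      proof (cases "j = 0")
        case False
        then have j: "j \<in> {1..<k}" using that by simp
        then have "dig b j u = dig b j (y j)" using yp dig_part[of j b u] by simp
        then show ?thesis using y(2)[OF j] by simp
      qed (use u(2) in simp)
      have "bits_of b (dig b j u) \<in> As ! j" if "j < k" for j
        using d[OF that] wc(1)[OF that] bits_of_bits_val[OF len[OF that]] by simp
      then have "u \<in> ?U" using u by blast
      moreover have "ws = codeword prob k b u"
        unfolding ws_eq codeword_def u(4) using yp by simp
      ultimately show ?thesis by blast
    next
      case 2
      have "\<not> prob_fun prob ?b ws" unfolding ws_eq 2(2) by (rule prob_fun_junk[OF k lt[OF k0] y(1)])
      then show ?thesis using ws(3) by blast
    qed
  }
qed

lemma finite_words: "(\<And>w. w \<in> A \<Longrightarrow> length w = b) \<Longrightarrow> finite (A :: bits set)"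
  by (rule finite_subset[OF _ finite_lists_length_eq[of "UNIV :: bool set" b]]) auto

lemma sum_of_bool_card: "finite A \<Longrightarrow> (\<Sum>x\<in>A. of_bool (P x) :: nat) = card {x \<in> A. P x}"
  by (subst Collect_conj_eq) (simp add: sum_of_bool_eq)

lemma sum_words_image:
  assumes k: "2 \<le> k" and As: "length As = k" "\<And>A w. A \<in> set As \<Longrightarrow> w \<in> A \<Longrightarrow> length w = b"
    and T: "\<And>u. u < 2 ^ (k * b) \<Longrightarrow> T u \<longleftrightarrow> f (tuple_of k b u)"
  shows "(\<Sum>ws\<in>listset (map (\<lambda>j. words_image prob k b T j (As ! j)) [0..<k]). of_bool (prob_fun prob (width prob k b) ws)) =
    (\<Sum>ws\<in>listset As. of_bool (f ws) :: nat)"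
proof -
  let ?As' = "map (\<lambda>j. words_image prob k b T j (As ! j)) [0..<k]"
  have fin: "finite (listset As)"
  proof (rule finite_listset)
    fix A assume "A \<in> set As"
    then show "finite A" by (rule finite_words[OF As(2)])
  qed
  have fin': "finite (listset ?As')"
  proof (rule finite_listset)
    fix A assume "A \<in> set ?As'"
    then obtain j where "A = words_image prob k b T j (As ! j)" by (auto simp del: in_set_conv_nth)
    then show "finite A" by (intro finite_words[of _ "width prob k b"]) (auto simp: words_image_def)
  qed
  have U: "{u. u < 2 ^ (k * b) \<and> (\<forall>j<k. bits_of b (dig b j u) \<in> As ! j) \<and> T u} =
    {u. u < 2 ^ (k * b) \<and> (\<forall>j<k. bits_of b (dig b j u) \<in> As ! j) \<and> f (tuple_of k b u)}" using T by blast
  have "(\<Sum>ws\<in>listset ?As'. of_bool (prob_fun prob (width prob k b) ws) :: nat) =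
      card {ws \<in> listset ?As'. prob_fun prob (width prob k b) ws}"
    by (rule sum_of_bool_card[OF fin'])
  also have "\<dots> = card {ws \<in> listset As. f ws}"
    using bij_betw_same_card[OF bij_codeword[OF k As refl, where prob = prob and T = T]] bij_betw_same_card[OF bij_tuple_of[OF As, where f = f]]
    unfolding U by (rule trans[OF sym])
  also have "\<dots> = (\<Sum>ws\<in>listset As. of_bool (f ws) :: nat)" by (rule sum_of_bool_card[OF fin, symmetric])
  finally show ?thesis .
qed

text \<open>The tuples of vectors correspond one to one, and each inner sum keeps its value because
  both versions count the same numbers \<open>u\<close>.\<close>

theorem factored_count_map:
  assumes k: "2 \<le> k" and inst: "fk_instance k n g b Vs"
    and T: "\<And>u. u < 2 ^ (k * b) \<Longrightarrow> T u \<longleftrightarrow> f (tuple_of k b u)"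
  shows "factored_count (prob_fun prob (width prob k b)) g (instance_map prob k b T Vs) = factored_count f g Vs"
proof -
  let ?F = "\<lambda>vs. map (\<lambda>j. vec_map prob k b T j (vs ! j)) [0..<k]"
  have Vs: "length Vs = k" "\<And>j. j < k \<Longrightarrow> Vs ! j \<subseteq> fvecs g b" using inst by (auto simp: fk_instance_def)
  have vs_mem: "length vs = k" "j < k \<Longrightarrow> vs ! j \<in> Vs ! j" if "vs \<in> listset Vs" for vs j
    using that Vs(1) by (simp_all add: in_listset_iff)
  have "bij_betw ?F (listset Vs) (listset (instance_map prob k b T Vs))"
  proof (rule bij_betwI')
    fix vs vs' assume vs: "vs \<in> listset Vs" "vs' \<in> listset Vs"
    show "?F vs = ?F vs' \<longleftrightarrow> vs = vs'"
    proof
      assume eq: "?F vs = ?F vs'"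
      show "vs = vs'"
      proof (rule nth_equalityI)
        show "length vs = length vs'" using vs_mem(1) vs by simp
        fix j assume "j < length vs"
        then have j: "j < k" using vs_mem(1) vs by simp
        have "vec_map prob k b T j (vs ! j) = vec_map prob k b T j (vs' ! j)"
          using arg_cong[OF eq, of "\<lambda>xs. xs ! j"] j by simp
        then show "vs ! j = vs' ! j"
          using inj_onD[OF vec_map_inj[OF k j]] vs_mem(2)[OF vs(1) j] vs_mem(2)[OF vs(2) j] Vs(2)[OF j] by blast
      qed
    qed simp
  next
    fix vs assume "vs \<in> listset Vs"
    from vs_mem(2)[OF this] have "\<forall>j<k. vec_map prob k b T j (vs ! j) \<in> vec_map prob k b T j ` (Vs ! j)" by blast
    then show "?F vs \<in> listset (instance_map prob k b T Vs)"
      by (simp add: in_listset_iff instance_map_def)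
  next
    fix vs' assume "vs' \<in> listset (instance_map prob k b T Vs)"
    then have vs': "length vs' = k" "\<And>j. j < k \<Longrightarrow> vs' ! j \<in> vec_map prob k b T j ` (Vs ! j)"
      by (simp_all add: in_listset_iff instance_map_def)
    then have "\<forall>j. \<exists>v. j < k \<longrightarrow> v \<in> Vs ! j \<and> vs' ! j = vec_map prob k b T j v" by blast
    from choice[OF this] obtain v where v: "\<forall>j. j < k \<longrightarrow> v j \<in> Vs ! j \<and> vs' ! j = vec_map prob k b T j (v j)" ..
    have "map v [0..<k] \<in> listset Vs" using v Vs(1) by (simp add: in_listset_iff)
    moreover have "vs' = ?F (map v [0..<k])" by (rule nth_equalityI) (use v vs'(1) in simp_all)
    ultimately show "\<exists>vs\<in>listset Vs. vs' = ?F vs" by blast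
  qed
  then have "factored_count (prob_fun prob (width prob k b)) g (instance_map prob k b T Vs) =
    (\<Sum>vs\<in>listset Vs. \<Prod>i<g. \<Sum>ws\<in>listset (map (\<lambda>v. v ! i) (?F vs)). of_bool (prob_fun prob (width prob k b) ws))"
    unfolding factored_count_def by (rule sum.reindex_bij_betw[symmetric])
  also have "\<dots> = (\<Sum>vs\<in>listset Vs. \<Prod>i<g. \<Sum>ws\<in>listset (map (\<lambda>v. v ! i) vs). of_bool (f ws))"
  proof (rule sum.cong[OF refl], rule prod.cong[OF refl])
    fix vs i assume vs: "vs \<in> listset Vs" and i: "i \<in> {..<g}"
    let ?As = "map (\<lambda>v. v ! i) vs"
    have fv: "vs ! j \<in> fvecs g b" if "j < k" for j using vs_mem(2)[OF vs that] Vs(2)[OF that] by blast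
    have M: "map (\<lambda>v. v ! i) (?F vs) = map (\<lambda>j. words_image prob k b T j (?As ! j)) [0..<k]"
    proof (rule nth_equalityI)
      fix j assume "j < length (map (\<lambda>v. v ! i) (?F vs))"
      then have j: "j < k" by simp
      then show "map (\<lambda>v. v ! i) (?F vs) ! j = map (\<lambda>j. words_image prob k b T j (?As ! j)) [0..<k] ! j"
        using i fvecs_dim[OF fv[OF j]] vs_mem(1)[OF vs] by (simp add: vec_map_def)
    qed simp
    have lenw: "length w = b" if A: "A \<in> set ?As" and w: "w \<in> A" for A w
    proof -
      obtain j where j: "j < k" "A = vs ! j ! i" using A vs_mem(1)[OF vs] by (auto simp: in_set_conv_nth)
      have "vs ! j ! i \<in> set (vs ! j)" using i fvecs_dim[OF fv[OF j(1)]] by simp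
      then show ?thesis using fvecs_length[OF fv[OF j(1)]] j(2) w by blast
    qed
    show "(\<Sum>ws\<in>listset (map (\<lambda>v. v ! i) (?F vs)). of_bool (prob_fun prob (width prob k b) ws)) =
      (\<Sum>ws\<in>listset ?As. of_bool (f ws) :: nat)"
      unfolding M
      by (rule sum_words_image[where As = ?As and f = f and b = b and T = T and k = k and prob = prob])
        (rule k, simp add: vs_mem(1)[OF vs], erule lenw, assumption, erule T)
  qed
  also have "\<dots> = factored_count f g Vs" by (simp only: factored_count_def)
  finally show ?thesis .
qed

section \<open>Every solver reads its input\<close>

text \<open>Words of length \<open>b = h + k\<close> for parameters \<open>x < 2 ^ h\<close>:
  \<open>adv\<close> fills the attacked cells of the first set, \<open>partner\<close> the other
  sets, and \<open>adv_alt\<close> is a replacement that never contributes. The distinction rests on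
  bit \<open>h\<close> for \<open>OV\<close> (all partners and \<open>adv_alt\<close> have it,
  \<open>adv\<close> does not) and for \<open>XOR\<close> (only \<open>adv_alt\<close> has it). For
  \<open>SUM\<close>, \<open>adv\<close> and the partner of the same \<open>x\<close> at
  \<open>j = 1\<close> add up to \<open>2 ^ b\<close>, whereas \<open>adv_alt\<close> lacks
  \<open>2 ^ (b - 1)\<close>.\<close>

fun adv :: "problem \<Rightarrow> nat \<Rightarrow> nat \<Rightarrow> nat \<Rightarrow> nat" where
  "adv PrSUM h b x = 2 ^ b - 1 - x"
| "adv PrXOR h b x = x"
| "adv PrOV h b x = x"

fun adv_alt :: "problem \<Rightarrow> nat \<Rightarrow> nat \<Rightarrow> nat \<Rightarrow> nat" where
  "adv_alt PrSUM h b x = 2 ^ (b - 1) - 1 - x"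
| "adv_alt PrXOR h b x = x + 2 ^ h * 1"
| "adv_alt PrOV h b x = x + 2 ^ h * 1"

fun partner :: "problem \<Rightarrow> nat \<Rightarrow> nat \<Rightarrow> nat \<Rightarrow> nat" where
  "partner PrSUM h j x = x + of_bool (j = 1)"
| "partner PrXOR h j x = x"
| "partner PrOV h j x = x + 2 ^ h * 1"

lemma adv_bounds:
  assumes "2 \<le> k" "x < 2 ^ h"
  shows "adv prob h (h + k) x < 2 ^ (h + k)" "adv_alt prob h (h + k) x < 2 ^ (h + k)"
    "partner prob h j x < 2 ^ (h + k)"
proof -
  have "(2::nat) ^ 2 \<le> 2 ^ k" using assms(1) by (intro power_increasing) auto
  then have "2 ^ h * 2 ^ 2 \<le> (2::nat) ^ h * 2 ^ k" by (rule mult_left_mono) simp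
  then have 1: "4 * 2 ^ h \<le> (2::nat) ^ (h + k)" by (simp add: power_add)
  have 2: "(2::nat) ^ (h + k - 1) \<le> 2 ^ (h + k)" by (intro power_increasing) auto
  show "adv prob h (h + k) x < 2 ^ (h + k)" using 1 assms(2) by (cases prob) auto
  have "2 ^ (h + k - 1) - 1 - x < (2::nat) ^ (h + k)" using 1 2 assms(2) by linarith
  moreover have "x + 2 ^ h * 1 < (2::nat) ^ (h + k)" "x < (2::nat) ^ (h + k)" "x + 1 < (2::nat) ^ (h + k)"
    using 1 assms(2) by linarith+
  ultimately show "adv_alt prob h (h + k) x < 2 ^ (h + k)" "partner prob h j x < 2 ^ (h + k)"
    by (cases prob; simp)+
qed

text \<open>The last claim keeps the value in an attacked cell from being a bit, so that the cell
  cannot pass for a digit of the output. This is why the parameters \<open>0\<close> and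
  \<open>1\<close> are not attacked.\<close>

lemma adv_inj:
  assumes "2 \<le> k" "x < 2 ^ h" "y < 2 ^ h"
  shows "adv prob h (h + k) x = adv prob h (h + k) y \<Longrightarrow> x = y" "adv prob h (h + k) x \<noteq> adv_alt prob h (h + k) y"
    "x \<ge> 2 \<Longrightarrow> adv prob h (h + k) x \<ge> 2"
proof -
  have "(2::nat) ^ 2 \<le> 2 ^ k" using assms(1) by (intro power_increasing) auto
  then have "2 ^ h * 2 ^ 2 \<le> (2::nat) ^ h * 2 ^ k" by (rule mult_left_mono) simp
  then have 1: "4 * 2 ^ h \<le> (2::nat) ^ (h + k)" by (simp add: power_add)
  have 2: "2 * 2 ^ (h + k - 1) = (2::nat) ^ (h + k)" using assms(1) by (cases k) simp_all
  have s: "2 ^ (h + k) - 1 - x = 2 ^ (h + k) - 1 - y \<Longrightarrow> x = y" using 1 assms by linarith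
  show "adv prob h (h + k) x = adv prob h (h + k) y \<Longrightarrow> x = y" using s by (cases prob) (simp_all only: adv.simps)
  have t: "2 ^ (h + k) - 1 - x \<noteq> 2 ^ (h + k - 1) - 1 - y" using 1 2 assms by linarith
  have t': "x \<noteq> y + 2 ^ h * 1" using assms by linarith
  show "adv prob h (h + k) x \<noteq> adv_alt prob h (h + k) y" using t t' by (cases prob) (simp_all only: adv.simps adv_alt.simps not_False_eq_True)
  have one: "(1::nat) \<le> 2 ^ h" by simp
  have "2 ^ (h + k) - 1 - x \<ge> 2" using 1 assms one by linarith
  then show "x \<ge> 2 \<Longrightarrow> adv prob h (h + k) x \<ge> 2" by (cases prob) (simp_all only: adv.simps)
qed

lemma partner_inj: "partner prob h j x = partner prob h j y \<Longrightarrow> x = y"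
  by (cases prob) (simp_all only: partner.simps add_right_cancel)

text \<open>Only the parameters \<open>0\<close> and \<open>x\<close> occur, so the partners are
  present once the other sets offer these two: \<open>0\<close> everywhere for \<open>OV\<close>,
  and a single \<open>x\<close> at \<open>j = 1\<close> for \<open>XOR\<close> and
  \<open>SUM\<close>.\<close>

lemma adv_hit:
  assumes k: "2 \<le> k" and x: "x < 2 ^ h"
  shows "\<exists>y. (\<forall>j. y j = 0 \<or> y j = x) \<and> prob_fun prob (h + k)
     (map (bits_of (h + k)) (adv prob h (h + k) x # map (\<lambda>j. partner prob h j (y j)) [1..<k]))"
proof (cases prob)
  case PrOV
  have "\<exists>c\<in>set (x # map (\<lambda>j. 0 + 2 ^ h * 1) [1..<k]). \<not> bit c a" for a
  proof (cases "a < h")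
    case True
    have "\<not> bit (0 + 2 ^ h * 1 :: nat) a" using True by (subst bit_concat) simp_all
    moreover have "0 + 2 ^ h * 1 \<in> set (x # map (\<lambda>j. 0 + 2 ^ h * 1) [1..<k])"
      using k by (auto simp: image_iff intro!: bexI[of _ 1])
    ultimately show ?thesis by blast
  next
    case False
    then show ?thesis using x by (simp add: nat_less_exp_iff)
  qed
  then show ?thesis unfolding PrOV prob_fun.simps f_OV_bits_of adv.simps partner.simps
    by (intro exI[of _ "\<lambda>_. 0"]) blast
next
  case PrXOR
  define y where "y = (\<lambda>j::nat. if j = 1 then x else 0)"
  have "\<not> bit (fold xor (map y [1..<k]) x) a" for a
  proof -
    have "bit (fold xor (map y [1..<k]) x) a \<longleftrightarrow> bit x a \<noteq> (1 \<in> set [1..<k] \<and> bit (y 1) a)"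
    proof (rule bit_fold_xor)
      fix j assume "bit (y j) a"
      then show "j = 1" by (cases "j = 1") (simp_all add: y_def)
    qed simp
    then show ?thesis using k by (simp add: y_def)
  qed
  then have "f_XOR (h + k) (map (bits_of (h + k)) (x # map y [1..<k]))"
    unfolding f_XOR_bits_of by simp
  moreover have "\<forall>j. y j = 0 \<or> y j = x" by (simp add: y_def)
  ultimately show ?thesis unfolding PrXOR prob_fun.simps adv.simps partner.simps
    by (intro exI[of _ y] conjI)
next
  case PrSUM
  define y where "y = (\<lambda>j::nat. if j = 1 then x else 0)"
  have xb: "x < 2 ^ (h + k)" using x by (rule less_le_trans) (intro power_increasing, auto)
  have "(\<Sum>j\<in>{1..<k}. y j + of_bool (j = 1)) = (\<Sum>j\<in>{1..<k}. if j = 1 then x + 1 else 0)"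
    by (intro sum.cong) (auto simp: y_def)
  also have "\<dots> = x + 1" using k by simp
  finally have "sum_list ((2 ^ (h + k) - 1 - x) # map (\<lambda>j. y j + of_bool (j = 1)) [1..<k]) = 2 ^ (h + k) - 1 - x + (x + 1)"
    by (simp add: interv_sum_list_conv_sum_set_nat)
  also have "\<dots> = 2 ^ (h + k)" using xb by linarith
  finally have s: "sum_list ((2 ^ (h + k) - 1 - x) # map (\<lambda>j. y j + of_bool (j = 1)) [1..<k]) mod 2 ^ (h + k) = 0" by simp
  have "c < 2 ^ (h + k)" if "c \<in> set ((2 ^ (h + k) - 1 - x) # map (\<lambda>j. y j + of_bool (j = 1)) [1..<k])" for c
  proof -
    have yx: "y j < 2 ^ h" for j using x by (simp add: y_def)
    have "c = adv PrSUM h (h + k) x \<or> (\<exists>j\<in>{1..<k}. c = partner PrSUM h j (y j))" using that by auto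
    then show ?thesis using adv_bounds(1)[OF k x] adv_bounds(3)[OF k yx] by blast
  qed
  note lt = this
  have "f_SUM (h + k) (map (bits_of (h + k)) ((2 ^ (h + k) - 1 - x) # map (\<lambda>j. y j + of_bool (j = 1)) [1..<k])) \<longleftrightarrow>
      sum_list ((2 ^ (h + k) - 1 - x) # map (\<lambda>j. y j + of_bool (j = 1)) [1..<k]) mod 2 ^ (h + k) = 0"
    by (rule f_SUM_bits_of) (erule lt)
  from iffD2[OF this s]
  have "f_SUM (h + k) (map (bits_of (h + k)) ((2 ^ (h + k) - 1 - x) # map (\<lambda>j. y j + of_bool (j = 1)) [1..<k]))" .
  moreover have "\<forall>j. y j = 0 \<or> y j = x" by (simp add: y_def)
  ultimately show ?thesis unfolding PrSUM prob_fun.simps adv.simps partner.simps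
    by (intro exI[of _ y] conjI)
qed

text \<open>For \<open>OV\<close> and \<open>XOR\<close> bit \<open>h\<close> decides.
  \<open>SUM\<close> is the reason for the \<open>k\<close> additional bits: \<open>k - 1\<close>
  numbers below \<open>2 ^ h\<close> add up to less than \<open>2 ^ (h + k - 1)\<close>, too little
  to lift \<open>adv_alt\<close> to \<open>2 ^ (h + k)\<close>.\<close>

lemma adv_miss:
  assumes k: "2 \<le> k" and x: "x < 2 ^ h" and y: "\<And>j. j \<in> {1..<k} \<Longrightarrow> y j < 2 ^ h"
  shows "\<not> prob_fun prob (h + k)
     (map (bits_of (h + k)) (adv_alt prob h (h + k) x # map (\<lambda>j. partner prob h j (y j)) [1..<k]))"
proof (cases prob)
  case PrOV
  have b: "bit (z + 2 ^ h * 1) h" if "z < 2 ^ h" for z :: nat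
    using that by (simp only: bit_concat) (simp add: bit_0)
  have "bit c h" if "c \<in> set ((x + 2 ^ h * 1) # map (\<lambda>j. y j + 2 ^ h * 1) [1..<k])" for c
  proof -
    have "c = x + 2 ^ h * 1 \<or> (\<exists>j\<in>{1..<k}. c = y j + 2 ^ h * 1)" using that by auto
    then show ?thesis using b[OF x] b[OF y] by blast
  qed
  moreover have "h < h + k" using k by simp
  ultimately show ?thesis unfolding PrOV prob_fun.simps f_OV_bits_of adv_alt.simps partner.simps by blast
next
  case PrXOR
  have b: "bit (x + 2 ^ h * 1) h" using x by (simp only: bit_concat) (simp add: bit_0)
  have y0: "\<not> bit (y j) h" if "j \<in> {1..<k}" for j using y[OF that] by (simp add: nat_less_exp_iff)
  have "bit (fold xor (map y [1..<k]) (x + 2 ^ h * 1)) h \<longleftrightarrow>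
      bit (x + 2 ^ h * 1) h \<noteq> (0 \<in> set [1..<k] \<and> bit (y 0) h)"
    by (rule bit_fold_xor) (use y0 in auto)
  then have "bit (fold xor (map y [1..<k]) (x + 2 ^ h * 1)) h" using b by simp
  moreover have "fold xor ((x + 2 ^ h * 1) # map y [1..<k]) 0 = fold xor (map y [1..<k]) (x + 2 ^ h * 1)" by simp
  moreover have "h < h + k" using k by simp
  ultimately show ?thesis unfolding PrXOR prob_fun.simps adv_alt.simps partner.simps f_XOR_bits_of by metis
next
  case PrSUM
  let ?c = "2 ^ (h + k - 1) - 1 - x"
  have k1: "h + k - 1 = h + (k - 1)" using k by simp
  have kk: "k - 1 < 2 ^ (k - 1)" by simp
  have "(\<Sum>j\<in>{1..<k}. y j) \<le> (\<Sum>j\<in>{1..<k}. 2 ^ h - 1)" using y by (intro sum_mono) (simp add: Suc_leI less_Suc_eq_le[symmetric])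
  also have "\<dots> = (k - 1) * (2 ^ h - 1)" by simp
  also have "\<dots> \<le> (k - 1) * 2 ^ h" by (intro mult_left_mono) auto
  also have "\<dots> < 2 ^ (k - 1) * 2 ^ h" by (intro mult_strict_right_mono kk) simp
  also have "\<dots> = 2 ^ (h + k - 1)" unfolding k1 by (simp add: power_add)
  finally have S: "(\<Sum>j\<in>{1..<k}. y j) < 2 ^ (h + k - 1)" .
  have xb: "x < 2 ^ (h + k - 1)" using x by (rule less_le_trans) (use k in \<open>intro power_increasing, auto\<close>)
  have "(\<Sum>j\<in>{1..<k}. of_bool (j = 1) :: nat) = 1"
  proof -
    have "(\<Sum>j\<in>{1..<k}. of_bool (j = 1) :: nat) = (\<Sum>j\<in>{1..<k}. if j = 1 then 1 else 0)" by (intro sum.cong) auto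
    then show ?thesis using k by simp
  qed
  then have s: "sum_list (?c # map (\<lambda>j. y j + of_bool (j = 1)) [1..<k]) = ?c + ((\<Sum>j\<in>{1..<k}. y j) + 1)"
    by (simp add: interv_sum_list_conv_sum_set_nat sum.distrib)
  have "2 * 2 ^ (h + k - 1) = (2::nat) ^ (h + k)" using k by (cases k) simp_all
  then have "?c + ((\<Sum>j\<in>{1..<k}. y j) + 1) < 2 ^ (h + k)" using S xb by linarith
  then have m: "sum_list (?c # map (\<lambda>j. y j + of_bool (j = 1)) [1..<k]) mod 2 ^ (h + k) \<noteq> 0"
    unfolding s by (simp only: mod_less)
  have "c < 2 ^ (h + k)" if "c \<in> set (?c # map (\<lambda>j. y j + of_bool (j = 1)) [1..<k])" for c
  proof -
    have "c = adv_alt PrSUM h (h + k) x \<or> (\<exists>j\<in>{1..<k}. c = partner PrSUM h j (y j))" using that by auto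
    then show ?thesis using adv_bounds(2)[OF k x] adv_bounds(3)[OF k y] by blast
  qed
  note lt = this
  have "f_SUM (h + k) (map (bits_of (h + k)) (?c # map (\<lambda>j. y j + of_bool (j = 1)) [1..<k])) \<longleftrightarrow>
      sum_list (?c # map (\<lambda>j. y j + of_bool (j = 1)) [1..<k]) mod 2 ^ (h + k) = 0"
    by (rule f_SUM_bits_of) (erule lt)
  from iffD1[OF this] m have "\<not> f_SUM (h + k) (map (bits_of (h + k)) (?c # map (\<lambda>j. y j + of_bool (j = 1)) [1..<k]))"
    by (rule contrapos_nn[rotated])
  then show ?thesis unfolding PrSUM prob_fun.simps adv_alt.simps partner.simps .
qed

text \<open>The first \<open>2 ^ (h - 1)\<close> entries are the cells under attack; the remaining ones spell out \<open>i\<close>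
  in binary and make the vectors distinct.\<close>

definition elems :: "nat \<Rightarrow> nat \<Rightarrow> nat list" where
  "elems h i = [0..<2 ^ (h - 1)] @ map (\<lambda>c. 2 ^ (h - 1) + 2 * c + of_bool (bit i c)) [0..<2 ^ (h - 2)]"

lemma length_elems: "length (elems h i) = 2 ^ (h - 1) + 2 ^ (h - 2)"
  by (simp only: elems_def length_append length_map length_upt diff_zero)

lemma elems_nth: "x < 2 ^ (h - 1) \<Longrightarrow> elems h i ! x = x"
  unfolding elems_def by (subst nth_append) (simp only: length_upt diff_zero if_True nth_upt add_0)

lemma elems_less:
  assumes "2 \<le> h" "x \<in> set (elems h i)"
  shows "x < 2 ^ h"
proof -
  define g where "g = h - 2"
  have h: "h = Suc (Suc g)" using assms(1) by (simp add: g_def)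
  have "2 ^ (h - 1) + 2 * c + of_bool (bit i c) < 2 ^ h" if "c < 2 ^ (h - 2)" for c
    using that by (simp add: h of_bool_def)
  then show ?thesis using assms(2) h by (auto simp: elems_def)
qed

lemma distinct_elems: "distinct (elems h i)"
proof -
  have inj: "inj_on (\<lambda>c. 2 ^ (h - 1) + 2 * c + of_bool (bit i c)) (set [0..<2 ^ (h - 2)])"
  proof (rule inj_onI)
    fix x y assume "2 ^ (h - 1) + 2 * x + of_bool (bit i x) = 2 ^ (h - 1) + 2 * y + of_bool (bit i y)"
    then have "(2 * x + of_bool (bit i x)) div 2 = (2 * y + of_bool (bit i y)) div 2" by simp
    moreover have "(2 * z + of_bool P) div 2 = z" for z :: nat and P by (cases P) simp_all
    ultimately show "x = y" by metis
  qed
  have dis: "set [0..<2 ^ (h - 1)] \<inter> (\<lambda>c. 2 ^ (h - 1) + 2 * c + of_bool (bit i c)) ` set [0..<2 ^ (h - 2)] = {}"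
    by (rule equals0I) (auto simp del: upt_Suc)
  show ?thesis unfolding elems_def distinct_append distinct_map set_map
    by (intro conjI distinct_upt inj dis)
qed

text \<open>Bit \<open>c\<close> of \<open>i\<close> is one iff the entry with the odd offset
  \<open>2 * c + 1\<close> is present. There are \<open>2 ^ (h - 2)\<close> such bits, whence the
  doubly exponential range.\<close>

lemma elems_inj:
  assumes "i < 2 ^ 2 ^ (h - 2)" "i' < 2 ^ 2 ^ (h - 2)" "set (elems h i) = set (elems h i')"
  shows "i = i'"
proof (rule bit_eqI)
  fix c
  have *: "bit i' c" if "bit i c" "i < 2 ^ 2 ^ (h - 2)" "set (elems h i) = set (elems h i')" for i i' :: nat
  proof -
    have c: "c < 2 ^ (h - 2)" using that(1,2) by (meson nat_less_exp_iff not_le)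
    have "2 ^ (h - 1) + 2 * c + 1 \<in> (\<lambda>c. 2 ^ (h - 1) + 2 * c + of_bool (bit i c)) ` {0..<2 ^ (h - 2)}"
      by (rule image_eqI[of _ _ c]) (use that(1) c in simp_all)
    then have "2 ^ (h - 1) + 2 * c + 1 \<in> set (elems h i)" unfolding elems_def set_append set_map set_upt by blast
    then have "2 ^ (h - 1) + 2 * c + 1 \<in> set (elems h i')" using that(3) by simp
    then obtain c' where "2 ^ (h - 1) + 2 * c + 1 = 2 ^ (h - 1) + 2 * c' + of_bool (bit i' c')"
      by (auto simp: elems_def)
    then have e: "2 * c + 1 = 2 * c' + of_bool (bit i' c')" by simp
    show ?thesis
    proof (cases "bit i' c'")
      case True
      then show ?thesis using e by simp
    next
      case False
      then have "2 * c + 1 = 2 * c'" using e by simp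
      then have False by presburger
      then show ?thesis ..
    qed
  qed
  show "bit i c = bit i' c" using *[of i i'] *[of i' i] assms by auto
qed

lemma sum_set_Cons:
  assumes "finite A" "finite B"
  shows "(\<Sum>l\<in>set_Cons A B. F l) = (\<Sum>a\<in>A. \<Sum>l\<in>B. F (a # l))"
proof -
  have "set_Cons A B = (\<lambda>(a, l). a # l) ` (A \<times> B)" unfolding set_Cons_def by auto
  moreover have "inj_on (\<lambda>(a, l). a # l) (A \<times> B)" by (rule inj_onI) auto
  ultimately have "(\<Sum>l\<in>set_Cons A B. F l) = (\<Sum>p\<in>A \<times> B. F (fst p # snd p))"
    by (simp add: sum.reindex case_prod_unfold)
  also have "\<dots> = (\<Sum>a\<in>A. \<Sum>l\<in>B. F (a # l))" by (simp add: sum.cartesian_product case_prod_unfold)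
  finally show ?thesis .
qed

text \<open>With one component per vector the product has a single factor, and the count becomes
  additive in the words of the first set; this is the contribution of one occurrence of
  \<open>w\<close>.\<close>

definition weight :: "(bits list \<Rightarrow> bool) \<Rightarrow> fvec set list \<Rightarrow> bits \<Rightarrow> nat" where
  "weight f rest w = (\<Sum>vs\<in>listset rest. \<Sum>ws\<in>listset (map (\<lambda>v. v ! 0) vs). of_bool (f (w # ws)))"

lemma factored_count_Cons:
  assumes "V \<subseteq> fvecs 1 b" "finite V" "\<And>W. W \<in> set rest \<Longrightarrow> W \<subseteq> fvecs 1 b \<and> finite W"
  shows "factored_count f 1 (V # rest) = (\<Sum>v\<in>V. \<Sum>w\<in>v ! 0. weight f rest w)"
proof -
  have fin: "finite (v ! 0)" if "v \<in> fvecs 1 b" for v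
  proof (rule finite_words[of _ b])
    have "v ! 0 \<in> set v" using fvecs_dim[OF that] by simp
    then show "length w = b" if "w \<in> v ! 0" for w using fvecs_length[OF \<open>v \<in> fvecs 1 b\<close>] that by blast
  qed
  have fr: "finite (listset rest)" using assms(3) by (intro finite_listset) blast
  have fw: "finite (listset (map (\<lambda>v. v ! 0) vs))" if "vs \<in> listset rest" for vs
  proof (rule finite_listset)
    fix A assume "A \<in> set (map (\<lambda>v. v ! 0) vs)"
    then obtain i where i: "i < length vs" "A = vs ! i ! 0" by (auto simp: in_set_conv_nth)
    have "i < length rest" "vs ! i \<in> rest ! i" using that i(1) by (simp_all add: in_listset_iff)
    then have "vs ! i \<in> fvecs 1 b" using assms(3)[OF nth_mem] by blast
    then show "finite A" using fin i(2) by simp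
  qed
  have "factored_count f 1 (V # rest) =
    (\<Sum>v\<in>V. \<Sum>vs\<in>listset rest. \<Sum>ws\<in>set_Cons (v ! 0) (listset (map (\<lambda>v. v ! 0) vs)). of_bool (f ws))"
    unfolding factored_count_def by (simp add: sum_set_Cons[OF assms(2) fr])
  also have "\<dots> = (\<Sum>v\<in>V. \<Sum>vs\<in>listset rest. \<Sum>w\<in>v ! 0. \<Sum>ws\<in>listset (map (\<lambda>v. v ! 0) vs). of_bool (f (w # ws)))"
  proof (rule sum.cong[OF refl], rule sum.cong[OF refl])
    fix v vs assume "v \<in> V" "vs \<in> listset rest"
    then show "(\<Sum>ws\<in>set_Cons (v ! 0) (listset (map (\<lambda>v. v ! 0) vs)). of_bool (f ws)) =
      (\<Sum>w\<in>v ! 0. \<Sum>ws\<in>listset (map (\<lambda>v. v ! 0) vs). of_bool (f (w # ws)) :: nat)"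
      using assms(1) by (intro sum_set_Cons fin fw) auto
  qed
  also have "\<dots> = (\<Sum>v\<in>V. \<Sum>w\<in>v ! 0. weight f rest w)"
    unfolding weight_def by (rule sum.cong[OF refl], rule sum.swap)
  finally show ?thesis .
qed

definition adv_vec :: "nat \<Rightarrow> nat list \<Rightarrow> fvec" where
  "adv_vec b L = [bits_of b ` set L]"

definition adv_set :: "nat \<Rightarrow> nat \<Rightarrow> (nat \<Rightarrow> nat list) \<Rightarrow> fvec set" where
  "adv_set b n A = (\<lambda>i. adv_vec b (A i)) ` {..<n}"

definition adv_enc :: "nat \<Rightarrow> (nat \<Rightarrow> nat list) \<Rightarrow> nat list" where
  "adv_enc n A = concat (map (\<lambda>i. enc_list (A i)) [0..<n])"

definition adv_ok :: "nat \<Rightarrow> nat \<Rightarrow> (nat \<Rightarrow> nat list) \<Rightarrow> bool" where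
  "adv_ok b n A \<longleftrightarrow> (\<forall>i<n. distinct (A i) \<and> (\<forall>x\<in>set (A i). x < 2 ^ b)) \<and>
     (\<forall>i<n. \<forall>i'<n. set (A i) = set (A i') \<longrightarrow> i = i')"

lemma bits_of_image_inj:
  assumes "\<And>x. x \<in> X \<Longrightarrow> x < 2 ^ b" "\<And>x. x \<in> Y \<Longrightarrow> x < 2 ^ b" "bits_of b ` X = bits_of b ` Y"
  shows "X = Y"
proof -
  have "inj_on (bits_of b) {..<2 ^ b}" by (rule inj_onI) (simp add: bits_of_inj)
  moreover have "X \<subseteq> {..<2 ^ b}" "Y \<subseteq> {..<2 ^ b}" using assms(1,2) by blast+
  ultimately show ?thesis using inj_on_image_eq_iff assms(3) by blast
qed

lemma adv_vec_inj:
  assumes "adv_ok b n A"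
  shows "inj_on (\<lambda>i. adv_vec b (A i)) {..<n}"
proof (rule inj_onI)
  fix i i' assume i: "i \<in> {..<n}" "i' \<in> {..<n}" and eq: "adv_vec b (A i) = adv_vec b (A i')"
  have "bits_of b ` set (A i) = bits_of b ` set (A i')" using eq by (simp add: adv_vec_def)
  then have "set (A i) = set (A i')" using assms i unfolding adv_ok_def by (intro bits_of_image_inj[of _ b]) blast+
  then show "i = i'" using assms i unfolding adv_ok_def by blast
qed

lemma adv_set_props:
  assumes "adv_ok b n A"
  shows "adv_set b n A \<subseteq> fvecs 1 b" "card (adv_set b n A) = n" "finite (adv_set b n A)"
    "enc_fvec_set (adv_set b n A) (adv_enc n A)"
proof -
  show "adv_set b n A \<subseteq> fvecs 1 b" by (auto simp: adv_set_def adv_vec_def fvecs_def)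
  show "card (adv_set b n A) = n" using adv_vec_inj[OF assms] by (simp add: adv_set_def card_image)
  show "finite (adv_set b n A)" by (simp add: adv_set_def)
  have enc: "enc_fvec (adv_vec b (A i)) (enc_list (A i))" if "i < n" for i
  proof -
    have lt: "\<And>x. x \<in> set (A i) \<Longrightarrow> x < 2 ^ b" and d: "distinct (A i)" using assms that by (simp_all add: adv_ok_def)
    have "inj_on (bits_of b) (set (A i))" by (rule inj_onI, rule bits_of_inj) (erule lt, erule lt, assumption)
    moreover have "map bits_val (map (bits_of b) (A i)) = A i" using lt by (simp add: map_idI bits_val_bits_of_less)
    ultimately have "enc_bits_set (bits_of b ` set (A i)) (enc_list (A i))"
      unfolding enc_bits_set_def using d
      by (intro exI[of _ "map (bits_of b) (A i)"]) (simp add: distinct_map enc_list_def)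
    then show ?thesis unfolding enc_fvec_def adv_vec_def by (intro exI[of _ "[enc_list (A i)]"]) simp
  qed
  have "distinct (map (\<lambda>i. adv_vec b (A i)) [0..<n])"
    unfolding distinct_map set_upt using adv_vec_inj[OF assms] by (simp add: atLeast0LessThan)
  moreover have "set (map (\<lambda>i. adv_vec b (A i)) [0..<n]) = adv_set b n A" by (simp add: adv_set_def atLeast0LessThan)
  moreover have "list_all2 enc_fvec (map (\<lambda>i. adv_vec b (A i)) [0..<n]) (map (\<lambda>i. enc_list (A i)) [0..<n])"
    using enc by (simp add: list_all2_conv_all_nth)
  ultimately show "enc_fvec_set (adv_set b n A) (adv_enc n A)"
    unfolding enc_fvec_set_def adv_enc_def by blast
qed

lemma count_adv:
  assumes "adv_ok b n A" "\<And>W. W \<in> set rest \<Longrightarrow> W \<subseteq> fvecs 1 b \<and> finite W"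
  shows "factored_count f 1 (adv_set b n A # rest) = (\<Sum>i<n. \<Sum>c\<in>set (A i). weight f rest (bits_of b c))"
proof -
  have "factored_count f 1 (adv_set b n A # rest) = (\<Sum>v\<in>adv_set b n A. \<Sum>w\<in>v ! 0. weight f rest w)"
    using adv_set_props[OF assms(1)] assms(2) by (intro factored_count_Cons)
  also have "\<dots> = (\<Sum>i<n. \<Sum>w\<in>adv_vec b (A i) ! 0. weight f rest w)"
    unfolding adv_set_def by (simp add: sum.reindex[OF adv_vec_inj[OF assms(1)]])
  also have "\<dots> = (\<Sum>i<n. \<Sum>c\<in>set (A i). weight f rest (bits_of b c))"
  proof (rule sum.cong[OF refl])
    fix i assume "i \<in> {..<n}"
    then have "inj_on (bits_of b) (set (A i))"
      using assms(1) unfolding adv_ok_def by (intro inj_onI) (blast intro: bits_of_inj)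
    then show "(\<Sum>w\<in>adv_vec b (A i) ! 0. weight f rest w) = (\<Sum>c\<in>set (A i). weight f rest (bits_of b c))"
      by (simp add: adv_vec_def sum.reindex)
  qed
  finally show ?thesis .
qed

section \<open>Outputs and cells that are never read\<close>

lemma result_in_bits:
  assumes "result_in M x"
  shows "x < 2 ^ M 0" "\<And>i. i < M 0 \<Longrightarrow> M (Suc i) = of_bool (bit x i)"
proof -
  have "x < 2 ^ (LEAST l. x < 2 ^ l)" by (rule LeastI[of _ x]) simp
  then show "x < 2 ^ M 0" using assms by (simp add: result_in_def)
  show "\<And>i. i < M 0 \<Longrightarrow> M (Suc i) = of_bool (bit x i)" using assms by (simp add: result_in_def)
qed

lemma result_in_unique:
  assumes "result_in M x" "result_in M' y" "M 0 = M' 0" "\<And>i. i < M 0 \<Longrightarrow> M (Suc i) = M' (Suc i)"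
  shows "x = y"
proof (rule bit_eqI)
  fix i
  show "bit x i = bit y i"
  proof (cases "i < M 0")
    case True
    then have "of_bool (bit x i) = (of_bool (bit y i) :: nat)"
      using result_in_bits(2)[OF assms(1), of i] result_in_bits(2)[OF assms(2), of i] assms(3,4) by simp
    then show ?thesis by (cases "bit x i"; cases "bit y i") simp_all
  next
    case False
    then show ?thesis
      using result_in_bits(1)[OF assms(1)] result_in_bits(1)[OF assms(2)] assms(3) by (simp add: nat_less_exp_iff)
  qed
qed

text \<open>A cell that can be overwritten so that the answer changes has to be loaded: it cannot be part
  of the output either, since its value is not a bit.\<close>

lemma unread_cell:
  assumes run: "exec w P (initial X) t (R, M)" "result_in M x"
    and ins: "insensitive w P (initial X) t (R, M) c"
    and c: "0 < c" "c < length X" "X ! c \<ge> 2"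
    and run': "exec w P (initial (X[c := v])) t' (R', M')" "result_in M' y"
  shows "x = y"
proof -
  have init: "initial (X[c := v]) = (fst (initial X), (snd (initial X))(c := v))"
    using c(2) by (auto simp: initial_def fun_eq_iff nth_list_update)
  from ins[unfolded insensitive_def, rule_format, of v]
  consider "exec w P (initial (X[c := v])) t (R, M)" |
    "M c = X ! c" "exec w P (initial (X[c := v])) t (R, M(c := v))"
    unfolding init using c(2) by (auto simp: initial_def)
  then show ?thesis
  proof cases
    case 1
    then have "M' = M" using exec_deterministic run'(1) by blast
    then show ?thesis using result_in_unique[OF run(2) run'(2)] by simp
  next
    case 2
    then have M': "M' = M(c := v)" using exec_deterministic run'(1) by blast
    have ne: "Suc i \<noteq> c" if "i < M 0" for i
    proof
      assume "Suc i = c"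
      then have "M c = of_bool (bit x i)" using result_in_bits(2)[OF run(2) that] by simp
      then show False using 2(1) c(3) by (cases "bit x i") simp_all
    qed
    \<comment> \<open>Cell \<open>0\<close> holds the number of digits and need not contain a bit;
      it is excluded by \<open>0 < c\<close>.\<close>
    show ?thesis
      by (rule result_in_unique[OF run(2) run'(2)]) (use c(1) ne M' in auto)
  qed
qed

text \<open>All lists have the same length \<open>s\<close>, so entry \<open>x\<close> of vector
  \<open>i\<close> has a fixed address; the first \<open>Suc\<close> counts the length cell of each
  list, the second skips that of vector \<open>i\<close>.\<close>

lemma concat_update:
  assumes "i < n" "x < length (A i)" "\<And>i. i < n \<Longrightarrow> length (A i) = s"
  shows "adv_enc n (A(i := (A i)[x := v])) = (adv_enc n A)[i * Suc s + Suc x := v]"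
    "adv_enc n A ! (i * Suc s + Suc x) = A i ! x" "length (adv_enc n A) = n * Suc s"
proof -
  let ?f = "\<lambda>i. enc_list (A i)"
  have len: "length (concat (map ?f [0..<m])) = m * Suc s" if "m \<le> n" for m
    using that assms(3) by (induction m) (simp_all add: enc_list_def)
  show "length (adv_enc n A) = n * Suc s" using len[of n] by (simp add: adv_enc_def)
  have "[0..<n] = [0..<i] @ [i..<n]" using upt_add_eq_append[of 0 i "n - i"] assms(1) by simp
  then have split: "[0..<n] = [0..<i] @ i # [Suc i..<n]" by (simp only: upt_conv_Cons[OF assms(1)])
  have e: "adv_enc n A = concat (map ?f [0..<i]) @ enc_list (A i) @ concat (map ?f [Suc i..<n])"
    unfolding adv_enc_def by (subst split) simp
  have e': "adv_enc n (A(i := (A i)[x := v])) =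
      concat (map ?f [0..<i]) @ enc_list ((A i)[x := v]) @ concat (map ?f [Suc i..<n])"
  proof -
    let ?g = "\<lambda>j. enc_list ((A(i := (A i)[x := v])) j)"
    have "map ?g [0..<i] = map ?f [0..<i]" "map ?g [Suc i..<n] = map ?f [Suc i..<n]" by (rule map_cong; simp)+
    moreover have "?g i = enc_list ((A i)[x := v])" by simp
    ultimately show ?thesis by (simp only: adv_enc_def split map_append list.map concat_append concat.simps)
  qed
  have l: "length (concat (map ?f [0..<i])) = i * Suc s" using len[of i] assms(1) by simp
  have gen: "(p @ q @ r)[length p + m := v] = p @ q[m := v] @ r" "(p @ q @ r) ! (length p + m) = q ! m"
    if "m < length q" for p q r :: "nat list" and m
    using that by (simp_all add: list_update_append nth_append)
  have el: "enc_list ((A i)[x := v]) = (enc_list (A i))[Suc x := v]" by (simp add: enc_list_def)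
  have sx: "Suc x < length (enc_list (A i))" using assms(2) by (simp add: enc_list_def)
  show "adv_enc n (A(i := (A i)[x := v])) = (adv_enc n A)[i * Suc s + Suc x := v]"
    unfolding e e' el l[symmetric] by (rule gen(1)[OF sx, symmetric])
  show "adv_enc n A ! (i * Suc s + Suc x) = A i ! x"
    unfolding e l[symmetric] gen(2)[OF sx] by (simp add: enc_list_def)
qed

lemma adv_ok_map:
  assumes "2 \<le> h" "n \<le> 2 ^ 2 ^ (h - 2)" "\<And>x. x < 2 ^ h \<Longrightarrow> F x < 2 ^ b"
    "\<And>x y. x < 2 ^ h \<Longrightarrow> y < 2 ^ h \<Longrightarrow> F x = F y \<Longrightarrow> x = y"
  shows "adv_ok b n (\<lambda>i. map F (elems h i))"
proof -
  have inj: "inj_on F {..<2 ^ h}" by (rule inj_onI) (use assms(4) in simp)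
  have sub: "set (elems h i) \<subseteq> {..<2 ^ h}" for i using elems_less[OF assms(1)] by blast
  have "distinct (map F (elems h i))" for i
    unfolding distinct_map using distinct_elems inj_on_subset[OF inj sub] by blast
  moreover have "x < 2 ^ b" if "x \<in> set (map F (elems h i))" for x i
    using that assms(3) sub by (simp only: set_map) blast
  moreover have "i = i'" if "i < n" "i' < n" "set (map F (elems h i)) = set (map F (elems h i'))" for i i'
  proof (rule elems_inj)
    show "i < 2 ^ 2 ^ (h - 2)" "i' < 2 ^ 2 ^ (h - 2)" using that assms(2) by linarith+
    show "set (elems h i) = set (elems h i')"
      using that(3) inj_on_image_eq_iff[OF inj sub sub] by (simp only: set_map)
  qed
  ultimately show ?thesis unfolding adv_ok_def by blast
qed

lemma finite_adv_components:
  assumes "\<And>W. W \<in> set rest \<Longrightarrow> W \<subseteq> fvecs 1 b" "vs \<in> listset rest"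
  shows "finite (listset (map (\<lambda>v. v ! 0) vs))"
proof (rule finite_listset)
  fix A assume "A \<in> set (map (\<lambda>v. v ! 0) vs)"
  then obtain i where i: "i < length vs" "A = vs ! i ! 0" by (auto simp: in_set_conv_nth)
  have "i < length rest" "vs ! i \<in> rest ! i" using assms(2) i(1) by (simp_all add: in_listset_iff)
  then have v: "vs ! i \<in> fvecs 1 b" using assms(1)[OF nth_mem] by blast
  have "vs ! i ! 0 \<in> set (vs ! i)" using fvecs_dim[OF v] by simp
  then have "\<And>w. w \<in> A \<Longrightarrow> length w = b" using fvecs_length[OF v] i(2) by blast
  then show "finite A" by (rule finite_words)
qed

text \<open>If an attacked cell stays unread, \<open>adv_alt\<close> can be put there without the
  solver noticing, although a word of positive weight is exchanged for one of weight
  \<open>0\<close>. So each of the \<open>n * (2 ^ (h - 1) - 2)\<close> attacked cells costs at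
  least one step.\<close>

lemma lower_bound:
  assumes k: "2 \<le> k" and h: "3 \<le> h" and n: "n \<le> 2 ^ 2 ^ (h - 2)"
    and solver: "\<And>Vs xs. fk_instance k n 1 (h + k) Vs \<Longrightarrow> enc_instance Vs xs \<Longrightarrow>
      computes_within w P ([n, 1, h + k] @ xs) t (factored_count (prob_fun prob (h + k)) 1 Vs)"
  shows "n * (2 ^ (h - 1) - 2) \<le> t"
proof (rule ccontr)
  assume neg: "\<not> n * (2 ^ (h - 1) - 2) \<le> t"
  let ?b = "h + k" and ?f = "prob_fun prob (h + k)" and ?m = "2 ^ (h - 1) :: nat"
  define s where "s = 2 ^ (h - 1) + (2::nat) ^ (h - 2)"
  define A where "A = (\<lambda>i. map (adv prob h ?b) (elems h i))"
  define W where "W = (\<lambda>j i. map (partner prob h j) (elems h i))"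
  define rest where "rest = map (\<lambda>j. adv_set ?b n (W j)) [1..<k]"
  define renc where "renc = concat (map (\<lambda>j. adv_enc n (W j)) [1..<k])"
  have h2: "2 \<le> h" using h by simp
  have n0: "0 < n" using neg by (cases n) auto
  have okA: "adv_ok ?b n A" unfolding A_def
    by (rule adv_ok_map[OF h2 n]) (rule adv_bounds(1)[OF k], assumption, rule adv_inj(1)[OF k], assumption+)
  have okW: "adv_ok ?b n (W j)" for j unfolding W_def
    by (rule adv_ok_map[OF h2 n]) (rule adv_bounds(3)[OF k], assumption, rule partner_inj)
  have restW: "V \<subseteq> fvecs 1 ?b \<and> finite V" if "V \<in> set rest" for V
    using that adv_set_props(1,3)[OF okW] by (auto simp: rest_def)
  have nth_rest: "rest ! i = adv_set ?b n (W (Suc i))" if "i < k - 1" for i using that by (simp add: rest_def)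
  have len_rest: "length rest = k - 1" by (simp add: rest_def)
  have solve: "computes_within w P ([n, 1, ?b] @ adv_enc n C @ renc) t (factored_count ?f 1 (adv_set ?b n C # rest))"
    if ok: "adv_ok ?b n C" for C
  proof (rule solver)
    have "\<forall>V\<in>set rest. V \<subseteq> fvecs 1 ?b \<and> card V = n"
      using adv_set_props(1,2)[OF okW] by (auto simp: rest_def)
    then show "fk_instance k n 1 ?b (adv_set ?b n C # rest)"
      using adv_set_props(1,2)[OF ok] len_rest k by (simp add: fk_instance_def)
    have "list_all2 enc_fvec_set rest (map (\<lambda>j. adv_enc n (W j)) [1..<k])"
      unfolding rest_def using adv_set_props(4)[OF okW] by (simp add: list_all2_conv_all_nth)
    then have "list_all2 enc_fvec_set (adv_set ?b n C # rest) (adv_enc n C # map (\<lambda>j. adv_enc n (W j)) [1..<k])"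
      using adv_set_props(4)[OF ok] by simp
    then show "enc_instance (adv_set ?b n C # rest) (adv_enc n C @ renc)"
      unfolding enc_instance_def renc_def by (intro exI conjI) (assumption, simp)
  qed
  obtain t1 R M where run: "t1 \<le> t" "exec w P (initial ([n, 1, ?b] @ adv_enc n A @ renc)) t1 (R, M)"
    "result_in M (factored_count ?f 1 (adv_set ?b n A # rest))"
    using solve[OF okA] unfolding computes_within_def by blast
  obtain Q where Q: "finite Q" "card Q \<le> t1"
    "\<And>c. c \<notin> Q \<Longrightarrow> insensitive w P (initial ([n, 1, ?b] @ adv_enc n A @ renc)) t1 (R, M) c"
    using exec_insensitive[OF run(2)] by blast
  \<comment> \<open>The offset \<open>3\<close> skips the cells for \<open>n\<close>, for the number
    \<open>1\<close> of components and for the word length.\<close>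
  let ?pos = "\<lambda>(i, x). 3 + (i * Suc s + Suc x)"
  let ?D = "{..<n} \<times> {2..<?m}"
  have "inj_on ?pos ?D"
  proof (rule inj_onI, clarify)
    fix i x i' x' assume x: "x \<in> {2..<?m}" "x' \<in> {2..<?m}" and eq: "3 + (i * Suc s + Suc x) = 3 + (i' * Suc s + Suc x')"
    have lt: "Suc x < Suc s" "Suc x' < Suc s" using x by (simp_all add: s_def)
    have "(Suc x + i * Suc s) div Suc s = (Suc x' + i' * Suc s) div Suc s"
      "(Suc x + i * Suc s) mod Suc s = (Suc x' + i' * Suc s) mod Suc s" using eq by (simp_all only: add.commute add_left_cancel)
    moreover have "(Suc z + c * Suc s) div Suc s = c" "(Suc z + c * Suc s) mod Suc s = Suc z" if "Suc z < Suc s" for z c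
      using that by (simp_all only: div_mult_self1 mod_mult_self1 div_less mod_less nat.simps not_False_eq_True add_0_right)
    ultimately have "i = i'" "Suc x = Suc x'" using lt by (simp_all only:)
    then show "i = i' \<and> x = x'" by simp
  qed
  then have "card (?pos ` ?D) = card ?D" by (rule card_image)
  also have "\<dots> = n * (?m - 2)" by (simp only: card_cartesian_product card_lessThan card_atLeastLessThan)
  finally have card: "card (?pos ` ?D) = n * (?m - 2)" .
  have "\<not> ?pos ` ?D \<subseteq> Q"
  proof
    assume "?pos ` ?D \<subseteq> Q"
    then have "card (?pos ` ?D) \<le> card Q" by (rule card_mono[OF Q(1)])
    then show False using card Q(2) run(1) neg by linarith
  qed
  then obtain p where p: "p \<in> ?D" "?pos p \<notin> Q" by blast
  obtain i x where "p = (i, x)" by (cases p)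
  then have ix: "i < n" "2 \<le> x" "x < ?m" "3 + (i * Suc s + Suc x) \<notin> Q" using p by simp_all
  define c where "c = 3 + (i * Suc s + Suc x)"
  define v where "v = adv_alt prob h ?b x"
  define A' where "A' = A(i := (A i)[x := v])"
  have "?m \<le> 2 ^ h" by (intro power_increasing) auto
  then have xh: "x < 2 ^ h" using ix(3) by linarith
  have lenA: "length (A j) = s" for j by (simp add: A_def length_elems s_def)
  have xs: "x < length (A i)" using ix(3) lenA by (simp add: s_def)
  have Aix: "A i ! x = adv prob h ?b x" using xs ix(3) by (simp add: A_def elems_nth)
  have v_notin: "v \<notin> set (A j)" for j
  proof
    assume "v \<in> set (A j)"
    then obtain z where "z \<in> set (elems h j)" "v = adv prob h ?b z" by (auto simp: A_def)
    then show False using adv_inj(2)[OF k elems_less[OF h2] xh, of z j prob] by (simp add: v_def)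
  qed
  have dA: "distinct (A j)" if "j < n" for j using okA that by (simp add: adv_ok_def)
  have setA': "set (A' i) = insert v (set (A i) - {A i ! x})"
    using set_update_distinct[OF dA[OF ix(1)] xs] by (simp add: A'_def)
  have A'_other: "A' j = A j" if "j \<noteq> i" for j using that by (simp add: A'_def)
  \<comment> \<open>The new word \<open>v\<close> occurs in no other vector, so vector
    \<open>i\<close> stays different from all others and the changed input is again legal.\<close>
  have okA': "adv_ok ?b n A'"
  proof -
    have d: "distinct (A' j)" if "j < n" for j
    proof (cases "j = i")
      case True
      then show ?thesis using distinct_list_update[OF dA[OF ix(1)], of v x] v_notin[of i] by (simp add: A'_def)
    qed (use dA that A'_other in simp)
    have l: "z < 2 ^ ?b" if "j < n" "z \<in> set (A' j)" for j z
    proof (cases "z = v")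
      case True
      then show ?thesis using adv_bounds(2)[OF k xh] by (simp add: v_def)
    next
      case False
      then have "z \<in> set (A j)" using that setA' A'_other by (cases "j = i") auto
      then show ?thesis using okA that(1) unfolding adv_ok_def by blast
    qed
    have e: "j = j'" if "j < n" "j' < n" "set (A' j) = set (A' j')" for j j'
    proof (rule ccontr)
      assume ne: "j \<noteq> j'"
      have vl: "v \<in> set (A' l) \<longleftrightarrow> l = i" for l using setA' A'_other v_notin by (cases "l = i") auto
      have "j \<noteq> i" using vl[of j] vl[of j'] that(3) ne by auto
      moreover have "j' \<noteq> i" using vl[of j] vl[of j'] that(3) ne by auto
      ultimately have "set (A j) = set (A j')" using that(3) A'_other by simp
      then show False using okA that(1,2) ne unfolding adv_ok_def by blast
    qed
    show ?thesis unfolding adv_ok_def using d l e by blast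
  qed
  let ?X = "[n, 1, ?b] @ adv_enc n A @ renc"
  note cu = concat_update[where A = A and i = i and n = n and x = x and s = s, OF ix(1) xs lenA]
  have idx: "i * Suc s + Suc x < length (adv_enc n A)"
  proof -
    have "i * Suc s + Suc x < Suc i * Suc s" using xs lenA by simp
    also have "\<dots> \<le> n * Suc s" using ix(1) by (intro mult_right_mono) auto
    finally show ?thesis using cu(3) by simp
  qed
  have shift: "([a1, a2, a3] @ E @ F) ! (3 + p) = E ! p" "3 + p < length ([a1, a2, a3] @ E @ F)"
    "([a1, a2, a3] @ E @ F)[3 + p := u] = [a1, a2, a3] @ E[p := u] @ F"
    if "p < length E" for a1 a2 a3 p u :: nat and E F
    using that by (simp_all add: nth_append list_update_append numeral_3_eq_3)
  have Xc: "?X ! c = adv prob h ?b x" "c < length ?X"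
    unfolding c_def using shift(2)[OF idx] by (simp_all only: shift(1)[OF idx] cu(2) Aix)
  have Xu: "?X[c := v] = [n, 1, ?b] @ adv_enc n A' @ renc"
    unfolding c_def A'_def cu(1) by (rule shift(3)[OF idx])
  obtain t2 R2 M2 where run': "exec w P (initial ([n, 1, ?b] @ adv_enc n A' @ renc)) t2 (R2, M2)"
    "result_in M2 (factored_count ?f 1 (adv_set ?b n A' # rest))"
    using solve[OF okA'] unfolding computes_within_def by blast
  have eq: "factored_count ?f 1 (adv_set ?b n A # rest) = factored_count ?f 1 (adv_set ?b n A' # rest)"
  proof (rule unread_cell[OF run(2,3)])
    show "insensitive w P (initial ?X) t1 (R, M) c" using Q(3) ix(4) by (simp add: c_def)
    show "0 < c" by (simp add: c_def)
    show "c < length ?X" by (rule Xc(2))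
    show "2 \<le> ?X ! c" unfolding Xc(1) by (rule adv_inj(3)[OF k xh xh ix(2)])
    show "exec w P (initial (?X[c := v])) t2 (R2, M2)" unfolding Xu by (rule run'(1))
    show "result_in M2 (factored_count ?f 1 (adv_set ?b n A' # rest))" by (rule run'(2))
  qed
  let ?wt = "\<lambda>z. weight ?f rest (bits_of ?b z)"
  have fin_rest: "finite (listset rest)" using restW by (intro finite_listset) blast
  have wt_v: "?wt v = 0"
    unfolding weight_def
  proof (rule sum.neutral, rule ballI, rule sum.neutral, rule ballI)
    fix vs ws assume vs: "vs \<in> listset rest" and ws: "ws \<in> listset (map (\<lambda>v. v ! 0) vs)"
    have lv: "length vs = k - 1" "\<And>l. l < k - 1 \<Longrightarrow> vs ! l \<in> adv_set ?b n (W (Suc l))"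
      using vs nth_rest len_rest by (auto simp: in_listset_iff)
    have lw: "length ws = k - 1" "\<And>l. l < k - 1 \<Longrightarrow> ws ! l \<in> vs ! l ! 0"
      using ws lv(1) by (auto simp: in_listset_iff)
    have "\<exists>y. l < k - 1 \<longrightarrow> y < 2 ^ h \<and> ws ! l = bits_of ?b (partner prob h (Suc l) y)" for l
    proof (cases "l < k - 1")
      case True
      obtain i' where "vs ! l = adv_vec ?b (W (Suc l) i')" using lv(2)[OF True] by (auto simp: adv_set_def)
      then have "ws ! l \<in> bits_of ?b ` set (W (Suc l) i')" using lw(2)[OF True] by (simp add: adv_vec_def)
      then obtain y where "y \<in> set (elems h i')" "ws ! l = bits_of ?b (partner prob h (Suc l) y)" by (auto simp: W_def)
      then show ?thesis using elems_less[OF h2] by blast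
    qed simp
    then have "\<forall>l. \<exists>y. l < k - 1 \<longrightarrow> y < 2 ^ h \<and> ws ! l = bits_of ?b (partner prob h (Suc l) y)" by blast
    from choice[OF this] obtain y where y: "\<forall>l. l < k - 1 \<longrightarrow> y l < 2 ^ h \<and> ws ! l = bits_of ?b (partner prob h (Suc l) (y l))" ..
    have "bits_of ?b v # ws = map (bits_of ?b) (adv_alt prob h ?b x # map (\<lambda>j. partner prob h j (y (j - 1))) [1..<k])"
    proof -
      have "ws = map (\<lambda>j. bits_of ?b (partner prob h j (y (j - 1)))) [1..<k]"
        by (rule nth_equalityI) (use lw(1) y in simp_all)
      then show ?thesis by (simp add: v_def comp_def)
    qed
    moreover have "\<not> ?f (map (bits_of ?b) (adv_alt prob h ?b x # map (\<lambda>j. partner prob h j (y (j - 1))) [1..<k]))"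
    proof (rule adv_miss[OF k xh])
      fix j assume "j \<in> {1..<k}"
      then have "j - 1 < k - 1" by auto
      then show "y (j - 1) < 2 ^ h" using y by blast
    qed
    ultimately show "of_bool (?f (bits_of ?b v # ws)) = (0::nat)" by (simp only: of_bool_eq(1))
  qed
  have wt_x: "?wt (A i ! x) \<noteq> 0"
  proof
    assume z: "?wt (A i ! x) = 0"
    obtain y where y: "\<forall>j. y j = 0 \<or> y j = x" "?f (map (bits_of ?b) (adv prob h ?b x # map (\<lambda>j. partner prob h j (y j)) [1..<k]))"
      using adv_hit[OF k xh, of prob] by blast
    \<comment> \<open>Both possible parameters are entries below \<open>2 ^ (h - 1)\<close>, which
      every vector contains; so vector \<open>0\<close> of each other set provides the
      partners.\<close>
    have ye: "y j \<in> set (elems h 0)" for j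
      using y(1)[rule_format, of j] ix(3) unfolding elems_def by auto
    let ?vs = "map (\<lambda>j. adv_vec ?b (W j 0)) [1..<k]" and ?ws = "map (\<lambda>j. bits_of ?b (partner prob h j (y j))) [1..<k]"
    have vs: "?vs \<in> listset rest"
      using n0 len_rest nth_rest by (auto simp: in_listset_iff adv_set_def)
    have ws: "?ws \<in> listset (map (\<lambda>v. v ! 0) ?vs)"
      using ye by (auto simp: in_listset_iff adv_vec_def W_def)
    have "(\<Sum>ws\<in>listset (map (\<lambda>v. v ! 0) ?vs). of_bool (?f (bits_of ?b (A i ! x) # ws)) :: nat) = 0"
      using z fin_rest vs unfolding weight_def by (simp only: sum_eq_0_iff)
    moreover have "finite (listset (map (\<lambda>v. v ! 0) ?vs))" using finite_adv_components[OF _ vs] restW by blast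
    ultimately have "of_bool (?f (bits_of ?b (A i ! x) # ?ws)) = (0::nat)" using ws by (simp only: sum_eq_0_iff)
    moreover have "?f (bits_of ?b (A i ! x) # ?ws)" using y(2) unfolding Aix by (simp add: comp_def)
    ultimately show False by simp
  qed
  have "(\<Sum>z\<in>set (A' i). ?wt z) < (\<Sum>z\<in>set (A i). ?wt z)"
  proof -
    have "(\<Sum>z\<in>set (A' i). ?wt z) = ?wt v + (\<Sum>z\<in>set (A i) - {A i ! x}. ?wt z)"
      unfolding setA' using v_notin by (intro sum.insert) auto
    moreover have "(\<Sum>z\<in>set (A i). ?wt z) = ?wt (A i ! x) + (\<Sum>z\<in>set (A i) - {A i ! x}. ?wt z)"
      using xs by (intro sum.remove) auto
    ultimately show ?thesis using wt_v wt_x by linarith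
  qed
  then have "(\<Sum>j<n. \<Sum>z\<in>set (A' j). ?wt z) < (\<Sum>j<n. \<Sum>z\<in>set (A j). ?wt z)"
    using A'_other ix(1) by (intro sum_strict_mono_ex1) (auto, metis less_imp_le order_refl)
  then show False using eq count_adv[OF okA restW] count_adv[OF okA' restW] by simp
qed

section \<open>The theorem\<close>

text \<open>The \<open>+ 2\<close> makes the inner logarithm at least \<open>1\<close>, so that the
  definition behaves well for every \<open>n\<close>. Words longer by this much suffice for
  \<open>n\<close> different vectors (\<open>loglog_ge\<close>) and are still admissible
  (\<open>loglog_small\<close>).\<close>

definition loglog :: "nat \<Rightarrow> nat" where
  "loglog n = nat \<lceil>log 2 (log 2 (real n + 2))\<rceil>"

definition bitlen :: "nat \<Rightarrow> nat" where
  "bitlen n = nat \<lceil>log 2 (real n + 1)\<rceil>"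

lemma bitlen_ge: "n + 1 \<le> 2 ^ bitlen n"
proof -
  have "log 2 (real n + 1) \<le> real (bitlen n)" unfolding bitlen_def by (rule real_nat_ceiling_ge)
  then have "real n + 1 \<le> 2 powr real (bitlen n)" by (subst (asm) log_le_iff) auto
  also have "\<dots> = real (2 ^ bitlen n)" by (simp add: powr_realpow)
  finally show ?thesis by linarith
qed

lemma loglog_ge: "n \<le> 2 ^ 2 ^ loglog n"
proof -
  have l: "1 \<le> log 2 (real n + 2)" by (subst le_log_iff) auto
  have "log 2 (log 2 (real n + 2)) \<le> real (loglog n)" unfolding loglog_def by (rule real_nat_ceiling_ge)
  then have "log 2 (real n + 2) \<le> 2 powr real (loglog n)" using l by (subst (asm) log_le_iff) auto
  also have "\<dots> = real (2 ^ loglog n)" by (simp add: powr_realpow)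
  finally have "real n + 2 \<le> 2 powr real (2 ^ loglog n)" by (subst (asm) log_le_iff) auto
  also have "\<dots> = 2 ^ (2 ^ loglog n)" by (rule powr_realpow) simp
  also have "\<dots> = real (2 ^ 2 ^ loglog n)" by (simp only: of_nat_power of_nat_numeral)
  finally show ?thesis by linarith
qed

lemma loglog_small: "(\<lambda>n. real (loglog n)) \<in> o(\<lambda>n. log 2 (real n))"
proof (rule landau_o.big_small_trans)
  show "(\<lambda>n. real (loglog n)) \<in> O(\<lambda>n. log 2 (log 2 (real n + 2)) + 1)"
  proof (rule bigoI[of _ 1], rule always_eventually, rule allI)
    fix n
    have "1 \<le> log 2 (real n + 2)" by (subst le_log_iff) auto
    then have "0 \<le> log 2 (log 2 (real n + 2))" by simp
    then have "real (loglog n) \<le> log 2 (log 2 (real n + 2)) + 1" unfolding loglog_def by linarith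
    then show "norm (real (loglog n)) \<le> 1 * norm (log 2 (log 2 (real n + 2)) + 1)" by simp
  qed
  show "(\<lambda>n. log 2 (log 2 (real n + 2)) + 1) \<in> o(\<lambda>n. log 2 (real n))" by real_asymp
qed

lemma bitlen_bigo: "(\<lambda>n. real (bitlen n)) \<in> O(\<lambda>n. log 2 (real n))"
proof (rule landau_o.big_trans)
  show "(\<lambda>n. real (bitlen n)) \<in> O(\<lambda>n. log 2 (real n + 1) + 1)"
  proof (rule bigoI[of _ 1], rule always_eventually, rule allI)
    fix n
    have "0 \<le> log 2 (real n + 1)" by simp
    then have "real (bitlen n) \<le> log 2 (real n + 1) + 1" unfolding bitlen_def by linarith
    then show "norm (real (bitlen n)) \<le> 1 * norm (log 2 (real n + 1) + 1)" by simp
  qed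
  show "(\<lambda>n. log 2 (real n + 1) + 1) \<in> O(\<lambda>n. log 2 (real n))" by real_asymp
qed

lemma const_small: "(\<lambda>n. c :: real) \<in> o(\<lambda>n. log 2 (real n))"
  by real_asymp

lemma admissible_small:
  assumes "admissible g b"
  shows "(\<lambda>n. real (g n)) \<in> o(\<lambda>n. log 2 (real n))" "(\<lambda>n. real (b n)) \<in> o(\<lambda>n. log 2 (real n))"
proof -
  have "(\<lambda>n. log 2 (real n) / log 2 (log 2 (real n))) \<in> O(\<lambda>n. log 2 (real n))" by real_asymp
  then show "(\<lambda>n. real (g n)) \<in> o(\<lambda>n. log 2 (real n))"
    using assms unfolding admissible_def by (blast intro: landau_o.small_big_trans)
  show "(\<lambda>n. real (b n)) \<in> o(\<lambda>n. log 2 (real n))" using assms by (simp add: admissible_def)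
qed

lemma width_le: "width prob k b \<le> 2 * (k * b) + 1"
  by (cases prob) simp_all

lemma admissible_width:
  assumes "admissible g b"
  shows "admissible g (\<lambda>n. width prob k (b n))"
proof -
  have "(\<lambda>n. real (2 * k) * real (b n) + 1) \<in> o(\<lambda>n. log 2 (real n))"
  proof (rule sum_in_smallo(1)[OF _ const_small])
    show "(\<lambda>n. real (2 * k) * real (b n)) \<in> o(\<lambda>n. log 2 (real n))"
      using admissible_small(2)[OF assms] by simp
  qed
  moreover have "(\<lambda>n. real (width prob k (b n))) \<in> O(\<lambda>n. real (2 * k) * real (b n) + 1)"
  proof (rule bigoI[of _ 1], rule always_eventually, rule allI)
    fix n
    have "real (width prob k (b n)) \<le> real (2 * (k * b n) + 1)" using width_le by (simp only: of_nat_le_iff)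
    then show "norm (real (width prob k (b n))) \<le> 1 * norm (real (2 * k) * real (b n) + 1)" by simp
  qed
  ultimately have "(\<lambda>n. real (width prob k (b n))) \<in> o(\<lambda>n. log 2 (real n))"
    by (rule landau_o.big_small_trans[rotated])
  then show ?thesis using assms by (simp add: admissible_def)
qed

lemma le_prod4:
  fixes p q r s :: nat
  assumes "1 \<le> p" "1 \<le> q" "1 \<le> r" "1 \<le> s"
  shows "p \<le> p * (q * (r * s))" "q \<le> p * (q * (r * s))" "r \<le> p * (q * (r * s))" "s \<le> p * (q * (r * s))"
proof -
  have l: "y \<le> x * y" "y \<le> y * x" if "1 \<le> x" for x y :: nat
    using mult_le_mono1[OF that, of y] mult_le_mono2[OF that, of y] by (simp_all only: mult_1_left mult_1_right)
  have 1: "s \<le> r * s" "r \<le> r * s" by (rule l, rule assms)+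
  have rs: "1 \<le> r * s" using 1 assms by linarith
  have 2: "r * s \<le> q * (r * s)" "q \<le> q * (r * s)" by (rule l(1)[OF assms(2)]) (rule l(2)[OF rs])
  have qrs: "1 \<le> q * (r * s)" using rs 2 by linarith
  have 3: "q * (r * s) \<le> p * (q * (r * s))" "p \<le> p * (q * (r * s))"
    by (rule l(1)[OF assms(1)]) (rule l(2)[OF qrs])
  show "p \<le> p * (q * (r * s))" "q \<le> p * (q * (r * s))" "r \<le> p * (q * (r * s))" "s \<le> p * (q * (r * s))"
    using 1 2 3 by linarith+
qed

lemma reduction_correct:
  fixes n g b k :: nat and f :: "bits list \<Rightarrow> bool"
  assumes k: "2 \<le> k" and inst: "fk_instance k n g b Vs" and enc: "enc_instance Vs xs"
    and w: "2 * (k * b) + k + g + bitlen n + 10 \<le> w"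
  shows "\<exists>Vs' xs' t. fk_instance k n g (width prob k b) Vs' \<and> enc_instance Vs' xs' \<and>
    factored_count (prob_fun prob (width prob k b)) g Vs' = factored_count f g Vs \<and>
    t \<le> 200 * ((k + 1) * ((n * g + 1) * 2 ^ (k * b))) \<and>
    exec w (reduction prob k) (initial ([n, g, b] @ truth_table k b f @ xs)) t
      (initial ([n, g, width prob k b] @ xs'))"
proof -
  let ?Z = "2 ^ (k * b) :: nat"
  define X where "X = [n, g, b] @ truth_table k b f @ xs"
  define T where "T = (\<lambda>u. X ! (3 + u) \<noteq> 0)"
  have T: "T u \<longleftrightarrow> f (tuple_of k b u)" if "u < ?Z" for u
  proof -
    have len: "length (truth_table k b f) = ?Z" by (simp add: truth_table_def)
    have "X ! (3 + u) = truth_table k b f ! u" using that len by (simp add: X_def nth_append)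
    then show ?thesis using truth_table_nth[OF that, of f] by (simp add: T_def)
  qed
  obtain Ls where Ls: "xs = concat (map (\<lambda>L. concat (map enc_list L)) Ls)" "length Ls = k"
    "\<forall>L\<in>set Ls. valid_part n g b L"
    "enc_instance (instance_map prob k b T Vs) (concat (map2 (part_image prob k b T) [0..<k] Ls))"
    using enc_instance_map[OF k inst enc, of prob T] by blast
  define ys where "ys = [n, g, width prob k b] @ concat (map2 (part_image prob k b T) [0..<k] Ls)"
  \<comment> \<open>\<open>D\<close> bounds \<open>n\<close>, \<open>g\<close>, \<open>k\<close> and
    \<open>2 ^ (k * b)\<close> at once, and even \<open>(n * g + 1) * (k * 2 ^ (k * b))\<close>. All
    numbers that have to fit into a word are at most \<open>1000\<close> times
    \<open>2 ^ (k * b) * D\<close>, and the \<open>10\<close> in the word length provides the factor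
    \<open>1024\<close>.\<close>
  define D where "D = 2 ^ bitlen n * (2 ^ g * (2 ^ k * ?Z))"
  have Z1: "1 \<le> ?Z" by simp
  have "1 \<le> (2::nat) ^ bitlen n" "1 \<le> (2::nat) ^ g" "1 \<le> (2::nat) ^ k" by simp_all
  note D4 = le_prod4[OF this Z1, folded D_def]
  note ZD = D4(4)
  have D1: "1 \<le> D" using Z1 ZD by linarith
  have pw: "1024 * (?Z * D) \<le> 2 ^ w"
  proof -
    have "1024 * (?Z * D) = 2 ^ (2 * (k * b) + k + g + bitlen n + 10)"
    proof -
      have ten: "(2::nat) ^ 10 = 1024" by simp
      show ?thesis unfolding D_def power_add mult_2 ten by (simp only: ac_simps)
    qed
    also have "\<dots> \<le> (2::nat) ^ w" using w by (rule power_increasing) simp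
    finally show ?thesis .
  qed
  have ZDD: "D \<le> ?Z * D" "?Z * ?Z \<le> ?Z * D"
    using mult_le_mono1[OF Z1, of D] mult_le_mono2[OF ZD, of ?Z] by (simp_all only: mult_1_left)
  have big: "x < 2 ^ w" if "x \<le> 1000 * (?Z * D)" for x using that pw D1 ZDD by linarith
  have nb: "n + 1 \<le> 2 ^ bitlen n" "g + 1 \<le> 2 ^ g" "k \<le> 2 ^ k"
    using bitlen_ge[of n] less_exp[of g] less_exp[of k] by (simp_all add: Suc_leI)
  have ng: "(n * g + 1) * (k * ?Z) \<le> D"
  proof -
    have "n * g + 1 \<le> (n + 1) * (g + 1)" by simp
    also have "\<dots> \<le> 2 ^ bitlen n * 2 ^ g" by (rule mult_mono) (use nb in auto)
    finally have 1: "n * g + 1 \<le> 2 ^ bitlen n * 2 ^ g" .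
    have "(n * g + 1) * (k * ?Z) \<le> (2 ^ bitlen n * 2 ^ g) * (2 ^ k * ?Z)"
      by (intro mult_mono 1 order_refl nb) auto
    then show ?thesis by (simp only: D_def mult.assoc)
  qed
  have kZ: "1 \<le> k * ?Z" using mult_le_mono[of 1 k 1 ?Z] k Z1 by simp
  have "n * g + 1 \<le> (n * g + 1) * (k * ?Z)" using mult_le_mono2[OF kZ, of "n * g + 1"] by (simp only: mult_1_right)
  then have ngD: "n * g + 1 \<le> D" using ng by linarith
  have nD: "n \<le> D" "g \<le> D" "k \<le> D" using nb D4 by linarith+
  have kb: "k * b \<le> ?Z" using less_exp[of "k * b"] by simp
  have E: "(2::nat) ^ b \<le> ?Z" using pow_le[of 1 k b] k by simp
  have bZ: "b \<le> ?Z" using less_exp[of b] E by linarith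
  have wd: "width prob k b \<le> 3 * D" using width_le[of prob k b] kb ZD D1 by linarith
  have fits: "fits w k n g b" unfolding fits_def
    using kb nD ngD ZD ZDD by (intro conjI big) linarith+
  have entries: "x < 2 ^ w" if "x \<in> set X" for x
  proof (rule big)
    have "x \<in> {n, g, b} \<or> x \<in> set (truth_table k b f) \<or> x \<in> set xs" using that by (auto simp: X_def)
    then show "x \<le> 1000 * (?Z * D)"
    proof (elim disjE)
      assume "x \<in> {n, g, b}"
      then have "x \<le> D" using nD bZ ZD by auto
      then show ?thesis using ZDD by linarith
    next
      assume "x \<in> set (truth_table k b f)"
      then have "x \<le> 1" by (auto simp: truth_table_def)
      then show ?thesis using D1 ZDD by linarith
    next
      assume "x \<in> set xs"
      then obtain L ws where L: "L \<in> set Ls" "ws \<in> set L" "x \<in> set (enc_list ws)" unfolding Ls(1) by auto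
      then have "length ws \<le> 2 ^ b" "\<forall>z\<in>set ws. z < 2 ^ b" using Ls(3) by (auto simp: valid_part_def)
      then have "x \<le> 2 ^ b" using L(3) by (auto simp: enc_list_def)
      then show ?thesis using E ZD ZDD by linarith
    qed
  qed
  have ngZ: "n * g * (8 * ?Z) \<le> 8 * D"
  proof -
    have "1 \<le> k" using k by linarith
    from mult_le_mono1[OF this, of ?Z] have kz: "?Z \<le> k * ?Z" by (simp only: mult_1_left)
    have "n * g * ?Z \<le> (n * g + 1) * (k * ?Z)" by (rule mult_le_mono[OF le_add1 kz])
    moreover have "n * g * (8 * ?Z) = 8 * (n * g * ?Z)" by (simp only: mult.left_commute)
    ultimately show ?thesis using ng by linarith
  qed
  have entries': "y < 2 ^ w" if "y \<in> set ys" for y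
  proof (rule big)
    have "y \<in> {n, g, width prob k b} \<or> y \<in> set (concat (map2 (part_image prob k b T) [0..<k] Ls))"
      using that by (auto simp: ys_def)
    then show "y \<le> 1000 * (?Z * D)"
    proof
      assume "y \<in> {n, g, width prob k b}"
      then have "y \<le> 3 * D" using nD wd by auto
      then show ?thesis using ZDD by linarith
    next
      assume "y \<in> set (concat (map2 (part_image prob k b T) [0..<k] Ls))"
      then obtain j L where "(j, L) \<in> set (zip [0..<k] Ls)" "y \<in> set (part_image prob k b T j L)" by auto
      then have j: "j < k" "L \<in> set Ls" "y \<in> set (part_image prob k b T j L)"
        by (auto dest: set_zip_leftD set_zip_rightD)
      then obtain ws where ws: "ws \<in> set L" "y \<in> set (enc_list (set_image prob k b T j ws))"
        unfolding part_image_def by auto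
      have V: "valid_part n g b L" using Ls(3) j(2) by blast
      have "y = length (set_image prob k b T j ws) \<or> (\<exists>x\<in>set ws. y \<in> set (word_image prob k b T j x))"
        using ws(2) by (auto simp: enc_list_def set_image_def)
      then show ?thesis
      proof
        assume y: "y = length (set_image prob k b T j ws)"
        obtain L1 L2 where "L = L1 @ ws # L2" using split_list[OF ws(1)] by blast
        then have "length (enc_list (set_image prob k b T j ws)) \<le> length (part_image prob k b T j L)"
          unfolding part_image_def by simp
        then have "y \<le> n * g * (8 * ?Z)" using length_part_image[OF k V, of prob T j] y by (simp add: enc_list_def)
        then show ?thesis using ngZ ZDD by linarith
      next
        assume "\<exists>x\<in>set ws. y \<in> set (word_image prob k b T j x)"
        then obtain x where x: "x \<in> set ws" "y \<in> set (word_image prob k b T j x)" by blast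
        have "x < 2 ^ b" using V ws(1) x(1) by (auto simp: valid_part_def)
        then have "y < 2 ^ width prob k b" using word_image_less[OF k j(1) _ x(2)] by blast
        also have "\<dots> \<le> 2 ^ (2 * (k * b) + 1)" using width_le by (intro power_increasing) auto
        also have "\<dots> = 2 * (?Z * ?Z)" by (simp add: mult_2 power_add)
        finally show ?thesis using ZDD by linarith
      qed
    qed
  qed
  have W: "out_base k n g b + 3 + k * ((n * g + 1) * (8 * ?Z)) + 1 < 2 ^ w"
  proof (rule big)
    have "n * g * k * (2 ^ b + 1) \<le> n * g * k * (2 * ?Z)" using E Z1 by (intro mult_left_mono) linarith+
    also have "\<dots> = 2 * (n * g * (k * ?Z))" by (simp only: ac_simps)
    also have "\<dots> \<le> 2 * ((n * g + 1) * (k * ?Z))" by (intro mult_le_mono order_refl) (rule le_add1)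
    finally have "out_base k n g b \<le> 3 + ?Z + 2 * D" unfolding out_base_def using ng by linarith
    moreover have "k * ((n * g + 1) * (8 * ?Z)) = 8 * ((n * g + 1) * (k * ?Z))" by (simp only: ac_simps)
    ultimately show "out_base k n g b + 3 + k * ((n * g + 1) * (8 * ?Z)) + 1 \<le> 1000 * (?Z * D)"
      using ng ZD D1 ZDD by linarith
  qed
  have wdw: "width prob k b < 2 ^ w" by (rule big) (use wd ZDD in linarith)
  have Xeq: "X = [n, g, b] @ truth_table k b f @ concat (map (\<lambda>L. concat (map enc_list L)) Ls)"
    by (simp only: X_def Ls(1)[symmetric])
  have "\<exists>t \<le> 200 * ((k + 1) * ((n * g + 1) * ?Z)). exec w (reduction prob k) (initial X) t (initial ys)"
    by (rule exec_reduction[OF k Xeq _ Ls(2,3) fits _ wdw W])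
      (use entries entries' in \<open>auto simp: truth_table_def ys_def T_def\<close>)
  then obtain t where "t \<le> 200 * ((k + 1) * ((n * g + 1) * ?Z))" "exec w (reduction prob k) (initial X) t (initial ys)" by blast
  moreover have "fk_instance k n g (width prob k b) (instance_map prob k b T Vs)" by (rule fk_instance_map[OF k inst])
  moreover have "factored_count (prob_fun prob (width prob k b)) g (instance_map prob k b T Vs) = factored_count f g Vs"
    by (rule factored_count_map[where T = T, OF k inst]) (rule T)
  ultimately show ?thesis using Ls(4) unfolding X_def ys_def by blast
qed

text \<open>The program \<open>P\<close> is used twice: on the reduced instance for the answer, and
  with the parameters \<open>1\<close> and \<open>h + k\<close> merely to learn that
  \<open>T\<close> dominates the time of the reduction.\<close>

theorem fk_solvable_reduction:
  assumes k: "2 \<le> k" and solv: "fk_solvable k (\<lambda>n. prob_fun prob) (\<lambda>n b. []) (O(T))"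
  shows "Fkf_solvable k f (soft_O T)"
proof -
  obtain P where P: "\<And>g b. admissible g b \<Longrightarrow>
       (\<exists>t w. (\<lambda>n. real (t n)) \<in> O(T) \<and> (\<lambda>n. real (w n)) \<in> O(\<lambda>n. log 2 (real n)) \<and>
         (\<forall>n Vs xs. fk_instance k n (g n) (b n) Vs \<longrightarrow> enc_instance Vs xs \<longrightarrow>
            computes_within (w n) P ([n, g n, b n] @ [] @ xs) (t n) (factored_count (prob_fun prob (b n)) (g n) Vs)))"
    using solv unfolding fk_solvable_def by blast
  have "\<exists>t w. (\<lambda>n. real (t n)) \<in> soft_O T \<and> (\<lambda>n. real (w n)) \<in> O(\<lambda>n. log 2 (real n)) \<and>
         (\<forall>n Vs xs. fk_instance k n (g n) (b n) Vs \<longrightarrow> enc_instance Vs xs \<longrightarrow>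
            computes_within (w n) (Seq (reduction prob k) P) ([n, g n, b n] @ truth_table k (b n) (f n (b n)) @ xs) (t n)
              (factored_count (f n (b n)) (g n) Vs))" if adm: "admissible g b" for g b
  proof -
    obtain t1 w1 where 1: "(\<lambda>n. real (t1 n)) \<in> O(T)" "(\<lambda>n. real (w1 n)) \<in> O(\<lambda>n. log 2 (real n))"
      "\<And>n Vs xs. fk_instance k n (g n) (width prob k (b n)) Vs \<Longrightarrow> enc_instance Vs xs \<Longrightarrow>
        computes_within (w1 n) P ([n, g n, width prob k (b n)] @ xs) (t1 n)
          (factored_count (prob_fun prob (width prob k (b n))) (g n) Vs)"
      using P[OF admissible_width[OF adm, of prob k]] unfolding append_Nil by blast
    \<comment> \<open>\<open>k * b n\<close> and \<open>g n\<close> pay for the factor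
      \<open>(g n + 1) * 2 ^ (k * b n)\<close> of the running time, \<open>loglog n\<close> for
      having \<open>n\<close> different vectors, and \<open>3\<close> for the losses
      \<open>h - 1\<close>, \<open>h - 2\<close> and \<open>- 2\<close> in
      \<open>lower_bound\<close>.\<close>
    define h where "h = (\<lambda>n. k * b n + g n + loglog n + 3)"
    note small = admissible_small[OF adm]
    have kb: "(\<lambda>n. real k * real (b n)) \<in> o(\<lambda>n. log 2 (real n))" using small(2) by simp
    have "(\<lambda>n. real k * real (b n) + real (g n) + real (loglog n) + real (3 + k)) \<in> o(\<lambda>n. log 2 (real n))"
      by (intro sum_in_smallo kb small loglog_small const_small)
    then have "admissible (\<lambda>n. 1) (\<lambda>n. h n + k)"
      unfolding admissible_def h_def by (intro conjI) (real_asymp, simp add: add_ac)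
    from P[OF this] obtain t2 w2 where 2: "(\<lambda>n. real (t2 n)) \<in> O(T)"
      "\<And>n Vs xs. fk_instance k n 1 (h n + k) Vs \<Longrightarrow> enc_instance Vs xs \<Longrightarrow>
        computes_within (w2 n) P ([n, 1, h n + k] @ xs) (t2 n) (factored_count (prob_fun prob (h n + k)) 1 Vs)"
      unfolding append_Nil by blast
    define r where "r = (\<lambda>n. 200 * ((k + 1) * ((n * g n + 1) * 2 ^ (k * b n))))"
    \<comment> \<open>The summand \<open>1\<close> is absorbed by
      \<open>n * g n + 1 \<le> n * (g n + 1)\<close>, which holds for \<open>n \<ge> 1\<close>; an
      asymptotic bound asks for no more.\<close>
    have lb: "(n * g n + 1) * 2 ^ (k * b n) \<le> t2 n" if n: "1 \<le> n" for n
    proof -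
      have ll: "(2::nat) ^ loglog n \<le> 2 ^ (h n - 2)" by (intro power_increasing) (auto simp: h_def)
      then have "(2::nat) ^ 2 ^ loglog n \<le> 2 ^ 2 ^ (h n - 2)" by (intro power_increasing) auto
      then have "n \<le> 2 ^ 2 ^ (h n - 2)" using loglog_ge[of n] by linarith
      then have low: "n * (2 ^ (h n - 1) - 2) \<le> t2 n"
        by (intro lower_bound[OF k _ _ 2(2)]) (auto simp: h_def)
      have h1: "h n - 1 = Suc (h n - 2)" by (simp add: h_def)
      have "(2::nat) ^ 1 \<le> 2 ^ (h n - 2)" by (intro power_increasing) (auto simp: h_def)
      then have a: "2 ^ (h n - 2) \<le> (2::nat) ^ (h n - 1) - 2" unfolding h1 by simp
      have "(g n + 1) * 2 ^ (k * b n) \<le> 2 ^ g n * 2 ^ (k * b n)" using less_exp[of "g n"] by (intro mult_right_mono) (auto simp: Suc_le_eq)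
      also have "\<dots> = 2 ^ (g n + k * b n)" by (simp add: power_add)
      also have "\<dots> \<le> (2::nat) ^ (h n - 2)" by (intro power_increasing) (auto simp: h_def)
      finally have c: "(g n + 1) * 2 ^ (k * b n) \<le> 2 ^ (h n - 1) - 2" using a by linarith
      have "n * g n + 1 \<le> n * (g n + 1)" using n by simp
      then have "(n * g n + 1) * 2 ^ (k * b n) \<le> n * (g n + 1) * 2 ^ (k * b n)" by (rule mult_right_mono) simp
      also have "\<dots> \<le> n * (2 ^ (h n - 1) - 2)" unfolding mult.assoc using c by (rule mult_left_mono) simp
      finally show ?thesis using low by linarith
    qed
    have "(\<lambda>n. real (r n)) \<in> O(\<lambda>n. real (t2 n))"
    proof (rule bigoI[of _ "200 * (real k + 1)"])
      show "eventually (\<lambda>n. norm (real (r n)) \<le> 200 * (real k + 1) * norm (real (t2 n))) sequentially"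
      proof (rule eventually_sequentiallyI[of 1])
        fix n :: nat assume "1 \<le> n"
        from lb[OF this] have "r n \<le> 200 * ((k + 1) * t2 n)" unfolding r_def by (intro mult_left_mono) auto
        then have "real (r n) \<le> real (200 * ((k + 1) * t2 n))" by (simp only: of_nat_le_iff)
        then show "norm (real (r n)) \<le> 200 * (real k + 1) * norm (real (t2 n))" by (simp add: algebra_simps)
      qed
    qed
    then have rT: "(\<lambda>n. real (r n)) \<in> O(T)" using 2(1) by (rule landau_o.big_trans)
    define w0 where "w0 = (\<lambda>n. 2 * (k * b n) + k + g n + bitlen n + 10)"
    have "(\<lambda>n. real 2 * (real k * real (b n)) + real k + real (g n) + real (bitlen n) + 10) \<in> O(\<lambda>n. log 2 (real n))"
      using kb small(1) bitlen_bigo const_small[of "real k"] const_small[of 10]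
      by (intro sum_in_bigo) (auto intro: landau_o.small_imp_big)
    then have "(\<lambda>n. real (w0 n)) \<in> O(\<lambda>n. log 2 (real n))" by (simp add: w0_def)
    then have w: "(\<lambda>n. real (w0 n + w1 n)) \<in> O(\<lambda>n. log 2 (real n))" using 1(2) by (simp add: sum_in_bigo)
    have "(\<lambda>n. real (r n + t1 n)) \<in> O(T)" using rT 1(1) by (simp add: sum_in_bigo)
    \<comment> \<open>The exponent \<open>0\<close> is the witness: not even a logarithmic factor is
      lost.\<close>
    then have t: "(\<lambda>n. real (r n + t1 n)) \<in> soft_O T" unfolding soft_O_def by (intro UN_I[of 0]) simp_all
    have cw: "computes_within (w0 n + w1 n) (Seq (reduction prob k) P)
        ([n, g n, b n] @ truth_table k (b n) (f n (b n)) @ xs) (r n + t1 n) (factored_count (f n (b n)) (g n) Vs)"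
      if inst: "fk_instance k n (g n) (b n) Vs" and enc: "enc_instance Vs xs" for n Vs xs
    proof -
      have "2 * (k * b n) + k + g n + bitlen n + 10 \<le> w0 n + w1 n" by (simp add: w0_def)
      from reduction_correct[OF k inst enc this, of prob "f n (b n)"]
      obtain Vs' xs' ta where red: "fk_instance k n (g n) (width prob k (b n)) Vs'" "enc_instance Vs' xs'"
        "factored_count (prob_fun prob (width prob k (b n))) (g n) Vs' = factored_count (f n (b n)) (g n) Vs"
        "ta \<le> r n"
        "exec (w0 n + w1 n) (reduction prob k) (initial ([n, g n, b n] @ truth_table k (b n) (f n (b n)) @ xs)) ta
           (initial ([n, g n, width prob k (b n)] @ xs'))"
        unfolding r_def by blast
      obtain tb R M where run: "tb \<le> t1 n" "exec (w1 n) P (initial ([n, g n, width prob k (b n)] @ xs')) tb (R, M)"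
        "result_in M (factored_count (f n (b n)) (g n) Vs)"
        using 1(3)[OF red(1,2)] unfolding red(3) computes_within_def by blast
      have "exec (w0 n + w1 n) P (initial ([n, g n, width prob k (b n)] @ xs')) tb (R, M)"
        by (rule exec_word_mono[OF run(2)]) simp
      from exec.Seq[OF red(5) this] show ?thesis
        unfolding computes_within_def using red(4) run(1,3) by (meson add_mono)
    qed
    show ?thesis
      by (rule exI[of _ "\<lambda>n. r n + t1 n"], rule exI[of _ "\<lambda>n. w0 n + w1 n"]) (intro conjI allI impI t w cw)
  qed
  then show ?thesis unfolding Fkf_solvable_def fk_solvable_def by blast
qed

theorem theorem1p9:
  fixes k :: nat and T :: "nat \<Rightarrow> real"
  assumes "k \<ge> 2"
    and "FkOV_solvable k (O(T)) \<or> FkSUM_solvable k (O(T)) \<or> FkXOR_solvable k (O(T))"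
  shows "\<forall>f :: nat \<Rightarrow> nat \<Rightarrow> bits list \<Rightarrow> bool. Fkf_solvable k f (soft_O T)"
proof -
  have "\<exists>prob. fk_solvable k (\<lambda>n. prob_fun prob) (\<lambda>n b. []) (O(T))"
    using assms(2) unfolding FkOV_solvable_def FkSUM_solvable_def FkXOR_solvable_def
    by (metis prob_fun.simps)
  then show ?thesis using fk_solvable_reduction[OF assms(1)] by blast
qed

end
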